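(* Let $R$ be a root system in $\mathbb{R}^d$ with positive root system $R_+$, fundamental Weyl chamber $\mathbb{W}$, multiplicity function $k$ and $\nu=k-1/2$. Suppose that $\min_{\alpha\in R_+}\nu(\alpha)>6$ and that $b:[0,T]\times\mathbb{R}^d\to\mathbb{R}^d$ is bounded, Lipschitz continuous in space and $1/2$-Hölder continuous in time. Let $X$ be the radial Dunkl process with drift $b$ started at $x(0)\in\mathbb{W}$, and let $X_\varepsilon^{(n)}$ be its semi-implicit truncated Euler--Maruyama scheme with truncation parameter $\varepsilon$ and $n$ steps on $[0,T]$. Then for any $p\in[1,\min_{\alpha\in R_+}\nu(\alpha)/6)$ there exists $C_p>0$ such that for any $n\in\mathbb{N}$ and any $\varepsilon\in(0,\min_{\alpha\in R_+}\langle\alpha,x(0)\rangle)$ with $\Delta t=T/n<\varepsilon^2/L_k$, $$\mathbb{E}\Big[\sup_{\ell=1,\ldots,n}\big|X(t_\ell)-X_\varepsilon^{(n)}(t_\ell)\big|^p\Big]^{1/p}\le C_p\Big\{\varepsilon+\frac{1}{\sqrt n}\Big\}.$$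
   Context: A root system $R$ in $\mathbb{R}^d$ is a finite set of nonzero vectors such that (R1) $R\cap\{c\alpha: c\in\mathbb{R}\}=\{\alpha,-\alpha\}$ for every $\alpha\in R$, and (R2) $\sigma_\alpha(R)=R$ for every $\alpha\in R$, where $\sigma_\alpha(x)=x-\frac{2\langle\alpha,x\rangle}{|\alpha|^2}\alpha$. The Weyl group $W$ is the subgroup of the orthogonal group $O(d)$ generated by $\{\sigma_\alpha:\alpha\in R\}$. A positive root system $R_+$ is a subset with $R=R_+\sqcup(-R_+)$ such that $R_+$ and $-R_+$ are separated by a hyperplane through the origin containing no root. The fundamental Weyl chamber is $\mathbb{W}=\{x\in\mathbb{R}^d:\langle\alpha,x\rangle>0\ \forall\alpha\in R_+\}$. A multiplicity function is $k:R\to\mathbb{R}$ with $k(w\alpha)=k(\alpha)$ for all $w\in W$, $\alpha\in R$; $\nu(\alpha):=k(\alpha)-1/2$. Fix $T>0$, a filtered probability space $(\Omega,\mathscr{F},(\mathscr{F}_t)_{t\in[0,T]},\mathbb{P})$ satisfying the usual conditions, and a $d$-dimensional Brownian motion $B$ on it. The radial Dunkl process with drift $X$ is the (unique strong, $\mathbb{W}$-valued, continuous) solution of $$X(t)=x(0)+B(t)+\sum_{\alpha\in R_+}\int_0^t\frac{k(\alpha)}{\langle\alpha,X(s)\rangle}\alpha\,ds+\int_0^t b(s,X(s))\,ds,\quad t\in[0,T],\ x(0)\in\mathbb{W}.$$ Lipschitz in space and $1/2$-Hölder in time means $\sup_{x\ne y,\,t}\frac{|b(t,x)-b(t,y)|}{|x-y|}+\sup_{x,\,t\ne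 s}\frac{|b(t,x)-b(s,x)|}{|t-s|^{1/2}}<\infty$. For $\varepsilon>0$ let $g_\varepsilon(u)=\frac{1}{\max(u,\varepsilon)}$, $u\in\mathbb{R}$, and $f_{k,\varepsilon}(x)=\sum_{\alpha\in R_+}k(\alpha)g_\varepsilon(\langle\alpha,x\rangle)\alpha$, $x\in\mathbb{R}^d$. Put $L_k=\big(|R_+|\sum_{\alpha\in R_+}|k(\alpha)|^2|\alpha|^4\big)^{1/2}$, where $|R_+|$ is the cardinality of $R_+$. Semi-implicit truncated Euler--Maruyama scheme: $\Delta t=T/n$, $t_\ell=\ell T/n$, $\Delta B_\ell=B(t_{\ell+1})-B(t_\ell)$, $X_\varepsilon^{(n)}(0)=x(0)$, and for $\ell=0,\ldots,n-1$, $X_\varepsilon^{(n)}(t_{\ell+1})$ is the unique solution in $\mathbb{R}^d$ of $$X_\varepsilon^{(n)}(t_{\ell+1})=X_\varepsilon^{(n)}(t_\ell)+\Delta B_\ell+\big\{f_{k,\varepsilon}(X_\varepsilon^{(n)}(t_{\ell+1}))+b(t_\ell,X_\varepsilon^{(n)}(t_\ell))\big\}\Delta t$$ (which exists uniquely when $\Delta t<\varepsilon^2/L_k$). *)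

theory Defs
  imports "HOL-Probability.Probability" "HOL-Algebra.Generated_Groups"
begin

definition reflection :: "real ^ 'd \<Rightarrow> real ^ 'd \<Rightarrow> real ^ 'd" where
  "reflection \<alpha> x = x - (2 * (\<alpha> \<bullet> x) / (norm \<alpha>)\<^sup>2) *\<^sub>R \<alpha>"

definition root_system :: "(real ^ 'd) set \<Rightarrow> bool" where
  "root_system R \<longleftrightarrow> finite R \<and> 0 \<notin> R \<and>
     (\<forall>\<alpha>\<in>R. R \<inter> range (\<lambda>c::real. c *\<^sub>R \<alpha>) = {\<alpha>, - \<alpha>}) \<and>
     (\<forall>\<alpha>\<in>R. reflection \<alpha> ` R = R)"

definition orthogonal_group :: "(real ^ 'd \<Rightarrow> real ^ 'd) monoid" where
  "orthogonal_group = \<lparr>carrier = {w. orthogonal_transformation w}, monoid.mult = (\<circ>), one = id\<rparr>"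

definition weyl_group :: "(real ^ 'd) set \<Rightarrow> (real ^ 'd \<Rightarrow> real ^ 'd) set" where
  "weyl_group R = generate orthogonal_group (reflection ` R)"

definition positive_root_system :: "(real ^ 'd) set \<Rightarrow> (real ^ 'd) set \<Rightarrow> bool" where
  "positive_root_system R Rp \<longleftrightarrow> R = Rp \<union> uminus ` Rp \<and> Rp \<inter> uminus ` Rp = {} \<and>
     (\<exists>v. v \<noteq> 0 \<and> (\<forall>\<alpha>\<in>R. v \<bullet> \<alpha> \<noteq> 0) \<and>
          (\<forall>\<alpha>\<in>Rp. v \<bullet> \<alpha> > 0) \<and> (\<forall>\<alpha>\<in>uminus ` Rp. v \<bullet> \<alpha> < 0))"

definition weyl_chamber :: "(real ^ 'd) set \<Rightarrow> (real ^ 'd) set" where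
  "weyl_chamber Rp = {x. \<forall>\<alpha>\<in>Rp. \<alpha> \<bullet> x > 0}"

definition multiplicity_function :: "(real ^ 'd) set \<Rightarrow> (real ^ 'd \<Rightarrow> real) \<Rightarrow> bool" where
  "multiplicity_function R k \<longleftrightarrow> (\<forall>w\<in>weyl_group R. \<forall>\<alpha>\<in>R. k (w \<alpha>) = k \<alpha>)"

definition dunkl_nu :: "(real ^ 'd \<Rightarrow> real) \<Rightarrow> real ^ 'd \<Rightarrow> real" where
  "dunkl_nu k \<alpha> = k \<alpha> - 1 / 2"

text \<open>The filtration is indexed by \<^term>\<open>{0..T}\<close>; only the sigma-algebras of the measures
  \<^term>\<open>F t\<close> matter.\<close>

locale usual_filtered_prob_space = prob_space M + complete_measure M
  for M :: "'w measure" +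
  fixes F :: "real \<Rightarrow> 'w measure" and T :: real
  assumes subalgebra_F: "t \<in> {0..T} \<Longrightarrow> subalgebra M (F t)"
    and sets_F_mono: "0 \<le> s \<Longrightarrow> s \<le> t \<Longrightarrow> t \<le> T \<Longrightarrow> sets (F s) \<subseteq> sets (F t)"
    and null_sets_F: "null_sets M \<subseteq> sets (F 0)"
    and right_continuous_F: "0 \<le> t \<Longrightarrow> t < T \<Longrightarrow> (\<Inter>s\<in>{t<..T}. sets (F s)) = sets (F t)"

text \<open>Standard Brownian motion relative to the filtration; the increments are
  \<open>N(0, (t - s) I)\<close>-distributed (the second argument of \<^const>\<open>normal_density\<close> is the
  standard deviation).\<close>

definition brownian_motion ::
    "'w measure \<Rightarrow> (real \<Rightarrow> 'w measure) \<Rightarrow> real \<Rightarrow> (real \<Rightarrow> 'w \<Rightarrow> real ^ 'd) \<Rightarrow> bool" where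
  "brownian_motion M F T B \<longleftrightarrow>
     (\<forall>t\<in>{0..T}. B t \<in> borel_measurable (F t)) \<and>
     (AE \<omega> in M. B 0 \<omega> = 0) \<and>
     (AE \<omega> in M. continuous_on {0..T} (\<lambda>t. B t \<omega>)) \<and>
     (\<forall>s t. 0 \<le> s \<and> s < t \<and> t \<le> T \<longrightarrow>
        prob_space.indep_set M (sets (F s))
          {(\<lambda>\<omega>. B t \<omega> - B s \<omega>) -` A \<inter> space M | A. A \<in> sets borel} \<and>
        distributed M lborel (\<lambda>\<omega>. B t \<omega> - B s \<omega>)
          (\<lambda>x. ennreal (\<Prod>i\<in>UNIV. normal_density 0 (sqrt (t - s)) (x $ i))))"

text \<open>For continuous paths in the open chamber and continuous \<open>b\<close> the integrands below are
  continuous on \<^term>\<open>{0..T}\<close>, so the integrals are ordinary ones.\<close>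

definition radial_dunkl_process ::
    "'w measure \<Rightarrow> (real \<Rightarrow> 'w measure) \<Rightarrow> real \<Rightarrow> (real \<Rightarrow> 'w \<Rightarrow> real ^ 'd) \<Rightarrow>
     (real ^ 'd) set \<Rightarrow> (real ^ 'd \<Rightarrow> real) \<Rightarrow> (real \<Rightarrow> real ^ 'd \<Rightarrow> real ^ 'd) \<Rightarrow> real ^ 'd \<Rightarrow>
     (real \<Rightarrow> 'w \<Rightarrow> real ^ 'd) \<Rightarrow> bool" where
  "radial_dunkl_process M F T B Rp k b x0 X \<longleftrightarrow>
     (\<forall>t\<in>{0..T}. X t \<in> borel_measurable (F t)) \<and>
     (AE \<omega> in M. continuous_on {0..T} (\<lambda>t. X t \<omega>) \<and>
        (\<forall>t\<in>{0..T}. X t \<omega> \<in> weyl_chamber Rp \<and>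
           X t \<omega> = x0 + B t \<omega>
             + (\<Sum>\<alpha>\<in>Rp. integral {0..t} (\<lambda>s. (k \<alpha> / (\<alpha> \<bullet> X s \<omega>)) *\<^sub>R \<alpha>))
             + integral {0..t} (\<lambda>s. b s (X s \<omega>))))"

definition bounded_drift :: "real \<Rightarrow> (real \<Rightarrow> real ^ 'd \<Rightarrow> real ^ 'd) \<Rightarrow> bool" where
  "bounded_drift T b \<longleftrightarrow> bounded ((\<lambda>(t, x). b t x) ` ({0..T} \<times> UNIV))"

definition lipschitz_in_space :: "real \<Rightarrow> (real \<Rightarrow> real ^ 'd \<Rightarrow> real ^ 'd) \<Rightarrow> bool" where
  "lipschitz_in_space T b \<longleftrightarrow> (\<exists>L. \<forall>t\<in>{0..T}. L-lipschitz_on UNIV (b t))"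

definition half_hoelder_in_time :: "real \<Rightarrow> (real \<Rightarrow> real ^ 'd \<Rightarrow> real ^ 'd) \<Rightarrow> bool" where
  "half_hoelder_in_time T b \<longleftrightarrow>
     (\<exists>H. \<forall>x. \<forall>s\<in>{0..T}. \<forall>t\<in>{0..T}. norm (b t x - b s x) \<le> H * \<bar>t - s\<bar> powr (1 / 2))"

definition trunc_inverse :: "real \<Rightarrow> real \<Rightarrow> real" where
  "trunc_inverse \<epsilon> u = 1 / max u \<epsilon>"

definition trunc_drift ::
    "(real ^ 'd) set \<Rightarrow> (real ^ 'd \<Rightarrow> real) \<Rightarrow> real \<Rightarrow> real ^ 'd \<Rightarrow> real ^ 'd" where
  "trunc_drift Rp k \<epsilon> x = (\<Sum>\<alpha>\<in>Rp. (k \<alpha> * trunc_inverse \<epsilon> (\<alpha> \<bullet> x)) *\<^sub>R \<alpha>)"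

definition trunc_const :: "(real ^ 'd) set \<Rightarrow> (real ^ 'd \<Rightarrow> real) \<Rightarrow> real" where
  "trunc_const Rp k = sqrt (real (card Rp) * (\<Sum>\<alpha>\<in>Rp. \<bar>k \<alpha>\<bar>\<^sup>2 * norm \<alpha> ^ 4))"

definition grid :: "real \<Rightarrow> nat \<Rightarrow> nat \<Rightarrow> real" where
  "grid T n l = real l * T / real n"

text \<open>The scheme is defined path by path: \<open>w\<close> is a path of the Brownian motion and the value at
  \<open>l\<close> is the approximation at time \<^term>\<open>grid T n l\<close>. The description operator picks
  the solution of the implicit equation, which exists and is unique whenever
  \<^prop>\<open>T / real n < \<epsilon>\<^sup>2 / trunc_const Rp k\<close> (the right-hand side is then a contraction).\<close>

primrec em_scheme ::
    "(real ^ 'd) set \<Rightarrow> (real ^ 'd \<Rightarrow> real) \<Rightarrow> (real \<Rightarrow> real ^ 'd \<Rightarrow> real ^ 'd) \<Rightarrow> real \<Rightarrow>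
     real ^ 'd \<Rightarrow> real \<Rightarrow> nat \<Rightarrow> (real \<Rightarrow> real ^ 'd) \<Rightarrow> nat \<Rightarrow> real ^ 'd" where
  "em_scheme Rp k b T x0 \<epsilon> n w 0 = x0"
| "em_scheme Rp k b T x0 \<epsilon> n w (Suc l) =
     (THE y. y = em_scheme Rp k b T x0 \<epsilon> n w l + (w (grid T n (Suc l)) - w (grid T n l))
               + (T / real n) *\<^sub>R
                 (trunc_drift Rp k \<epsilon> y + b (grid T n l) (em_scheme Rp k b T x0 \<epsilon> n w l)))"

end

theory Submission
  imports Defs
begin

text \<open>The truncated drift is dissipative for every \<open>\<epsilon>\<close>, so the error of the implicit scheme is bounded
  path by path by the sum of the local residuals of \<open>X\<close>. By Young's inequality these have the
  right size in \<open>L\<^sup>p\<close> once the inverse powers \<open>\<langle>\<alpha>, X(t)\<rangle>\<close> to the \<open>-3p\<close> are bounded in mean, uniformly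
  in time. For this the Lyapunov function \<open>V(x) = exp (m \<Sum> (\<langle>\<alpha>, x\<rangle> - ln \<langle>\<alpha>, x\<rangle>))\<close> is used, whose image
  under the generator is at most \<open>C V\<close> as soon as \<open>m + 1 < 2 min k\<close>: the cross terms
  \<open>k(\<beta>) \<langle>\<alpha>, \<beta>\<rangle> / (\<langle>\<alpha>, x\<rangle> \<langle>\<beta>, x\<rangle>)\<close> with \<open>\<alpha> \<noteq> \<beta>\<close> sum to zero.

  No stochastic calculus is needed. On the event that the path has stayed in a box inside the
  chamber, the third-order Taylor remainder of \<open>V\<close> over a time step \<open>h\<close> is \<open>O(h\<^sup>3\<^sup>/\<^sup>2)\<close> in mean, and
  independence of the increments evaluates the second-order polynomial. This polynomial is
  nonnegative, so dropping the paths that leave the box in a step costs only \<open>C h\<close> times their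
  probability. Letting \<open>h \<rightarrow> 0\<close> and then exhausting the chamber by boxes gives the moment bound.\<close>

section \<open>Root systems\<close>

text \<open>The Lyapunov function is a product over all positive roots because a single inverse
  pairing cannot be controlled: applied to one power of \<open>\<alpha> \<bullet> x\<close>, the
  generator leaves mixed terms of either sign. In the symmetric sum they cancel, since reflections
  permute the roots and preserve \<open>k\<close>. The exponent \<open>3 * p\<close> stems from the
  drift residual, which contains an increment of \<open>X\<close> times two inverse pairings, each
  of these three factors being measured in the mean of order \<open>3 * p\<close>. An increment over
  time \<open>h\<close> has size \<open>sqrt h\<close>, so a residual has size
  \<open>h * (\<epsilon> + sqrt h)\<close>, and \<open>T / h\<close> of them add up to the claimed
  rate. Since the supremum over the grid is dominated path by path, moments at fixed times are
  enough. Localisation is unavoidable, because neither the Lyapunov function nor its third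
  derivatives are bounded on the chamber. The event of having stayed in the box up to time
  \<open>s\<close> is known at time \<open>s\<close> and compatible with independence; the same
  event at time \<open>s + h\<close> is not, and replacing one by the other is the point where the
  sign of the polynomial matters.\<close>

lemma exists_avoiding_hyperplanes:
  fixes A :: "'a::euclidean_space set"
  assumes "finite A" "0 \<notin> A"
  shows "\<exists>y. \<forall>a\<in>A. a \<bullet> y \<noteq> 0"
  using assms
proof (induction A rule: finite_induct)
  case empty
  then show ?case by simp
next
  case (insert a A)
  then obtain y where y: "\<forall>c\<in>A. c \<bullet> y \<noteq> 0" by auto
  \<comment> \<open>The parameters \<open>t\<close> at which \<open>y + t *\<^sub>R a\<close> enters
    one of the hyperplanes. A hyperplane with \<open>c \<bullet> a = 0\<close> is parallel to the
    direction of motion, so \<open>y\<close> keeps avoiding it.\<close>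
  let ?bad = "(\<lambda>c. - (c \<bullet> y) / (c \<bullet> a)) ` insert a A"
  have "finite ?bad" using insert by auto
  then obtain t where t: "t \<notin> ?bad" "t \<noteq> 0"
    using ex_new_if_finite[of "insert (0::real) ?bad"] by (auto simp: infinite_UNIV_char_0)
  have "c \<bullet> (y + t *\<^sub>R a) \<noteq> 0" if "c \<in> insert a A" for c
  proof (cases "c \<bullet> a = 0")
    case True
    then have "c \<noteq> a" using insert.prems by auto
    then show ?thesis using True y that by (auto simp: inner_add_right)
  next
    case False
    show ?thesis
    proof
      assume "c \<bullet> (y + t *\<^sub>R a) = 0"
      then have "t = - (c \<bullet> y) / (c \<bullet> a)"
        using False by (simp add: inner_add_right field_simps)
      then show False using t(1) that by blast
    qed
  qed
  then show ?case by blast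
qed

context
  fixes R Rp :: "(real ^ 'd) set"
  assumes R: "root_system R" and Rp: "positive_root_system R Rp"
begin

lemma root_finite: "finite R" "finite Rp"
  using R Rp by (auto simp: root_system_def positive_root_system_def)

lemma root_nonzero: "\<alpha> \<in> R \<Longrightarrow> \<alpha> \<noteq> 0"
  using R by (auto simp: root_system_def)

lemma pos_root: "Rp \<subseteq> R"
  using Rp by (auto simp: positive_root_system_def)

lemma root_reflection: "\<alpha> \<in> R \<Longrightarrow> \<beta> \<in> R \<Longrightarrow> reflection \<alpha> \<beta> \<in> R"
  using R by (auto simp: root_system_def)

lemma reflection_self: "\<alpha> \<in> R \<Longrightarrow> reflection \<alpha> \<alpha> = - \<alpha>"
  using root_nonzero by (simp add: reflection_def power2_norm_eq_inner scaleR_2)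

lemma reflection_involution: "\<alpha> \<noteq> 0 \<Longrightarrow> reflection \<alpha> (reflection \<alpha> x) = x"
  unfolding reflection_def power2_norm_eq_inner
  by (simp add: inner_diff_right algebra_simps)

lemma reflection_uminus: "reflection \<alpha> (- x) = - reflection \<alpha> x"
  unfolding reflection_def by simp

text \<open>Reflections permute \<open>R\<close> but not \<open>Rp\<close>. For even summands a sum
  over \<open>Rp\<close> can thus be evaluated over the whole root system, where reindexing by a
  reflection is possible.\<close>

lemma sum_roots_even:
  fixes G :: "real ^ 'd \<Rightarrow> real"
  assumes "\<And>\<alpha>. \<alpha> \<in> R \<Longrightarrow> G (- \<alpha>) = G \<alpha>"
  shows "sum G R = 2 * sum G Rp"
proof -
  have "sum G R = sum G Rp + sum G (uminus ` Rp)"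
    using Rp root_finite by (auto simp: positive_root_system_def sum.union_disjoint)
  also have "sum G (uminus ` Rp) = sum G Rp"
    using assms pos_root by (auto simp: sum.reindex intro!: sum.cong)
  finally show ?thesis by simp
qed

text \<open>The line through a root contains only this root and its negative, and positivity
  excludes the negative.\<close>

lemma pos_roots_not_parallel:
  assumes "\<alpha> \<in> Rp" "\<beta> \<in> Rp" "\<alpha> \<noteq> \<beta>"
  shows "\<beta> \<noteq> c *\<^sub>R \<alpha>"
proof
  assume "\<beta> = c *\<^sub>R \<alpha>"
  then have "\<beta> \<in> R \<inter> range (\<lambda>c::real. c *\<^sub>R \<alpha>)" using assms pos_root by auto
  moreover have "\<alpha> \<in> R" using assms pos_root by auto
  ultimately have "\<beta> \<in> {\<alpha>, - \<alpha>}" using R unfolding root_system_def by metis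
  then show False using assms Rp by (auto simp: positive_root_system_def)
qed

context
  fixes k :: "real ^ 'd \<Rightarrow> real"
  assumes k: "multiplicity_function R k"
begin

lemma mult_reflection: "\<alpha> \<in> R \<Longrightarrow> \<beta> \<in> R \<Longrightarrow> k (reflection \<alpha> \<beta>) = k \<beta>"
  using k unfolding multiplicity_function_def weyl_group_def
  by (auto intro: generate.incl)

lemma mult_uminus: "\<alpha> \<in> R \<Longrightarrow> k (- \<alpha>) = k \<alpha>"
  using mult_reflection reflection_self by metis

text \<open>On the hyperplane orthogonal to \<open>\<beta>\<close> the reflection in \<open>\<beta>\<close> preserves the denominators and
  flips the sign of the numerators.\<close>

lemma hyperplane_sum_zero:
  assumes \<beta>: "\<beta> \<in> Rp" and x: "\<beta> \<bullet> x = 0"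
  shows "(\<Sum>\<alpha>\<in>Rp - {\<beta>}. k \<alpha> * (\<alpha> \<bullet> \<beta>) / (\<alpha> \<bullet> x)) = 0"
proof -
  \<comment> \<open>The terms at \<open>\<beta>\<close> and its negative, whose denominators vanish,
    are set to zero. The result is even in \<open>\<alpha>\<close> and changes sign under the
    reflection, so its sum over \<open>R\<close> equals its own negative.\<close>
  let ?G = "\<lambda>\<alpha>. if \<alpha> = \<beta> \<or> \<alpha> = - \<beta> then 0 else k \<alpha> * (\<alpha> \<bullet> \<beta>) / (\<alpha> \<bullet> x)"
  have \<beta>R: "\<beta> \<in> R" using \<beta> pos_root by auto
  have nz: "\<beta> \<noteq> 0" by (rule root_nonzero[OF \<beta>R])
  have neg: "reflection \<beta> \<alpha> = \<beta> \<longleftrightarrow> \<alpha> = - \<beta>" "reflection \<beta> \<alpha> = - \<beta> \<longleftrightarrow> \<alpha> = \<beta>" for \<alpha>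
    using reflection_self[OF \<beta>R] reflection_involution[OF nz] reflection_uminus by metis+
  have G: "?G (reflection \<beta> \<alpha>) = - ?G \<alpha>" if "\<alpha> \<in> R" for \<alpha>
  proof -
    have 1: "reflection \<beta> \<alpha> \<bullet> \<beta> = - (\<alpha> \<bullet> \<beta>)"
      using nz by (simp add: reflection_def inner_diff_left power2_norm_eq_inner inner_commute[of \<beta> \<alpha>])
    have 2: "reflection \<beta> \<alpha> \<bullet> x = \<alpha> \<bullet> x"
      using x by (simp add: reflection_def inner_diff_left)
    show ?thesis unfolding neg 1 2 using mult_reflection[OF \<beta>R that] by auto
  qed
  have inj: "inj_on (reflection \<beta>) R"
    using reflection_involution[OF nz] by (metis inj_onI)
  have im: "reflection \<beta> ` R = R" using R \<beta>R by (auto simp: root_system_def)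
  have "sum ?G R = sum ?G (reflection \<beta> ` R)" using im by simp
  also have "\<dots> = (\<Sum>\<alpha>\<in>R. ?G (reflection \<beta> \<alpha>))" by (simp only: sum.reindex[OF inj] o_def)
  also have "\<dots> = - sum ?G R"
    using G by (simp only: sum_negf[symmetric] cong: sum.cong)
  finally have "sum ?G R = 0" by simp
  moreover have "sum ?G R = 2 * sum ?G Rp"
    by (rule sum_roots_even) (auto simp: mult_uminus)
  ultimately have "sum ?G Rp = 0" by simp
  also have "sum ?G Rp = sum ?G (Rp - {\<beta>})"
    using \<beta> root_finite by (intro sum.mono_neutral_right) auto
  also have "\<dots> = (\<Sum>\<alpha>\<in>Rp - {\<beta>}. k \<alpha> * (\<alpha> \<bullet> \<beta>) / (\<alpha> \<bullet> x))"
    using \<beta> Rp by (intro sum.cong) (auto simp: positive_root_system_def)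
  finally show ?thesis by simp
qed

end

end

text \<open>Partial fractions along a line through \<open>x\<close> that meets the root hyperplanes in
  distinct points reduce the off-diagonal terms to the hyperplane sums above.\<close>

lemma log_gradient_inner:
  fixes R Rp :: "(real ^ 'd) set" and k :: "real ^ 'd \<Rightarrow> real"
  assumes R: "root_system R" and Rp: "positive_root_system R Rp"
    and k: "multiplicity_function R k"
    and x: "\<And>\<alpha>. \<alpha> \<in> Rp \<Longrightarrow> \<alpha> \<bullet> x \<noteq> 0"
  shows "(\<Sum>\<alpha>\<in>Rp. (1 / (\<alpha> \<bullet> x)) *\<^sub>R \<alpha>) \<bullet> (\<Sum>\<beta>\<in>Rp. (k \<beta> / (\<beta> \<bullet> x)) *\<^sub>R \<beta>) =
    (\<Sum>\<beta>\<in>Rp. k \<beta> * (norm \<beta>)\<^sup>2 / (\<beta> \<bullet> x)\<^sup>2)"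
proof -
  note fin_Rp = root_finite(2)[OF R Rp]
  \<comment> \<open>A direction \<open>y\<close> orthogonal to none of these vectors makes the line
    through \<open>x\<close> meet the hyperplanes of different positive roots in different
    points.\<close>
  let ?A = "(\<lambda>(\<alpha>, \<beta>). (\<alpha> \<bullet> x) *\<^sub>R \<beta> - (\<beta> \<bullet> x) *\<^sub>R \<alpha>) ` {(\<alpha>, \<beta>). \<alpha> \<in> Rp \<and> \<beta> \<in> Rp \<and> \<alpha> \<noteq> \<beta>}"
  have "finite {(\<alpha>, \<beta>). \<alpha> \<in> Rp \<and> \<beta> \<in> Rp \<and> \<alpha> \<noteq> \<beta>}"
    by (rule finite_subset[of _ "Rp \<times> Rp"]) (use fin_Rp in auto)
  then have fin: "finite ?A" by (rule finite_imageI)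
  have "0 \<notin> ?A"
  proof
    assume "0 \<in> ?A"
    then obtain \<alpha> \<beta> where ab: "\<alpha> \<in> Rp" "\<beta> \<in> Rp" "\<alpha> \<noteq> \<beta>"
      and eq: "(\<alpha> \<bullet> x) *\<^sub>R \<beta> = (\<beta> \<bullet> x) *\<^sub>R \<alpha>" by auto
    from eq have "(1 / (\<alpha> \<bullet> x)) *\<^sub>R (\<alpha> \<bullet> x) *\<^sub>R \<beta> = (1 / (\<alpha> \<bullet> x)) *\<^sub>R (\<beta> \<bullet> x) *\<^sub>R \<alpha>" by simp
    then have "\<beta> = ((\<beta> \<bullet> x) / (\<alpha> \<bullet> x)) *\<^sub>R \<alpha>"
      using x[OF ab(1)] by simp
    then show False using pos_roots_not_parallel[OF R Rp ab] by blast
  qed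
  then obtain y where y: "\<forall>a\<in>?A. a \<bullet> y \<noteq> 0"
    using exists_avoiding_hyperplanes[OF fin] by blast
  define D where "D \<alpha> \<beta> = (\<alpha> \<bullet> x) * (\<beta> \<bullet> y) - (\<beta> \<bullet> x) * (\<alpha> \<bullet> y)" for \<alpha> \<beta>
  have D: "D \<alpha> \<beta> \<noteq> 0" if "\<alpha> \<in> Rp" "\<beta> \<in> Rp" "\<alpha> \<noteq> \<beta>" for \<alpha> \<beta>
    using y that by (force simp: D_def inner_diff_left)
  \<comment> \<open>Partial fractions: \<open>W \<alpha> \<beta>\<close> is the part of
    \<open>(\<alpha> \<bullet> \<beta>) / ((\<alpha> \<bullet> x) * (\<beta> \<bullet> x))\<close>
    that has its pole on the hyperplane of \<open>\<beta>\<close>.\<close>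
  define W where "W \<alpha> \<beta> = (\<alpha> \<bullet> \<beta>) / D \<alpha> \<beta> * ((\<beta> \<bullet> y) / (\<beta> \<bullet> x))" for \<alpha> \<beta>
  have split: "(\<alpha> \<bullet> \<beta>) / ((\<alpha> \<bullet> x) * (\<beta> \<bullet> x)) = W \<alpha> \<beta> + W \<beta> \<alpha>"
    if "\<alpha> \<in> Rp" "\<beta> \<in> Rp" "\<alpha> \<noteq> \<beta>" for \<alpha> \<beta>
  proof -
    have "D \<beta> \<alpha> = - D \<alpha> \<beta>" by (simp add: D_def)
    then have "W \<alpha> \<beta> + W \<beta> \<alpha> = (\<alpha> \<bullet> \<beta>) / D \<alpha> \<beta> * ((\<beta> \<bullet> y) / (\<beta> \<bullet> x) - (\<alpha> \<bullet> y) / (\<alpha> \<bullet> x))"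
      by (simp add: W_def inner_commute right_diff_distrib)
    also have "(\<beta> \<bullet> y) / (\<beta> \<bullet> x) - (\<alpha> \<bullet> y) / (\<alpha> \<bullet> x) = D \<alpha> \<beta> / ((\<alpha> \<bullet> x) * (\<beta> \<bullet> x))"
      using x[OF that(1)] x[OF that(2)] by (simp add: D_def field_simps)
    finally show ?thesis using D[OF that] by simp
  qed
  have hz: "(\<Sum>\<alpha>\<in>Rp - {\<beta>}. k' \<alpha> * (\<alpha> \<bullet> \<beta>) / D \<alpha> \<beta>) = 0"
    if "\<beta> \<in> Rp" "multiplicity_function R k'" for \<beta> k'
  proof -
    \<comment> \<open>Where the line meets the hyperplane of \<open>\<beta>\<close>, this vector is
      proportional to the point of intersection. Its pairing with \<open>\<alpha>\<close> is exactly
      \<open>D \<alpha> \<beta>\<close>.\<close>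
    have "\<beta> \<bullet> ((\<beta> \<bullet> y) *\<^sub>R x - (\<beta> \<bullet> x) *\<^sub>R y) = 0"
      by (simp add: inner_diff_right)
    from hyperplane_sum_zero[OF R Rp that(2,1) this] show ?thesis
      by (simp add: D_def inner_diff_right mult.commute)
  qed
  have one: "multiplicity_function R (\<lambda>_. 1)" by (simp add: multiplicity_function_def)
  \<comment> \<open>The inner sum runs over \<open>\<alpha>\<close> with \<open>k \<beta>\<close> as
    a common factor, so the hyperplane identity is taken for constant multiplicity one. After the
    exchange of sums, \<open>off2\<close> keeps \<open>k\<close> inside and takes the identity for
    \<open>k\<close> itself.\<close>
  have off1: "(\<Sum>\<beta>\<in>Rp. \<Sum>\<alpha>\<in>Rp - {\<beta>}. k \<beta> * W \<alpha> \<beta>) = 0"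
  proof (rule sum.neutral, rule ballI)
    fix \<beta> assume "\<beta> \<in> Rp"
    have "(\<Sum>\<alpha>\<in>Rp - {\<beta>}. k \<beta> * W \<alpha> \<beta>) =
        (k \<beta> * ((\<beta> \<bullet> y) / (\<beta> \<bullet> x))) * (\<Sum>\<alpha>\<in>Rp - {\<beta>}. 1 * (\<alpha> \<bullet> \<beta>) / D \<alpha> \<beta>)"
      unfolding sum_distrib_left by (intro sum.cong) (auto simp: W_def mult_ac)
    then show "(\<Sum>\<alpha>\<in>Rp - {\<beta>}. k \<beta> * W \<alpha> \<beta>) = 0"
      using hz[OF \<open>\<beta> \<in> Rp\<close> one] by simp
  qed
  have swap: "(\<Sum>\<beta>\<in>Rp. \<Sum>\<alpha>\<in>Rp - {\<beta>}. G \<alpha> \<beta>) = (\<Sum>\<alpha>\<in>Rp. \<Sum>\<beta>\<in>Rp - {\<alpha>}. G \<alpha> \<beta>)"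
    for G :: "real ^ 'd \<Rightarrow> real ^ 'd \<Rightarrow> real"
  proof -
    have "(\<Sum>\<beta>\<in>Rp. \<Sum>\<alpha>\<in>Rp - {\<beta>}. G \<alpha> \<beta>) = (\<Sum>\<beta>\<in>Rp. \<Sum>\<alpha>\<in>Rp. if \<alpha> \<noteq> \<beta> then G \<alpha> \<beta> else 0)"
      using fin_Rp by (intro sum.cong[OF refl] sum.mono_neutral_cong_left) auto
    also have "\<dots> = (\<Sum>\<alpha>\<in>Rp. \<Sum>\<beta>\<in>Rp. if \<alpha> \<noteq> \<beta> then G \<alpha> \<beta> else 0)" by (rule sum.swap)
    also have "\<dots> = (\<Sum>\<alpha>\<in>Rp. \<Sum>\<beta>\<in>Rp - {\<alpha>}. G \<alpha> \<beta>)"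
      using fin_Rp by (intro sum.cong[OF refl] sum.mono_neutral_cong_right) auto
    finally show ?thesis .
  qed
  have off2: "(\<Sum>\<beta>\<in>Rp. \<Sum>\<alpha>\<in>Rp - {\<beta>}. k \<beta> * W \<beta> \<alpha>) = 0"
  proof (subst swap, rule sum.neutral, rule ballI)
    fix \<alpha> assume "\<alpha> \<in> Rp"
    have "(\<Sum>\<beta>\<in>Rp - {\<alpha>}. k \<beta> * W \<beta> \<alpha>) =
        ((\<alpha> \<bullet> y) / (\<alpha> \<bullet> x)) * (\<Sum>\<beta>\<in>Rp - {\<alpha>}. k \<beta> * (\<beta> \<bullet> \<alpha>) / D \<beta> \<alpha>)"
      unfolding sum_distrib_left by (intro sum.cong) (auto simp: W_def mult_ac)
    then show "(\<Sum>\<beta>\<in>Rp - {\<alpha>}. k \<beta> * W \<beta> \<alpha>) = 0"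
      using hz[OF \<open>\<alpha> \<in> Rp\<close> k] by simp
  qed
  let ?G = "\<lambda>\<alpha> \<beta>. k \<beta> * ((\<alpha> \<bullet> \<beta>) / ((\<alpha> \<bullet> x) * (\<beta> \<bullet> x)))"
  have "(\<Sum>\<alpha>\<in>Rp. (1 / (\<alpha> \<bullet> x)) *\<^sub>R \<alpha>) \<bullet> (\<Sum>\<beta>\<in>Rp. (k \<beta> / (\<beta> \<bullet> x)) *\<^sub>R \<beta>) =
      (\<Sum>\<beta>\<in>Rp. \<Sum>\<alpha>\<in>Rp. ?G \<alpha> \<beta>)"
    unfolding inner_sum_left inner_sum_right
    by (auto intro!: sum.cong simp: field_simps)
  also have "\<dots> = (\<Sum>\<beta>\<in>Rp. ?G \<beta> \<beta> + (\<Sum>\<alpha>\<in>Rp - {\<beta>}. ?G \<alpha> \<beta>))"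
    using fin_Rp by (intro sum.cong[OF refl] sum.remove) auto
  also have "\<dots> = (\<Sum>\<beta>\<in>Rp. ?G \<beta> \<beta>) + (\<Sum>\<beta>\<in>Rp. \<Sum>\<alpha>\<in>Rp - {\<beta>}. k \<beta> * W \<alpha> \<beta> + k \<beta> * W \<beta> \<alpha>)"
    unfolding sum.distrib[of "\<lambda>\<beta>. ?G \<beta> \<beta>"]
    by (intro arg_cong2[where f="(+)"] sum.cong refl) (auto simp: split distrib_left)
  also have "\<dots> = (\<Sum>\<beta>\<in>Rp. ?G \<beta> \<beta>)"
    using off1 off2 by (simp add: sum.distrib)
  also have "\<dots> = (\<Sum>\<beta>\<in>Rp. k \<beta> * (norm \<beta>)\<^sup>2 / (\<beta> \<bullet> x)\<^sup>2)"
    unfolding power2_norm_eq_inner by (intro sum.cong) (auto simp: power2_eq_square)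
  finally show ?thesis .
qed

section \<open>The implicit truncated scheme\<close>

text \<open>Keeping both maxima serves two estimates: bounded below by \<open>\<epsilon>\<close>
  they give a Lipschitz constant, bounded below by \<open>u\<close> and \<open>v\<close> they give
  an estimate free of negative powers of \<open>\<epsilon>\<close>.\<close>

lemma trunc_inverse_diff:
  assumes "\<epsilon> > 0"
  shows "\<bar>trunc_inverse \<epsilon> u - trunc_inverse \<epsilon> v\<bar> \<le> \<bar>u - v\<bar> / (max u \<epsilon> * max v \<epsilon>)"
proof -
  have pos: "max u \<epsilon> > 0" "max v \<epsilon> > 0" using assms by auto
  have "\<bar>trunc_inverse \<epsilon> u - trunc_inverse \<epsilon> v\<bar> = \<bar>max v \<epsilon> - max u \<epsilon>\<bar> / (max u \<epsilon> * max v \<epsilon>)"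
    unfolding trunc_inverse_def using pos by (simp add: abs_div_pos[symmetric] field_simps)
  also have "\<dots> \<le> \<bar>u - v\<bar> / (max u \<epsilon> * max v \<epsilon>)"
    using pos by (intro divide_right_mono) auto
  finally show ?thesis .
qed

lemma trunc_inverse_lipschitz:
  assumes "\<epsilon> > 0"
  shows "\<bar>trunc_inverse \<epsilon> u - trunc_inverse \<epsilon> v\<bar> \<le> \<bar>u - v\<bar> / \<epsilon>\<^sup>2"
proof -
  have "\<bar>u - v\<bar> / (max u \<epsilon> * max v \<epsilon>) \<le> \<bar>u - v\<bar> / (\<epsilon> * \<epsilon>)"
    using assms by (intro frac_le mult_mono) auto
  then show ?thesis using trunc_inverse_diff[OF assms, of u v] by (simp add: power2_eq_square)
qed

lemma trunc_inverse_antimono: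
  assumes "\<epsilon> > 0"
  shows "(u - v) * (trunc_inverse \<epsilon> u - trunc_inverse \<epsilon> v) \<le> 0"
proof -
  have "trunc_inverse \<epsilon> u \<le> trunc_inverse \<epsilon> v" if "v \<le> u" for u v
    unfolding trunc_inverse_def using that assms by (intro divide_left_mono) auto
  then show ?thesis
    by (metis (no_types, opaque_lifting) diff_ge_0_iff_ge diff_le_0_iff_le linorder_linear
        mult_nonneg_nonpos mult_nonpos_nonneg)
qed

text \<open>\<open>trunc_inverse \<epsilon>\<close> is decreasing, so every root contributes a
  nonpositive term. Unlike the Lipschitz constant, this one-sided bound does not deteriorate as
  \<open>\<epsilon>\<close> tends to zero.\<close>

lemma trunc_drift_monotone:
  assumes "\<epsilon> > 0" "\<And>\<alpha>. \<alpha> \<in> Rp \<Longrightarrow> 0 \<le> k \<alpha>"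
  shows "(x - y) \<bullet> (trunc_drift Rp k \<epsilon> x - trunc_drift Rp k \<epsilon> y) \<le> 0"
proof -
  have "(x - y) \<bullet> (trunc_drift Rp k \<epsilon> x - trunc_drift Rp k \<epsilon> y) =
      (\<Sum>\<alpha>\<in>Rp. k \<alpha> * ((\<alpha> \<bullet> x - \<alpha> \<bullet> y) *
        (trunc_inverse \<epsilon> (\<alpha> \<bullet> x) - trunc_inverse \<epsilon> (\<alpha> \<bullet> y))))"
    unfolding trunc_drift_def sum_subtractf[symmetric] inner_sum_right
    by (intro sum.cong refl) (simp add: inner_diff_left inner_diff_right inner_commute[of x] inner_commute[of y] algebra_simps)
  also have "\<dots> \<le> 0"
    by (rule sum_nonpos, rule mult_nonneg_nonpos, rule assms(2), assumption,
        rule trunc_inverse_antimono, rule assms(1))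
  finally show ?thesis .
qed

lemma trunc_drift_lipschitz:
  assumes "\<epsilon> > 0"
  shows "norm (trunc_drift Rp k \<epsilon> x - trunc_drift Rp k \<epsilon> y) \<le> trunc_const Rp k / \<epsilon>\<^sup>2 * norm (x - y)"
proof -
  have "norm (trunc_drift Rp k \<epsilon> x - trunc_drift Rp k \<epsilon> y) \<le>
      (\<Sum>\<alpha>\<in>Rp. norm ((k \<alpha> * (trunc_inverse \<epsilon> (\<alpha> \<bullet> x) - trunc_inverse \<epsilon> (\<alpha> \<bullet> y))) *\<^sub>R \<alpha>))"
    unfolding trunc_drift_def sum_subtractf[symmetric]
    by (rule order_trans[OF _ norm_sum]) (simp add: algebra_simps)
  \<comment> \<open>The factor \<open>1\<close> is the second vector of the Cauchy--Schwarz
    inequality over the roots, which produces the factor \<open>card Rp\<close> in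
    \<open>trunc_const\<close>.\<close>
  also have "\<dots> \<le> (\<Sum>\<alpha>\<in>Rp. (norm (x - y) / \<epsilon>\<^sup>2) * (1 * (\<bar>k \<alpha>\<bar> * (norm \<alpha>)\<^sup>2)))"
  proof (rule sum_mono)
    fix \<alpha>
    have "\<bar>trunc_inverse \<epsilon> (\<alpha> \<bullet> x) - trunc_inverse \<epsilon> (\<alpha> \<bullet> y)\<bar> \<le> \<bar>\<alpha> \<bullet> (x - y)\<bar> / \<epsilon>\<^sup>2"
      using trunc_inverse_lipschitz[OF assms] by (simp add: inner_diff_right)
    also have "\<dots> \<le> norm \<alpha> * norm (x - y) / \<epsilon>\<^sup>2"
      by (intro divide_right_mono Cauchy_Schwarz_ineq2) auto
    finally have "\<bar>k \<alpha>\<bar> * \<bar>trunc_inverse \<epsilon> (\<alpha> \<bullet> x) - trunc_inverse \<epsilon> (\<alpha> \<bullet> y)\<bar> * norm \<alpha> \<le>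
        \<bar>k \<alpha>\<bar> * (norm \<alpha> * norm (x - y) / \<epsilon>\<^sup>2) * norm \<alpha>"
      by (intro mult_mono) auto
    then show "norm ((k \<alpha> * (trunc_inverse \<epsilon> (\<alpha> \<bullet> x) - trunc_inverse \<epsilon> (\<alpha> \<bullet> y))) *\<^sub>R \<alpha>) \<le>
        (norm (x - y) / \<epsilon>\<^sup>2) * (1 * (\<bar>k \<alpha>\<bar> * (norm \<alpha>)\<^sup>2))"
      by (simp add: abs_mult power2_eq_square mult_ac)
  qed
  also have "\<dots> = (norm (x - y) / \<epsilon>\<^sup>2) * (\<Sum>\<alpha>\<in>Rp. 1 * (\<bar>k \<alpha>\<bar> * (norm \<alpha>)\<^sup>2))"
    by (simp only: sum_distrib_left)
  also have "\<dots> \<le> (norm (x - y) / \<epsilon>\<^sup>2) * trunc_const Rp k"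
    unfolding trunc_const_def
  proof (rule mult_left_mono)
    show "(\<Sum>\<alpha>\<in>Rp. 1 * (\<bar>k \<alpha>\<bar> * (norm \<alpha>)\<^sup>2)) \<le>
      sqrt (real (card Rp) * (\<Sum>\<alpha>\<in>Rp. \<bar>k \<alpha>\<bar>\<^sup>2 * norm \<alpha> ^ 4))"
  proof (rule real_le_rsqrt)
    have "(\<Sum>\<alpha>\<in>Rp. 1 * (\<bar>k \<alpha>\<bar> * (norm \<alpha>)\<^sup>2))\<^sup>2 \<le>
        (\<Sum>\<alpha>\<in>Rp. 1\<^sup>2) * (\<Sum>\<alpha>\<in>Rp. (\<bar>k \<alpha>\<bar> * (norm \<alpha>)\<^sup>2)\<^sup>2)"
      by (rule Cauchy_Schwarz_ineq_sum)
    then show "(\<Sum>\<alpha>\<in>Rp. 1 * (\<bar>k \<alpha>\<bar> * (norm \<alpha>)\<^sup>2))\<^sup>2 \<le>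
        real (card Rp) * (\<Sum>\<alpha>\<in>Rp. \<bar>k \<alpha>\<bar>\<^sup>2 * norm \<alpha> ^ 4)"
      by (simp add: power_mult_distrib)
  qed
  qed simp
  finally show ?thesis by (simp add: mult_ac)
qed

text \<open>The right-hand side is a contraction with ratio
  \<open>h * trunc_const Rp k / \<epsilon>\<^sup>2\<close>. The step condition is multiplied out, so
  that it stays meaningful when \<open>trunc_const\<close> vanishes.\<close>

lemma implicit_step_ex1:
  assumes "\<epsilon> > 0" "0 \<le> h" "h * trunc_const Rp k < \<epsilon>\<^sup>2"
  shows "\<exists>!y. y = u + v + h *\<^sub>R (trunc_drift Rp k \<epsilon> y + c)"
proof -
  let ?\<Phi> = "\<lambda>y. u + v + h *\<^sub>R (trunc_drift Rp k \<epsilon> y + c)"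
  have "trunc_const Rp k \<ge> 0" by (simp add: trunc_const_def sum_nonneg)
  then have "0 \<le> h * trunc_const Rp k / \<epsilon>\<^sup>2" using assms by simp
  moreover have "h * trunc_const Rp k / \<epsilon>\<^sup>2 < 1" using assms by (simp add: field_simps)
  moreover have "dist (?\<Phi> x) (?\<Phi> y) \<le> h * trunc_const Rp k / \<epsilon>\<^sup>2 * dist x y" for x y
  proof -
    have "dist (?\<Phi> x) (?\<Phi> y) = h * norm (trunc_drift Rp k \<epsilon> x - trunc_drift Rp k \<epsilon> y)"
      using assms(2) by (simp add: dist_norm scaleR_diff_right[symmetric])
    also have "\<dots> \<le> h * (trunc_const Rp k / \<epsilon>\<^sup>2 * norm (x - y))"
      by (intro mult_left_mono trunc_drift_lipschitz assms)
    finally show ?thesis by (simp add: dist_norm mult_ac)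
  qed
  ultimately have "\<exists>!y. ?\<Phi> y = y"
    by (intro banach_fix_type) auto
  then show ?thesis by metis
qed

lemma em_scheme_step:
  fixes w :: "real \<Rightarrow> real ^ 'd" and x0 :: "real ^ 'd"
    and b :: "real \<Rightarrow> real ^ 'd \<Rightarrow> real ^ 'd"
  assumes "\<epsilon> > 0" "T \<ge> 0" "T / real n * trunc_const Rp k < \<epsilon>\<^sup>2"
  defines "y \<equiv> em_scheme Rp k b T x0 \<epsilon> n w"
  shows "y (Suc l) = y l + (w (grid T n (Suc l)) - w (grid T n l))
      + (T / real n) *\<^sub>R (trunc_drift Rp k \<epsilon> (y (Suc l)) + b (grid T n l) (y l))"
  unfolding y_def em_scheme.simps(2)
  by (rule theI'[OF implicit_step_ex1]) (use assms in auto)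

text \<open>In the inner product with \<open>y - y'\<close> the drift difference contributes a
  nonpositive term. Solving the implicit equation is therefore nonexpansive, whatever the values of
  \<open>h\<close> and \<open>\<epsilon>\<close>.\<close>

lemma implicit_step_diff:
  fixes u :: "real ^ 'd"
  assumes "\<epsilon> > 0" "0 \<le> h" "\<And>\<alpha>. \<alpha> \<in> Rp \<Longrightarrow> 0 \<le> k \<alpha>"
    and "y = u + h *\<^sub>R trunc_drift Rp k \<epsilon> y" "y' = u' + h *\<^sub>R trunc_drift Rp k \<epsilon> y'"
  shows "norm (y - y') \<le> norm (u - u')"
proof -
  let ?d = "trunc_drift Rp k \<epsilon> y - trunc_drift Rp k \<epsilon> y'"
  have "y - y' = (u - u') + h *\<^sub>R ?d" using assms(4,5) by (simp add: algebra_simps)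
  then have "(norm (y - y'))\<^sup>2 = (y - y') \<bullet> (u - u') + h * ((y - y') \<bullet> ?d)"
    by (metis inner_add_right inner_scaleR_right power2_norm_eq_inner)
  also have "\<dots> \<le> (y - y') \<bullet> (u - u')"
    using mult_nonneg_nonpos[OF assms(2) trunc_drift_monotone[of \<epsilon> Rp k y y', OF assms(1,3)]] by simp
  also have "\<dots> \<le> norm (y - y') * norm (u - u')" by (rule norm_cauchy_schwarz)
  finally show ?thesis
    by (metis mult_le_cancel_left_pos norm_ge_zero order_le_less power2_eq_square zero_less_norm_iff)
qed

text \<open>The solution map of the implicit equation is nonexpansive, hence continuous and Borel,
  and one step of the scheme applies this map to a measurable argument.\<close>

lemma em_scheme_measurable:
  fixes B :: "real \<Rightarrow> 'w \<Rightarrow> real ^ 'd"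
  assumes "\<epsilon> > 0" "T \<ge> 0" "T / real n * trunc_const Rp k < \<epsilon>\<^sup>2"
    and pos: "\<And>\<alpha>. \<alpha> \<in> Rp \<Longrightarrow> 0 \<le> k \<alpha>"
    and B: "\<And>l. l \<le> n \<Longrightarrow> B (grid T n l) \<in> borel_measurable M"
    and b: "\<And>l. l \<le> n \<Longrightarrow> b (grid T n l) \<in> borel_measurable borel"
    and "l \<le> n"
  shows "(\<lambda>\<omega>. em_scheme Rp k b T x0 \<epsilon> n (\<lambda>t. B t \<omega>) l) \<in> borel_measurable M"
  using \<open>l \<le> n\<close>
proof (induction l)
  case 0
  then show ?case by simp
next
  case (Suc l)
  define h where "h = T / real n"
  \<comment> \<open>The resolvent of the truncated drift, with all explicit terms moved into its
    argument; the zeros match the form of \<open>implicit_step_ex1\<close>.\<close>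
  define Y where "Y u = (THE y. y = u + 0 + h *\<^sub>R (trunc_drift Rp k \<epsilon> y + 0))" for u
  have h: "0 \<le> h" "h * trunc_const Rp k < \<epsilon>\<^sup>2" using assms by (auto simp: h_def)
  have Y: "Y u = u + h *\<^sub>R trunc_drift Rp k \<epsilon> (Y u)" for u
    using theI'[OF implicit_step_ex1[OF assms(1) h(1,2), of u 0 0]] unfolding Y_def by simp
  have Y_eq: "Y u = y" if "y = u + h *\<^sub>R trunc_drift Rp k \<epsilon> y" for u y
  proof -
    have "norm (Y u - y) \<le> norm (u - u)"
      by (rule implicit_step_diff[OF assms(1) h(1) pos Y that])
    then show ?thesis by simp
  qed
  have "continuous_on UNIV Y"
  proof (rule lipschitz_on_continuous_on)
    show "1-lipschitz_on UNIV Y"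
      using implicit_step_diff[OF assms(1) h(1) pos Y Y]
      by (intro lipschitz_onI) (simp_all add: dist_norm)
  qed
  then have Y_meas [measurable]: "Y \<in> borel_measurable borel"
    by (rule borel_measurable_continuous_onI)
  let ?y = "\<lambda>l \<omega>. em_scheme Rp k b T x0 \<epsilon> n (\<lambda>t. B t \<omega>) l"
  have [measurable]: "B (grid T n l) \<in> borel_measurable M" "B (grid T n (Suc l)) \<in> borel_measurable M"
    "b (grid T n l) \<in> borel_measurable borel" "?y l \<in> borel_measurable M"
    using Suc B b by auto
  have "?y (Suc l) \<omega> = Y (?y l \<omega> + (B (grid T n (Suc l)) \<omega> - B (grid T n l) \<omega>)
      + h *\<^sub>R b (grid T n l) (?y l \<omega>))" for \<omega>
    by (rule Y_eq[symmetric],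
        subst em_scheme_step[OF assms(1,2,3), where w="\<lambda>t. B t \<omega>"])
       (simp add: h_def algebra_simps)
  then show ?case by (simp del: em_scheme.simps)
qed

text \<open>Because the truncated drift is dissipative, the constant does not depend on \<open>\<epsilon>\<close>.\<close>

lemma em_scheme_stability:
  fixes x :: "nat \<Rightarrow> real ^ 'd"
  assumes "\<epsilon> > 0" "T \<ge> 0" "n \<ge> 1" "T / real n * trunc_const Rp k < \<epsilon>\<^sup>2"
    and pos: "\<And>\<alpha>. \<alpha> \<in> Rp \<Longrightarrow> 0 \<le> k \<alpha>"
    and L: "L \<ge> 0" "\<And>l u v. l < n \<Longrightarrow> norm (b (grid T n l) u - b (grid T n l) v) \<le> L * norm (u - v)"
    and x0: "x 0 = x0"
    and x: "\<And>l. l < n \<Longrightarrow> x (Suc l) = x l + (w (grid T n (Suc l)) - w (grid T n l))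
      + (T / real n) *\<^sub>R (trunc_drift Rp k \<epsilon> (x (Suc l)) + b (grid T n l) (x l)) + r l"
    and "l \<le> n"
  shows "norm (x l - em_scheme Rp k b T x0 \<epsilon> n w l) \<le> exp (L * T) * (\<Sum>j<n. norm (r j))"
proof -
  define h where "h = T / real n"
  define y where "y = em_scheme Rp k b T x0 \<epsilon> n w"
  have h: "0 \<le> h" "1 \<le> 1 + L * h" using assms by (auto simp: h_def)
  \<comment> \<open>A discrete Gronwall estimate: one step multiplies the error by at most
    \<open>1 + L * h\<close> and adds the residual.\<close>
  have main: "norm (x l - y l) \<le> (1 + L * h) ^ l * (\<Sum>j<l. norm (r j))" if "l \<le> n" for l
    using that
  proof (induction l)
    case 0
    then show ?case using x0 by (simp add: y_def)
  next
    case (Suc l)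
    let ?v = "w (grid T n (Suc l)) - w (grid T n l)"
    have 1: "x (Suc l) = (x l + ?v + h *\<^sub>R b (grid T n l) (x l) + r l)
        + h *\<^sub>R trunc_drift Rp k \<epsilon> (x (Suc l))"
      using x[of l] Suc.prems by (simp add: h_def algebra_simps)
    have 2: "y (Suc l) = (y l + ?v + h *\<^sub>R b (grid T n l) (y l))
        + h *\<^sub>R trunc_drift Rp k \<epsilon> (y (Suc l))"
      unfolding y_def by (subst em_scheme_step[OF assms(1,2,4)]) (simp add: h_def algebra_simps)
    have "norm (x (Suc l) - y (Suc l)) \<le> norm ((x l + ?v + h *\<^sub>R b (grid T n l) (x l) + r l)
        - (y l + ?v + h *\<^sub>R b (grid T n l) (y l)))"
      by (rule implicit_step_diff[OF assms(1) h(1) pos 1 2])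
    also have "\<dots> = norm ((x l - y l) + h *\<^sub>R (b (grid T n l) (x l) - b (grid T n l) (y l)) + r l)"
      by (simp add: algebra_simps)
    also have "\<dots> \<le> norm (x l - y l) + h * norm (b (grid T n l) (x l) - b (grid T n l) (y l)) + norm (r l)"
      using h by (intro norm_triangle_le add_mono) auto
    also have "\<dots> \<le> norm (x l - y l) + h * (L * norm (x l - y l)) + norm (r l)"
      using h L Suc.prems by (intro add_mono mult_left_mono) auto
    also have "\<dots> = (1 + L * h) * norm (x l - y l) + norm (r l)" by (simp add: algebra_simps)
    \<comment> \<open>The residual is inflated by a power of a factor that is at least one, so that
      it merges into the sum.\<close>
    also have "\<dots> \<le> (1 + L * h) * ((1 + L * h) ^ l * (\<Sum>j<l. norm (r j)))
        + (1 + L * h) ^ Suc l * norm (r l)"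
      using h Suc one_le_power[OF h(2), of "Suc l"]
      by (intro add_mono mult_left_mono) (auto intro: mult_le_cancel_right1[THEN iffD2])
    finally show ?case by (simp add: algebra_simps)
  qed
  have "norm (x l - y l) \<le> (1 + L * h) ^ l * (\<Sum>j<l. norm (r j))" using main \<open>l \<le> n\<close> by simp
  also have "\<dots> \<le> exp (L * T) * (\<Sum>j<n. norm (r j))"
  proof (rule mult_mono)
    have "(1 + L * h) ^ l \<le> (1 + L * h) ^ n" using h \<open>l \<le> n\<close> by (intro power_increasing) auto
    also have "\<dots> \<le> exp (L * h) ^ n" using h by (intro power_mono exp_ge_add_one_self) auto
    also have "\<dots> = exp (L * T)"
      using \<open>n \<ge> 1\<close> by (simp add: exp_of_nat_mult[symmetric] h_def)
    finally show "(1 + L * h) ^ l \<le> exp (L * T)" .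
    show "(\<Sum>j<l. norm (r j)) \<le> (\<Sum>j<n. norm (r j))"
      using \<open>l \<le> n\<close> by (intro sum_mono2) auto
  qed (auto intro: sum_nonneg)
  finally show ?thesis by (simp add: y_def)
qed

section \<open>Power means and time integrals\<close>

text \<open>A convex function lies above its tangent at \<open>\<mu>\<close>. Young's inequality
  with the exponents \<open>p\<close> and \<open>p / (p - 1)\<close> gives this at
  \<open>x = 0\<close> as well.\<close>

lemma powr_tangent_le:
  fixes x \<mu> p :: real
  assumes "0 \<le> x" "0 < \<mu>" "1 \<le> p"
  shows "\<mu> powr p + p * \<mu> powr (p - 1) * (x - \<mu>) \<le> x powr p"
proof (cases "p = 1")
  case True
  then show ?thesis using assms by simp
next
  case False
  then have p: "p > 1" using assms by simp
  have "x * \<mu> powr (p - 1) \<le> x powr p / p + (\<mu> powr (p - 1)) powr (p / (p - 1)) / (p / (p - 1))"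
    using p assms by (intro Youngs_inequality) (auto simp: field_simps)
  also have "(\<mu> powr (p - 1)) powr (p / (p - 1)) = \<mu> powr p"
    using p by (simp add: powr_powr)
  finally have "p * (x * \<mu> powr (p - 1)) \<le> x powr p + \<mu> powr p * (p - 1)"
    using p by (simp add: field_simps)
  moreover have "\<mu> powr (p - 1) * \<mu> = \<mu> powr p"
    using assms by (simp add: powr_mult_base mult.commute)
  ultimately show ?thesis by (simp add: algebra_simps)
qed

text \<open>Jensen's inequality: the tangent bounds at the mean \<open>S / N\<close> are added up,
  and their linear terms cancel.\<close>

lemma sum_powr_le:
  fixes c :: "'a \<Rightarrow> real"
  assumes "finite A" "\<And>i. i \<in> A \<Longrightarrow> 0 \<le> c i" "1 \<le> p"
  shows "(\<Sum>i\<in>A. c i) powr p \<le> real (card A) powr (p - 1) * (\<Sum>i\<in>A. c i powr p)"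
proof (cases "(\<Sum>i\<in>A. c i) = 0")
  case True
  then show ?thesis using assms by (simp add: sum_nonneg)
next
  case False
  define S where "S = (\<Sum>i\<in>A. c i)"
  define N where "N = real (card A)"
  have "A \<noteq> {}" using False by auto
  then have N: "N > 0" using assms by (simp add: N_def card_gt_0_iff)
  have S: "S > 0" using False assms by (metis S_def less_eq_real_def sum_nonneg)
  have "(\<Sum>i\<in>A. (S / N) powr p + p * (S / N) powr (p - 1) * (c i - S / N)) \<le> (\<Sum>i\<in>A. c i powr p)"
    using assms N S by (intro sum_mono powr_tangent_le) auto
  also have "(\<Sum>i\<in>A. (S / N) powr p + p * (S / N) powr (p - 1) * (c i - S / N)) =
      N * (S / N) powr p + p * (S / N) powr (p - 1) * (\<Sum>i\<in>A. c i - S / N)"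
    by (simp add: sum.distrib sum_distrib_left N_def)
  also have "(\<Sum>i\<in>A. c i - S / N) = 0"
    using N by (simp add: sum_subtractf S_def[symmetric] N_def)
  finally have "N powr (p - 1) * (N * (S / N) powr p) \<le> N powr (p - 1) * (\<Sum>i\<in>A. c i powr p)"
    using N by (intro mult_left_mono) auto
  also have "N powr (p - 1) * (N * (S / N) powr p) = S powr p"
    using N S by (simp add: powr_divide powr_diff)
  finally show ?thesis by (simp add: S_def N_def)
qed

text \<open>The same tangent argument at the mean value. It reduces powers of a time integral to
  time integrals of powers, whose expectations are controlled time by time.\<close>

lemma integral_powr_le:
  fixes g :: "real \<Rightarrow> real"
  assumes "a \<le> b" "continuous_on {a..b} g" "\<And>s. s \<in> {a..b} \<Longrightarrow> 0 \<le> g s" "1 \<le> p"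
  shows "integral {a..b} g powr p \<le> (b - a) powr (p - 1) * integral {a..b} (\<lambda>s. g s powr p)"
proof (cases "integral {a..b} g = 0")
  case True
  have "continuous_on {a..b} (\<lambda>s. g s powr p)"
    by (rule continuous_on_powr') (use assms in auto)
  then have "0 \<le> integral {a..b} (\<lambda>s. g s powr p)"
    by (intro integral_nonneg integrable_continuous_real) auto
  then show ?thesis using True by simp
next
  case False
  define S where "S = integral {a..b} g"
  define N where "N = b - a"
  have int: "g integrable_on {a..b}" using assms by (intro integrable_continuous_real)
  have "a \<noteq> b" using False by auto
  then have N: "N > 0" using assms by (simp add: N_def)
  have "S \<ge> 0" unfolding S_def using assms int by (intro integral_nonneg) auto
  then have S: "S > 0" using False by (simp add: S_def)
  have intp: "(\<lambda>s. g s powr p) integrable_on {a..b}"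
    by (rule integrable_continuous_real, rule continuous_on_powr') (use assms in auto)
  have "((\<lambda>s. (S / N) powr p + p * (S / N) powr (p - 1) * (g s - S / N)) has_integral
      (S / N) powr p * N + p * (S / N) powr (p - 1) * (S - S / N * N)) {a..b}"
  proof (intro has_integral_add has_integral_mult_right has_integral_diff)
    have const: "((\<lambda>_. c) has_integral c * N) {a..b}" for c
      using has_integral_const_real[of c a b] assms(1) by (simp add: N_def mult.commute)
    show "((\<lambda>_. (S / N) powr p) has_integral (S / N) powr p * N) {a..b}" by (rule const)
    show "((\<lambda>_. S / N) has_integral S / N * N) {a..b}" by (rule const)
    show "(g has_integral S) {a..b}" unfolding S_def by (rule integrable_integral[OF int])
  qed
  then have "(S / N) powr p * N + p * (S / N) powr (p - 1) * (S - S / N * N) \<le>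
      integral {a..b} (\<lambda>s. g s powr p)"
  proof (rule has_integral_le[OF _ integrable_integral[OF intp]])
    fix s assume "s \<in> {a..b}"
    then show "(S / N) powr p + p * (S / N) powr (p - 1) * (g s - S / N) \<le> g s powr p"
      using assms(3)[of s] assms(4) N S by (intro powr_tangent_le) simp_all
  qed
  then have "N powr (p - 1) * (N * (S / N) powr p) \<le>
      N powr (p - 1) * integral {a..b} (\<lambda>s. g s powr p)"
    using N by (intro mult_left_mono) (auto simp: mult.commute)
  also have "N powr (p - 1) * (N * (S / N) powr p) = S powr p"
    using N S by (simp add: powr_divide powr_diff)
  finally show ?thesis by (simp add: S_def N_def)
qed

lemma integral_grid_sum:
  fixes g :: "real \<Rightarrow> 'a::banach"
  assumes "\<And>i. i < n \<Longrightarrow> t i \<le> t (Suc i)" "g integrable_on {t 0..t n}"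
  shows "integral {t 0..t n} g = (\<Sum>i<n. integral {t i..t (Suc i)} g)"
  using assms
proof (induction n)
  case 0
  then show ?case by simp
next
  case (Suc n)
  have le: "t 0 \<le> t i" if "i \<le> n" for i
    using that
  proof (induction i)
    case (Suc i)
    then show ?case using Suc.prems(1) \<open>\<And>i. i < Suc n \<Longrightarrow> t i \<le> t (Suc i)\<close>[of i] by force
  qed simp
  have "g integrable_on {t 0..t n}"
    by (rule integrable_on_subinterval[OF Suc.prems(2)]) (use Suc.prems(1)[of n] in auto)
  then have "integral {t 0..t n} g = (\<Sum>i<n. integral {t i..t (Suc i)} g)"
    using Suc by auto
  moreover have "integral {t 0..t (Suc n)} g = integral {t 0..t n} g + integral {t n..t (Suc n)} g"
    using le[of n] Suc.prems by (intro Henstock_Kurzweil_Integration.integral_combine[symmetric]) auto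
  ultimately show ?case by simp
qed

lemma riemann_sum_tendsto_integral:
  fixes g :: "real \<Rightarrow> real"
  assumes ab: "a \<le> b" and g: "continuous_on {a..b} g"
  shows "(\<lambda>n. (b - a) / real n * (\<Sum>i<n. g (a + real i * ((b - a) / real n)))) \<longlonglongrightarrow> integral {a..b} g"
proof (rule LIMSEQ_I)
  fix e :: real assume "e > 0"
  \<comment> \<open>The \<open>+ 1\<close> keeps the denominator positive when
    \<open>a = b\<close>.\<close>
  define e' where "e' = e / (2 * (b - a + 1))"
  have e': "e' > 0" "e' * (b - a) < e"
  proof -
    show "e' > 0" using \<open>e > 0\<close> ab by (auto simp: e'_def)
    have "e * (b - a) < e * (2 * (b - a + 1))"
      using \<open>e > 0\<close> ab by (intro mult_strict_left_mono) auto
    then show "e' * (b - a) < e" using ab by (simp add: e'_def field_simps)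
  qed
  have "uniformly_continuous_on {a..b} g"
    using g by (rule compact_uniformly_continuous) auto
  then obtain d where d: "d > 0" "\<And>x y. x \<in> {a..b} \<Longrightarrow> y \<in> {a..b} \<Longrightarrow> dist y x < d \<Longrightarrow> dist (g y) (g x) < e'"
    unfolding uniformly_continuous_on_def using e'(1) by metis
  obtain N where N: "real N > (b - a) / d" using reals_Archimedean2 by blast
  have "norm ((b - a) / real n * (\<Sum>i<n. g (a + real i * ((b - a) / real n))) - integral {a..b} g) < e"
    if n: "n \<ge> Suc N" for n
  proof -
    define h where "h = (b - a) / real n"
    define t where "t i = a + real i * h" for i
    have n0: "n > 0" using n by auto
    have h: "h \<ge> 0" "h < d"
    proof -
      show "h \<ge> 0" using ab by (simp add: h_def)
      have "(b - a) / d < real n" using N n by simp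
      then show "h < d" using d(1) n0 by (simp add: h_def field_simps)
    qed
    have t0: "t 0 = a" and tn: "t n = b" using n0 by (auto simp: t_def h_def)
    have step: "t (Suc i) = t i + h" for i by (simp add: t_def algebra_simps)
    have tin: "{t i..t (Suc i)} \<subseteq> {a..b}" if "i < n" for i
    proof -
      have "t i \<ge> a" using h by (simp add: t_def)
      moreover have "t (Suc i) \<le> t n" using that h by (auto simp: t_def intro!: mult_right_mono)
      ultimately show ?thesis using tn by auto
    qed
    have intg: "g integrable_on {a..b}" using g by (rule integrable_continuous_real)
    have "integral {a..b} g = (\<Sum>i<n. integral {t i..t (Suc i)} g)"
      using integral_grid_sum[of n t g] intg h unfolding t0 tn by (simp add: step)
    then have "norm (h * (\<Sum>i<n. g (t i)) - integral {a..b} g) =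
        norm (\<Sum>i<n. h * g (t i) - integral {t i..t (Suc i)} g)"
      by (simp add: sum_subtractf sum_distrib_left)
    also have "\<dots> \<le> (\<Sum>i<n. e' * h)"
    proof (rule sum_norm_le)
      fix i assume "i \<in> {..<n}"
      then have i: "{t i..t (Suc i)} \<subseteq> {a..b}" using tin by simp
      have "((\<lambda>s. g s - g (t i)) has_integral integral {t i..t (Suc i)} g - (t (Suc i) - t i) *\<^sub>R g (t i))
          {t i..t (Suc i)}"
        using integrable_on_subinterval[OF intg i] has_integral_const_real[of "g (t i)" "t i" "t (Suc i)"]
          step h by (intro has_integral_diff) (auto simp: mult.commute)
      then have "norm (integral {t i..t (Suc i)} g - (t (Suc i) - t i) *\<^sub>R g (t i)) \<le>
          e' * measure lborel {t i..t (Suc i)}"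
      proof (rule has_integral_bound_real[rotated 2])
        show "norm (g s - g (t i)) \<le> e'" if "s \<in> {t i..t (Suc i)} - {}" for s
        proof -
          have "dist s (t i) < d" using that step h by (auto simp: dist_real_def)
          then have "dist (g s) (g (t i)) < e'"
            using that i step h by (intro d(2)) auto
          then show ?thesis by (simp add: dist_norm)
        qed
      qed (use e' in auto)
      then show "norm (h * g (t i) - integral {t i..t (Suc i)} g) \<le> e' * h"
        using step h by (simp add: norm_minus_commute)
    qed
    also have "\<dots> = e' * (b - a)" using n0 by (simp add: h_def)
    finally show ?thesis using e' by (simp add: h_def t_def)
  qed
  then show "\<exists>no. \<forall>n\<ge>no. norm ((b - a) / real n * (\<Sum>i<n. g (a + real i * ((b - a) / real n))) - integral {a..b} g) < e"
    by blast
qed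

text \<open>Riemann sums and Fatou's lemma replace Fubini's theorem, so that no joint
  measurability is needed.\<close>

lemma
  fixes g :: "real \<Rightarrow> 'w \<Rightarrow> real"
  assumes ab: "a \<le> b" and cont: "\<And>\<omega>. \<omega> \<in> space M \<Longrightarrow> continuous_on {a..b} (\<lambda>s. g s \<omega>)"
    and meas: "\<And>s. s \<in> {a..b} \<Longrightarrow> g s \<in> borel_measurable M"
  shows borel_measurable_time_integral: "(\<lambda>\<omega>. integral {a..b} (\<lambda>s. g s \<omega>)) \<in> borel_measurable M"
    and nn_integral_time_integral_le:
      "\<lbrakk>\<And>s \<omega>. s \<in> {a..b} \<Longrightarrow> \<omega> \<in> space M \<Longrightarrow> 0 \<le> g s \<omega>;
        \<And>s. s \<in> {a..b} \<Longrightarrow> (\<integral>\<^sup>+\<omega>. g s \<omega> \<partial>M) \<le> ennreal c\<rbrakk> \<Longrightarrow>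
      (\<integral>\<^sup>+\<omega>. integral {a..b} (\<lambda>s. g s \<omega>) \<partial>M) \<le> ennreal ((b - a) * c)"
proof -
  define S where "S n \<omega> = (b - a) / real n * (\<Sum>i<n. g (a + real i * ((b - a) / real n)) \<omega>)" for n \<omega>
  have pt: "a + real i * ((b - a) / real n) \<in> {a..b}" if "i < n" for i n
  proof -
    have "real i * ((b - a) / real n) \<le> real n * ((b - a) / real n)"
      using that ab by (intro mult_right_mono) auto
    then show ?thesis using that ab by auto
  qed
  have S: "(\<lambda>n. S n \<omega>) \<longlonglongrightarrow> integral {a..b} (\<lambda>s. g s \<omega>)" if "\<omega> \<in> space M" for \<omega>
    unfolding S_def by (rule riemann_sum_tendsto_integral[OF ab cont[OF that]])
  have Sm: "S n \<in> borel_measurable M" for n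
    unfolding S_def using pt meas by (intro borel_measurable_times borel_measurable_sum) auto
  show "(\<lambda>\<omega>. integral {a..b} (\<lambda>s. g s \<omega>)) \<in> borel_measurable M"
    using S Sm by (rule borel_measurable_LIMSEQ_real)
  assume nn: "\<And>s \<omega>. s \<in> {a..b} \<Longrightarrow> \<omega> \<in> space M \<Longrightarrow> 0 \<le> g s \<omega>"
    and c: "\<And>s. s \<in> {a..b} \<Longrightarrow> (\<integral>\<^sup>+\<omega>. g s \<omega> \<partial>M) \<le> ennreal c"
  have Sc: "(\<integral>\<^sup>+\<omega>. S n \<omega> \<partial>M) \<le> ennreal ((b - a) * c)" for n
  proof (cases "n = 0")
    case False
    have "(\<integral>\<^sup>+\<omega>. S n \<omega> \<partial>M) = (\<integral>\<^sup>+\<omega>. ennreal ((b - a) / real n) *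
        (\<Sum>i<n. ennreal (g (a + real i * ((b - a) / real n)) \<omega>)) \<partial>M)"
      unfolding S_def using ab pt nn
      by (intro nn_integral_cong) (subst sum_ennreal, auto simp: ennreal_mult'[symmetric])
    also have "\<dots> = ennreal ((b - a) / real n) *
        (\<Sum>i<n. \<integral>\<^sup>+\<omega>. ennreal (g (a + real i * ((b - a) / real n)) \<omega>) \<partial>M)"
      using meas[OF pt] by (subst nn_integral_cmult, (simp; fail), subst nn_integral_sum) simp_all
    also have "\<dots> \<le> ennreal ((b - a) / real n) * (\<Sum>i<n. ennreal c)"
      using c pt by (intro mult_left_mono sum_mono) auto
    also have "\<dots> = ennreal ((b - a) / real n) * (ennreal (real n) * ennreal c)"
      by (simp add: ennreal_of_nat_eq_real_of_nat)
    also have "\<dots> = ennreal ((b - a) * c)"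
      using False ab by (cases "c \<ge> 0") (auto simp: ennreal_mult'[symmetric] ennreal_neg mult_nonneg_nonpos)
    finally show ?thesis .
  qed (simp add: S_def)
  have "(\<integral>\<^sup>+\<omega>. integral {a..b} (\<lambda>s. g s \<omega>) \<partial>M) = (\<integral>\<^sup>+\<omega>. liminf (\<lambda>n. ennreal (S n \<omega>)) \<partial>M)"
  proof (rule nn_integral_cong)
    fix \<omega> assume "\<omega> \<in> space M"
    then have "(\<lambda>n. ennreal (S n \<omega>)) \<longlonglongrightarrow> ennreal (integral {a..b} (\<lambda>s. g s \<omega>))"
      using S by (intro tendsto_ennrealI) auto
    then show "ennreal (integral {a..b} (\<lambda>s. g s \<omega>)) = liminf (\<lambda>n. ennreal (S n \<omega>))"
      by (simp add: lim_imp_Liminf)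
  qed
  also have "\<dots> \<le> liminf (\<lambda>n. \<integral>\<^sup>+\<omega>. ennreal (S n \<omega>) \<partial>M)"
    using Sm by (intro nn_integral_liminf) auto
  also have "\<dots> \<le> ennreal ((b - a) * c)"
    using Sc by (intro Liminf_le) auto
  finally show "(\<integral>\<^sup>+\<omega>. integral {a..b} (\<lambda>s. g s \<omega>) \<partial>M) \<le> ennreal ((b - a) * c)" .
qed

section \<open>Gaussian increments\<close>

text \<open>Tonelli's theorem in coordinates, carried over from \<open>Basis\<close> along the
  bijection between indices and unit vectors.\<close>

lemma nn_integral_lborel_vec_prod:
  fixes f :: "'d::finite \<Rightarrow> real \<Rightarrow> ennreal"
  assumes f: "\<And>i. f i \<in> borel_measurable borel"
  shows "(\<integral>\<^sup>+x. (\<Prod>i\<in>UNIV. f i ((x :: real ^ 'd) $ i)) \<partial>lborel) = (\<Prod>i\<in>UNIV. \<integral>\<^sup>+u. f i u \<partial>lborel)"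
proof -
  let ?ax = "\<lambda>i::'d. axis i (1::real)"
  have inj: "inj ?ax" by (auto simp: inj_on_def axis_eq_axis)
  have B: "(Basis :: (real ^ 'd) set) = range ?ax" by (auto simp: Basis_vec_def)
  have "(\<integral>\<^sup>+x. (\<Prod>b\<in>Basis. f (inv_into UNIV ?ax b) ((x :: real ^ 'd) \<bullet> b)) \<partial>lborel) =
      (\<Prod>b\<in>(Basis :: (real ^ 'd) set). \<integral>\<^sup>+u. f (inv_into UNIV ?ax b) u \<partial>lborel)"
    using f by (intro nn_integral_lborel_prod) auto
  then show ?thesis
    unfolding B prod.reindex[OF inj] by (simp add: inv_f_f[OF inj] inner_axis)
qed

lemma borel_measurable_vec_nth [measurable (raw)]:
  fixes f :: "'a \<Rightarrow> real ^ 'd"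
  assumes "f \<in> borel_measurable M"
  shows "(\<lambda>x. f x $ i) \<in> borel_measurable M"
  using assms by (simp add: cart_eq_inner_axis)

context prob_space
begin

text \<open>Independence means that the joint law is the product of the marginal laws, and
  rectangles determine a finite measure on the product.\<close>

lemma indep_varI_rect:
  assumes X: "X \<in> borel_measurable M" and Y: "Y \<in> borel_measurable M"
    and rect: "\<And>A B. A \<in> sets borel \<Longrightarrow> B \<in> sets borel \<Longrightarrow>
      prob ((X -` A \<inter> space M) \<inter> (Y -` B \<inter> space M)) =
      prob (X -` A \<inter> space M) * prob (Y -` B \<inter> space M)"
  shows "indep_var (borel :: 'b::second_countable_topology measure) X borel Y"
  unfolding indep_var_distribution_eq
proof (intro conjI X Y pair_measure_eqI)
  show "sigma_finite_measure (distr M borel X)" "sigma_finite_measure (distr M borel Y)"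
    using X Y by (auto intro!: prob_space_distr prob_space_imp_sigma_finite)
  show "sets (distr M borel X \<Otimes>\<^sub>M distr M borel Y) =
      sets (distr M (borel \<Otimes>\<^sub>M borel) (\<lambda>x. (X x, Y x)))"
    by (simp add: sets_pair_eq_sets_fst_snd cong: sets_pair_measure_cong)
  fix A B assume A: "A \<in> sets (distr M borel X)" and B: "B \<in> sets (distr M borel Y)"
  then have AB: "A \<in> sets borel" "B \<in> sets borel" by auto
  have "emeasure (distr M (borel \<Otimes>\<^sub>M borel) (\<lambda>x. (X x, Y x))) (A \<times> B) =
      emeasure M ((\<lambda>x. (X x, Y x)) -` (A \<times> B) \<inter> space M)"
    using X Y AB by (intro emeasure_distr) auto
  also have "(\<lambda>x. (X x, Y x)) -` (A \<times> B) \<inter> space M = (X -` A \<inter> space M) \<inter> (Y -` B \<inter> space M)"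
    by auto
  also have "emeasure M \<dots> = ennreal (prob (X -` A \<inter> space M) * prob (Y -` B \<inter> space M))"
    using rect[OF AB] by (simp add: emeasure_eq_measure)
  also have "\<dots> = emeasure (distr M borel X) A * emeasure (distr M borel Y) B"
    using X Y AB by (simp add: emeasure_distr emeasure_eq_measure ennreal_mult)
  finally show "emeasure (distr M borel X) A * emeasure (distr M borel Y) B =
      emeasure (distr M (borel \<Otimes>\<^sub>M borel) (\<lambda>x. (X x, Y x))) (A \<times> B)" by simp
qed

text \<open>This converts the independence of sigma-algebras in \<open>brownian_motion\<close> into
  independence of random variables, for which expectations of products factorise.\<close>

lemma indep_var_of_indep_set:
  fixes W :: "'a \<Rightarrow> 'b::second_countable_topology" and Y :: "'a \<Rightarrow> real" and \<phi> :: "'b \<Rightarrow> real"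
  assumes ind: "indep_set (sets G) {W -` A \<inter> space M | A. A \<in> sets borel}"
    and G: "subalgebra M G" and W: "W \<in> borel_measurable M"
    and Y: "Y \<in> borel_measurable G" and \<phi>: "\<phi> \<in> borel_measurable borel"
  shows "indep_var borel Y borel (\<lambda>\<omega>. \<phi> (W \<omega>))"
proof (rule indep_varI_rect)
  show Ym: "Y \<in> borel_measurable M" by (rule measurable_from_subalg[OF G Y])
  show "(\<lambda>\<omega>. \<phi> (W \<omega>)) \<in> borel_measurable M" using W \<phi> by measurable
  fix A B :: "real set" assume AB: "A \<in> sets borel" "B \<in> sets borel"
  have "Y -` A \<inter> space M \<in> sets G"
    using measurable_sets[OF Y AB(1)] G by (simp add: subalgebra_def)
  moreover have "(\<lambda>\<omega>. \<phi> (W \<omega>)) -` B \<inter> space M = W -` (\<phi> -` B) \<inter> space M" by auto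
  moreover have "\<phi> -` B \<in> sets borel" using measurable_sets[OF \<phi> AB(2)] by simp
  ultimately show "prob ((Y -` A \<inter> space M) \<inter> ((\<lambda>\<omega>. \<phi> (W \<omega>)) -` B \<inter> space M)) =
      prob (Y -` A \<inter> space M) * prob ((\<lambda>\<omega>. \<phi> (W \<omega>)) -` B \<inter> space M)"
    by (intro indep_setD[OF ind]) auto
qed

text \<open>The density is the one in \<open>brownian_motion\<close>, so Brownian increments are
  instances by unfolding; \<open>\<sigma>\<close> is the standard deviation of each
  component.\<close>

definition gauss_vec :: "real \<Rightarrow> ('a \<Rightarrow> real ^ 'd) \<Rightarrow> bool" where
  "gauss_vec \<sigma> W \<longleftrightarrow> distributed M lborel W
     (\<lambda>x. ennreal (\<Prod>i\<in>UNIV. normal_density 0 \<sigma> (x $ i)))"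

lemma gauss_vec_measurable: "gauss_vec \<sigma> W \<Longrightarrow> W \<in> borel_measurable M"
  unfolding gauss_vec_def using distributed_measurable by force

text \<open>The density is a product over the coordinates, so Tonelli's theorem separates them.
  Marginal laws and independence of components follow by taking all but one or two factors equal to
  one.\<close>

lemma gauss_vec_nn_integral_prod:
  fixes W :: "'a \<Rightarrow> real ^ 'd"
  assumes W: "gauss_vec \<sigma> W" and f: "\<And>i. f i \<in> borel_measurable borel"
  shows "(\<integral>\<^sup>+\<omega>. (\<Prod>i\<in>UNIV. f i (W \<omega> $ i)) \<partial>M) =
    (\<Prod>i\<in>UNIV. \<integral>\<^sup>+u. ennreal (normal_density 0 \<sigma> u) * f i u \<partial>lborel)"
proof -
  note [measurable] = f
  have "(\<integral>\<^sup>+\<omega>. (\<Prod>i\<in>UNIV. f i (W \<omega> $ i)) \<partial>M) =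
      (\<integral>\<^sup>+x. ennreal (\<Prod>i\<in>UNIV. normal_density 0 \<sigma> (x $ i)) * (\<Prod>i\<in>UNIV. f i (x $ i)) \<partial>lborel)"
    using W unfolding gauss_vec_def
    by (intro distributed_nn_integral[symmetric]) auto
  also have "\<dots> = (\<integral>\<^sup>+x. (\<Prod>i\<in>UNIV. ennreal (normal_density 0 \<sigma> ((x :: real ^ 'd) $ i)) * f i (x $ i)) \<partial>lborel)"
    by (simp add: prod.distrib prod_ennreal[symmetric] normal_density_nonneg)
  also have "\<dots> = (\<Prod>i\<in>UNIV. \<integral>\<^sup>+u. ennreal (normal_density 0 \<sigma> u) * f i u \<partial>lborel)"
    by (rule nn_integral_lborel_vec_prod) simp
  finally show ?thesis .
qed

lemma nn_integral_normal_density_1: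
  assumes "\<sigma> > 0"
  shows "(\<integral>\<^sup>+u. ennreal (normal_density 0 \<sigma> u) \<partial>lborel) = 1"
  using prob_space.emeasure_space_1[OF prob_space_normal_density[OF assms, of 0]]
  by (simp add: emeasure_density)

lemma gauss_vec_component:
  fixes W :: "'a \<Rightarrow> real ^ 'd"
  assumes W: "gauss_vec \<sigma> W" and \<sigma>: "\<sigma> > 0"
  shows "distributed M lborel (\<lambda>\<omega>. W \<omega> $ i) (\<lambda>u. ennreal (normal_density 0 \<sigma> u))"
proof -
  note [measurable] = gauss_vec_measurable[OF W]
  have "distr M lborel (\<lambda>\<omega>. W \<omega> $ i) = density lborel (\<lambda>u. ennreal (normal_density 0 \<sigma> u))"
  proof (rule measure_eqI)
    fix A assume "A \<in> sets (distr M lborel (\<lambda>\<omega>. W \<omega> $ i))"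
    then have A [measurable]: "A \<in> sets borel" by simp
    let ?f = "\<lambda>j u. if j = i then indicator A u else 1 :: ennreal"
    have "emeasure (distr M lborel (\<lambda>\<omega>. W \<omega> $ i)) A = (\<integral>\<^sup>+\<omega>. indicator A (W \<omega> $ i) \<partial>M)"
      by (subst nn_integral_indicator[symmetric], simp, subst nn_integral_distr) simp_all
    also have "\<dots> = (\<integral>\<^sup>+\<omega>. (\<Prod>j\<in>UNIV. ?f j (W \<omega> $ j)) \<partial>M)"
      by (simp add: prod.delta)
    also have "\<dots> = (\<Prod>j\<in>UNIV. \<integral>\<^sup>+u. ennreal (normal_density 0 \<sigma> u) * ?f j u \<partial>lborel)"
      by (rule gauss_vec_nn_integral_prod[OF W]) simp
    also have "\<dots> = (\<Prod>j\<in>UNIV. if j = i then \<integral>\<^sup>+u. ennreal (normal_density 0 \<sigma> u) * indicator A u \<partial>lborel else 1)"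
      by (intro prod.cong) (auto simp: nn_integral_normal_density_1[OF \<sigma>])
    also have "\<dots> = emeasure (density lborel (\<lambda>u. ennreal (normal_density 0 \<sigma> u))) A"
      by (simp add: prod.delta emeasure_density)
    finally show "emeasure (distr M lborel (\<lambda>\<omega>. W \<omega> $ i)) A =
        emeasure (density lborel (\<lambda>u. ennreal (normal_density 0 \<sigma> u))) A" .
  qed simp
  then show ?thesis by (simp add: distributed_def)
qed

lemma gauss_vec_indep_components:
  fixes W :: "'a \<Rightarrow> real ^ 'd"
  assumes W: "gauss_vec \<sigma> W" and \<sigma>: "\<sigma> > 0" and ij: "i \<noteq> j"
  shows "indep_var borel (\<lambda>\<omega>. W \<omega> $ i) borel (\<lambda>\<omega>. W \<omega> $ j)"
proof (rule indep_varI_rect)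
  note [measurable] = gauss_vec_measurable[OF W]
  show "(\<lambda>\<omega>. W \<omega> $ i) \<in> borel_measurable M" "(\<lambda>\<omega>. W \<omega> $ j) \<in> borel_measurable M" by measurable
  fix A B :: "real set" assume [measurable]: "A \<in> sets borel" "B \<in> sets borel"
  let ?I = "\<lambda>A. \<integral>\<^sup>+u. ennreal (normal_density 0 \<sigma> u) * indicator A u \<partial>lborel"
  have one: "emeasure M ((\<lambda>\<omega>. W \<omega> $ i) -` A \<inter> space M) = ?I A" if [measurable]: "A \<in> sets borel" for i A
  proof -
    have "emeasure M ((\<lambda>\<omega>. W \<omega> $ i) -` A \<inter> space M) = emeasure (distr M lborel (\<lambda>\<omega>. W \<omega> $ i)) A"
      by (simp add: emeasure_distr)
    also have "\<dots> = ?I A"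
      using gauss_vec_component[OF W \<sigma>, of i] by (simp add: distributed_def emeasure_density)
    finally show ?thesis .
  qed
  let ?f = "\<lambda>l u. if l = i then indicator A u else if l = j then indicator B u else 1 :: ennreal"
  have "emeasure M (((\<lambda>\<omega>. W \<omega> $ i) -` A \<inter> space M) \<inter> ((\<lambda>\<omega>. W \<omega> $ j) -` B \<inter> space M)) =
      (\<integral>\<^sup>+\<omega>. indicator A (W \<omega> $ i) * indicator B (W \<omega> $ j) \<partial>M)"
  proof -
    have "((\<lambda>\<omega>. W \<omega> $ i) -` A \<inter> space M) \<inter> ((\<lambda>\<omega>. W \<omega> $ j) -` B \<inter> space M) \<in> sets M"
      by measurable
    note nn_integral_indicator[OF this, symmetric]
    then show ?thesis by (simp only:) (auto intro!: nn_integral_cong simp: indicator_def)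
  qed
  also have "\<dots> = (\<integral>\<^sup>+\<omega>. (\<Prod>l\<in>UNIV. ?f l (W \<omega> $ l)) \<partial>M)"
  proof (rule nn_integral_cong)
    fix \<omega>
    have "(\<Prod>l\<in>UNIV. ?f l (W \<omega> $ l)) = ?f i (W \<omega> $ i) * (?f j (W \<omega> $ j) * (\<Prod>l\<in>UNIV - {i} - {j}. ?f l (W \<omega> $ l)))"
      using ij by (subst prod.remove[of _ i], simp, simp, subst prod.remove[of _ j]) auto
    also have "(\<Prod>l\<in>UNIV - {i} - {j}. ?f l (W \<omega> $ l)) = 1" by (intro prod.neutral) auto
    finally show "indicator A (W \<omega> $ i) * indicator B (W \<omega> $ j) = (\<Prod>l\<in>UNIV. ?f l (W \<omega> $ l))"
      using ij by simp
  qed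
  also have "\<dots> = (\<Prod>l\<in>UNIV. \<integral>\<^sup>+u. ennreal (normal_density 0 \<sigma> u) * ?f l u \<partial>lborel)"
    by (rule gauss_vec_nn_integral_prod[OF W]) simp
  also have "\<dots> = ?I A * (?I B * (\<Prod>l\<in>UNIV - {i} - {j}. \<integral>\<^sup>+u. ennreal (normal_density 0 \<sigma> u) * ?f l u \<partial>lborel))"
    using ij by (subst prod.remove[of _ i], simp, simp, subst prod.remove[of _ j]) auto
  also have "(\<Prod>l\<in>UNIV - {i} - {j}. \<integral>\<^sup>+u. ennreal (normal_density 0 \<sigma> u) * ?f l u \<partial>lborel) = 1"
    by (intro prod.neutral) (auto simp: nn_integral_normal_density_1[OF \<sigma>])
  finally have "emeasure M (((\<lambda>\<omega>. W \<omega> $ i) -` A \<inter> space M) \<inter> ((\<lambda>\<omega>. W \<omega> $ j) -` B \<inter> space M)) =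
      emeasure M ((\<lambda>\<omega>. W \<omega> $ i) -` A \<inter> space M) * emeasure M ((\<lambda>\<omega>. W \<omega> $ j) -` B \<inter> space M)"
    by (simp add: one)
  then show "prob (((\<lambda>\<omega>. W \<omega> $ i) -` A \<inter> space M) \<inter> ((\<lambda>\<omega>. W \<omega> $ j) -` B \<inter> space M)) =
      prob ((\<lambda>\<omega>. W \<omega> $ i) -` A \<inter> space M) * prob ((\<lambda>\<omega>. W \<omega> $ j) -` B \<inter> space M)"
    by (simp add: measure_def enn2real_mult)
qed

lemma gauss_vec_integrable_component:
  fixes W :: "'a \<Rightarrow> real ^ 'd"
  assumes W: "gauss_vec \<sigma> W" and \<sigma>: "\<sigma> > 0"
  shows "integrable M (\<lambda>\<omega>. (W \<omega> $ i) ^ n)"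
  using distributed_integrable[OF gauss_vec_component[OF W \<sigma>, of i], of "\<lambda>u. u ^ n"]
    integrable_normal_moment[OF \<sigma>, of 0 n] by simp

lemma gauss_vec_cov:
  fixes W :: "'a \<Rightarrow> real ^ 'd"
  assumes W: "gauss_vec \<sigma> W" and \<sigma>: "\<sigma> > 0"
  shows "integrable M (\<lambda>\<omega>. W \<omega> $ i)" "expectation (\<lambda>\<omega>. W \<omega> $ i) = 0"
    and "integrable M (\<lambda>\<omega>. W \<omega> $ i * W \<omega> $ j)"
    and "expectation (\<lambda>\<omega>. W \<omega> $ i * W \<omega> $ j) = (if i = j then \<sigma>\<^sup>2 else 0)"
proof -
  have int: "integrable M (\<lambda>\<omega>. W \<omega> $ i)" for i
    using gauss_vec_integrable_component[OF W \<sigma>, of i 1] by simp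
  have exp: "expectation (\<lambda>\<omega>. W \<omega> $ i) = 0" for i
    by (rule normal_distributed_expectation[OF \<sigma> gauss_vec_component[OF W \<sigma>]])
  show "integrable M (\<lambda>\<omega>. W \<omega> $ i)" "expectation (\<lambda>\<omega>. W \<omega> $ i) = 0" by fact+
  show "integrable M (\<lambda>\<omega>. W \<omega> $ i * W \<omega> $ j)"
  proof (cases "i = j")
    case True
    then show ?thesis
      using gauss_vec_integrable_component[OF W \<sigma>, of i 2] by (simp add: power2_eq_square)
  next
    case False
    then show ?thesis by (intro indep_var_integrable gauss_vec_indep_components[OF W \<sigma>] int)
  qed
  show "expectation (\<lambda>\<omega>. W \<omega> $ i * W \<omega> $ j) = (if i = j then \<sigma>\<^sup>2 else 0)"
  proof (cases "i = j")
    case True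
    then show ?thesis
      using normal_distributed_variance[OF \<sigma> gauss_vec_component[OF W \<sigma>, of i]] exp
      by (simp add: power2_eq_square)
  next
    case False
    then show ?thesis
      using indep_var_lebesgue_integral[OF gauss_vec_indep_components[OF W \<sigma> False] int int] exp
      by simp
  qed
qed

text \<open>Division by \<open>\<sigma>\<close> reduces every component to the standard normal law,
  which makes the constant uniform in \<open>\<sigma>\<close> and \<open>W\<close>.\<close>

lemma gauss_vec_moments:
  assumes "q \<ge> 1"
  shows "\<exists>C\<ge>0. \<forall>\<sigma> (W :: 'a \<Rightarrow> real ^ 'd). \<sigma> > 0 \<longrightarrow> gauss_vec \<sigma> W \<longrightarrow>
    (\<integral>\<^sup>+\<omega>. ennreal (norm (W \<omega>) powr q) \<partial>M) \<le> ennreal (C * \<sigma> powr q)"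
proof -
  define N where "N = nat \<lceil>q\<rceil>"
  have N: "q \<le> real N" "N \<ge> 1" using assms by (auto simp: N_def) linarith
  \<comment> \<open>For a natural \<open>N \<ge> q\<close>, the function
    \<open>1 + \<bar>u\<bar> ^ N\<close> dominates \<open>\<bar>u\<bar> powr q\<close>, so a moment
    of natural order suffices.\<close>
  define c where "c = (\<integral>u. std_normal_density u * (1 + \<bar>u\<bar> ^ N) \<partial>lborel)"
  have int: "integrable lborel (\<lambda>u. std_normal_density u * (1 + \<bar>u\<bar> ^ N))"
    using integrable_std_normal_moment_abs[of N] by (simp add: distrib_left)
  have c0: "c \<ge> 0" unfolding c_def by (intro integral_nonneg_AE) auto
  have comp: "(\<integral>\<^sup>+\<omega>. ennreal (\<bar>W \<omega> $ i\<bar> powr q) \<partial>M) \<le> ennreal (c * \<sigma> powr q)"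
    if \<sigma>: "\<sigma> > 0" and W: "gauss_vec \<sigma> W" for \<sigma> and W :: "'a \<Rightarrow> real ^ 'd" and i
  proof -
    have D: "distributed M lborel (\<lambda>\<omega>. (W \<omega> $ i - 0) / \<sigma>) std_normal_density"
      by (rule normal_standard_normal_convert[OF \<sigma>, THEN iffD1, OF gauss_vec_component[OF W \<sigma>]])
    have le: "\<bar>u\<bar> powr q \<le> 1 + \<bar>u\<bar> ^ N" for u :: real
    proof (cases "\<bar>u\<bar> \<le> 1")
      case True
      then have "\<bar>u\<bar> powr q \<le> 1" using assms by (intro powr_le1) auto
      then show ?thesis by (simp add: add_increasing2)
    next
      case False
      then have "\<bar>u\<bar> powr q \<le> \<bar>u\<bar> powr real N" using N by (intro powr_mono) auto
      also have "\<dots> = \<bar>u\<bar> ^ N" using False by (intro powr_realpow) auto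
      finally show ?thesis by simp
    qed
    have "(\<integral>\<^sup>+\<omega>. ennreal (\<bar>W \<omega> $ i\<bar> powr q) \<partial>M) =
        (\<integral>\<^sup>+\<omega>. ennreal (\<sigma> powr q) * ennreal (\<bar>(W \<omega> $ i - 0) / \<sigma>\<bar> powr q) \<partial>M)"
      using \<sigma> by (intro nn_integral_cong) (simp add: ennreal_mult[symmetric] powr_divide)
    also have "\<dots> = ennreal (\<sigma> powr q) * (\<integral>\<^sup>+\<omega>. ennreal (\<bar>(W \<omega> $ i - 0) / \<sigma>\<bar> powr q) \<partial>M)"
      using gauss_vec_measurable[OF W] by (intro nn_integral_cmult) measurable
    also have "(\<integral>\<^sup>+\<omega>. ennreal (\<bar>(W \<omega> $ i - 0) / \<sigma>\<bar> powr q) \<partial>M) =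
        (\<integral>\<^sup>+u. ennreal (std_normal_density u) * ennreal (\<bar>u\<bar> powr q) \<partial>lborel)"
      by (rule distributed_nn_integral[OF D, symmetric]) simp
    also have "ennreal (\<sigma> powr q) * \<dots> \<le>
        ennreal (\<sigma> powr q) * (\<integral>\<^sup>+u. ennreal (std_normal_density u * (1 + \<bar>u\<bar> ^ N)) \<partial>lborel)"
      using le by (intro mult_left_mono nn_integral_mono)
        (auto simp: ennreal_mult[symmetric] intro!: mult_left_mono ennreal_leI)
    also have "(\<integral>\<^sup>+u. ennreal (std_normal_density u * (1 + \<bar>u\<bar> ^ N)) \<partial>lborel) = ennreal c"
      unfolding c_def by (rule nn_integral_eq_integral[OF int]) auto
    finally show ?thesis using c0 by (simp add: ennreal_mult[symmetric] mult.commute)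
  qed
  define d where "d = real CARD('d)"
  show ?thesis
  proof (intro exI[of _ "d powr (q - 1) * (d * c)"] conjI allI impI)
    show "0 \<le> d powr (q - 1) * (d * c)" using c0 by (simp add: d_def)
    fix \<sigma> :: real and W :: "'a \<Rightarrow> real ^ 'd" assume \<sigma>: "\<sigma> > 0" and W: "gauss_vec \<sigma> W"
    note [measurable] = gauss_vec_measurable[OF W]
    have "(\<integral>\<^sup>+\<omega>. ennreal (norm (W \<omega>) powr q) \<partial>M) \<le>
        (\<integral>\<^sup>+\<omega>. ennreal (d powr (q - 1)) * (\<Sum>i\<in>UNIV. ennreal (\<bar>W \<omega> $ i\<bar> powr q)) \<partial>M)"
    proof (rule nn_integral_mono)
      fix \<omega>
      have "norm (W \<omega>) powr q \<le> (\<Sum>i\<in>UNIV. \<bar>W \<omega> $ i\<bar>) powr q"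
        using assms norm_le_l1_cart by (intro powr_mono2) auto
      also have "\<dots> \<le> d powr (q - 1) * (\<Sum>i\<in>UNIV. \<bar>W \<omega> $ i\<bar> powr q)"
        unfolding d_def using assms by (intro sum_powr_le) auto
      finally show "ennreal (norm (W \<omega>) powr q) \<le>
          ennreal (d powr (q - 1)) * (\<Sum>i\<in>UNIV. ennreal (\<bar>W \<omega> $ i\<bar> powr q))"
        by (simp add: ennreal_mult[symmetric] sum_nonneg ennreal_leI)
    qed
    also have "\<dots> = ennreal (d powr (q - 1)) * (\<Sum>i\<in>UNIV. \<integral>\<^sup>+\<omega>. ennreal (\<bar>W \<omega> $ i\<bar> powr q) \<partial>M)"
      by (subst nn_integral_cmult, simp, subst nn_integral_sum) simp_all
    also have "\<dots> \<le> ennreal (d powr (q - 1)) * (\<Sum>i\<in>(UNIV :: 'd set). ennreal (c * \<sigma> powr q))"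
      using comp[OF \<sigma> W] by (intro mult_left_mono sum_mono) auto
    also have "\<dots> = ennreal (d powr (q - 1) * (d * c) * \<sigma> powr q)"
      using c0 by (simp add: d_def ennreal_of_nat_eq_real_of_nat ennreal_mult[symmetric] mult_ac)
    finally show "(\<integral>\<^sup>+\<omega>. ennreal (norm (W \<omega>) powr q) \<partial>M) \<le> ennreal (d powr (q - 1) * (d * c) * \<sigma> powr q)" .
  qed
qed

text \<open>The contribution of independence to the one-step estimate: terms linear in the increment
  average to zero, and a quadratic form averages to \<open>\<sigma>\<^sup>2\<close> times its
  trace.\<close>

lemma indep_bounded_moments:
  fixes W :: "'a \<Rightarrow> real ^ 'd" and Y :: "'a \<Rightarrow> real"
  assumes W: "gauss_vec \<sigma> W" and \<sigma>: "\<sigma> > 0"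
    and ind: "indep_set (sets G) {W -` A \<inter> space M | A. A \<in> sets borel}"
    and G: "subalgebra M G" and Y: "Y \<in> borel_measurable G"
    and bd: "\<And>\<omega>. \<omega> \<in> space M \<Longrightarrow> \<bar>Y \<omega>\<bar> \<le> c"
  shows "has_bochner_integral M (\<lambda>\<omega>. Y \<omega> * W \<omega> $ i) 0"
    and "has_bochner_integral M (\<lambda>\<omega>. Y \<omega> * (W \<omega> $ i * W \<omega> $ j))
      ((if i = j then \<sigma>\<^sup>2 else 0) * expectation Y)"
proof -
  note Wm = gauss_vec_measurable[OF W] and cov = gauss_vec_cov[OF W \<sigma>]
  have intY: "integrable M Y"
    using measurable_from_subalg[OF G Y] bd
    by (intro Bochner_Integration.integrable_bound[of M "\<lambda>_. c" Y] AE_I2) (auto intro: order_trans[OF _ abs_ge_self])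
  have 1: "indep_var borel Y borel (\<lambda>\<omega>. W \<omega> $ i)"
    by (rule indep_var_of_indep_set[OF ind G Wm Y]) simp
  have 2: "indep_var borel Y borel (\<lambda>\<omega>. W \<omega> $ i * W \<omega> $ j)"
    by (rule indep_var_of_indep_set[OF ind G Wm Y, of "\<lambda>x. x $ i * x $ j"]) simp
  show "has_bochner_integral M (\<lambda>\<omega>. Y \<omega> * W \<omega> $ i) 0"
    unfolding has_bochner_integral_iff
    using indep_var_integrable[OF 1 intY cov(1)] indep_var_lebesgue_integral[OF 1 intY cov(1)] cov(2)
    by simp
  show "has_bochner_integral M (\<lambda>\<omega>. Y \<omega> * (W \<omega> $ i * W \<omega> $ j))
      ((if i = j then \<sigma>\<^sup>2 else 0) * expectation Y)"
    unfolding has_bochner_integral_iff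
    using indep_var_integrable[OF 2 intY cov(3)] indep_var_lebesgue_integral[OF 2 intY cov(3)] cov(4)
    by simp
qed

end

section \<open>The Lyapunov function\<close>

definition dunkl_drift :: "(real ^ 'd) set \<Rightarrow> (real ^ 'd \<Rightarrow> real) \<Rightarrow> real ^ 'd \<Rightarrow> real ^ 'd" where
  "dunkl_drift Rp k x = (\<Sum>\<alpha>\<in>Rp. (k \<alpha> / (\<alpha> \<bullet> x)) *\<^sub>R \<alpha>)"

text \<open>Only pairings with roots are bounded, because \<open>lyap\<close> and
  \<open>dunkl_drift\<close> depend on \<open>x\<close> through them alone. The set need not be
  compact when the roots do not span the space.\<close>

definition chamber_box :: "(real ^ 'd) set \<Rightarrow> real \<Rightarrow> real \<Rightarrow> (real ^ 'd) set" where
  "chamber_box Rp \<delta> r = {x. \<forall>\<alpha>\<in>Rp. \<delta> \<le> \<alpha> \<bullet> x \<and> \<alpha> \<bullet> x \<le> r}"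

text \<open>Since \<open>u - ln u \<ge> 0\<close>, every factor is at least one, so that
  this Lyapunov function dominates each single inverse power.\<close>

definition lyap :: "(real ^ 'd) set \<Rightarrow> real \<Rightarrow> real ^ 'd \<Rightarrow> real" where
  "lyap Rp m x = exp (\<Sum>\<alpha>\<in>Rp. m * (\<alpha> \<bullet> x) - m * ln (\<alpha> \<bullet> x))"

text \<open>The gradient of \<open>ln (lyap Rp m x)\<close>; the gradient of \<open>lyap\<close>
  itself is \<open>lyap\<close> times this vector.\<close>

definition lyap_grad :: "(real ^ 'd) set \<Rightarrow> real \<Rightarrow> real ^ 'd \<Rightarrow> real ^ 'd" where
  "lyap_grad Rp m x = (\<Sum>\<alpha>\<in>Rp. (m - m / (\<alpha> \<bullet> x)) *\<^sub>R \<alpha>)"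

text \<open>The Hessian of \<open>lyap\<close>, divided by \<open>lyap\<close>, as a bilinear form
  in \<open>y\<close> and \<open>z\<close>.\<close>

definition lyap_form :: "(real ^ 'd) set \<Rightarrow> real \<Rightarrow> real ^ 'd \<Rightarrow> real ^ 'd \<Rightarrow> real ^ 'd \<Rightarrow> real" where
  "lyap_form Rp m x y z = (lyap_grad Rp m x \<bullet> y) * (lyap_grad Rp m x \<bullet> z)
     + m * (\<Sum>\<alpha>\<in>Rp. (\<alpha> \<bullet> y) * (\<alpha> \<bullet> z) / (\<alpha> \<bullet> x)\<^sup>2)"

text \<open>The generator applied to \<open>lyap\<close>, divided by \<open>lyap\<close>, for the
  worst additional drift of norm at most \<open>\<beta>\<close>.\<close>

definition lyap_gen :: "(real ^ 'd) set \<Rightarrow> (real ^ 'd \<Rightarrow> real) \<Rightarrow> real \<Rightarrow> real \<Rightarrow> real ^ 'd \<Rightarrow> real" where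
  "lyap_gen Rp k m \<beta> x = ((norm (lyap_grad Rp m x))\<^sup>2 + m * (\<Sum>\<alpha>\<in>Rp. (norm \<alpha>)\<^sup>2 / (\<alpha> \<bullet> x)\<^sup>2)) / 2
    + lyap_grad Rp m x \<bullet> dunkl_drift Rp k x + \<beta> * norm (lyap_grad Rp m x)"

text \<open>Here \<open>w\<close> stands for the Brownian increment over a time step \<open>h\<close>, and \<open>\<beta>\<close> for the bound of the
  additional drift.\<close>

definition lyap_bound ::
    "(real ^ 'd) set \<Rightarrow> (real ^ 'd \<Rightarrow> real) \<Rightarrow> real \<Rightarrow> real \<Rightarrow> real \<Rightarrow> real ^ 'd \<Rightarrow> real ^ 'd \<Rightarrow> real" where
  "lyap_bound Rp k m \<beta> h x w = lyap Rp m x * (1 + lyap_grad Rp m x \<bullet> w + lyap_form Rp m x w w / 2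
    + h * (lyap_grad Rp m x \<bullet> dunkl_drift Rp k x + \<beta> * norm (lyap_grad Rp m x)))"

text \<open>These are the quantities left over by the one-step expansion. For a Brownian path each
  of them has mean at most of order \<open>h * sqrt h\<close>.\<close>

definition incr_error :: "(real \<Rightarrow> 'a::real_normed_vector) \<Rightarrow> real \<Rightarrow> real \<Rightarrow> real" where
  "incr_error B s h = h * norm (B (s + h) - B s) + h\<^sup>2 + norm (B (s + h) - B s) ^ 3
    + integral {s..s+h} (\<lambda>r. norm (B r - B s))"

lemma lyap_pos: "lyap Rp m x > 0"
  by (simp add: lyap_def)

lemma powr_le_lyap:
  assumes "finite Rp" "x \<in> weyl_chamber Rp" "\<alpha> \<in> Rp" "m \<ge> 0"
  shows "(\<alpha> \<bullet> x) powr (- m) \<le> lyap Rp m x"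
proof -
  have pos: "\<beta> \<bullet> x > 0" if "\<beta> \<in> Rp" for \<beta> using assms that by (auto simp: weyl_chamber_def)
  have "0 \<le> m * (\<beta> \<bullet> x) - m * ln (\<beta> \<bullet> x)" if "\<beta> \<in> Rp" for \<beta>
    using ln_le_minus_one[OF pos[OF that]] assms(4) by (auto simp flip: right_diff_distrib)
  then have "m * (\<alpha> \<bullet> x) - m * ln (\<alpha> \<bullet> x) \<le> (\<Sum>\<beta>\<in>Rp. m * (\<beta> \<bullet> x) - m * ln (\<beta> \<bullet> x))"
    using assms by (intro member_le_sum) auto
  moreover have "0 \<le> m * (\<alpha> \<bullet> x)" using pos[OF assms(3)] assms(4) by simp
  ultimately have "- m * ln (\<alpha> \<bullet> x) \<le> (\<Sum>\<beta>\<in>Rp. m * (\<beta> \<bullet> x) - m * ln (\<beta> \<bullet> x))" by simp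
  then show ?thesis using pos[OF assms(3)] by (simp add: lyap_def powr_def)
qed

text \<open>With \<open>s = lyap_grad Rp m x \<bullet> z\<close> the form dominates
  \<open>s * s\<close>, and \<open>1 + s + s * s / 2\<close> is half of
  \<open>(1 + s)\<^sup>2 + 1\<close>.\<close>

lemma lyap_taylor_nonneg:
  assumes "m \<ge> 0"
  shows "0 \<le> 1 + lyap_grad Rp m x \<bullet> z + lyap_form Rp m x z z / 2"
proof -
  let ?s = "lyap_grad Rp m x \<bullet> z"
  have "0 \<le> (\<Sum>\<alpha>\<in>Rp. (\<alpha> \<bullet> z) * (\<alpha> \<bullet> z) / (\<alpha> \<bullet> x)\<^sup>2)" by (intro sum_nonneg) simp
  then have "?s * ?s \<le> lyap_form Rp m x z z" using assms by (simp add: lyap_form_def)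
  moreover have "0 \<le> (1 + ?s)\<^sup>2 + 1" by simp
  then have "0 \<le> 2 * (1 + ?s) + ?s * ?s" by (simp add: power2_eq_square algebra_simps)
  ultimately show ?thesis by simp
qed

lemma lyap_form_add:
  "lyap_form Rp m x (y + z) (y + z) =
    lyap_form Rp m x y y + 2 * lyap_form Rp m x y z + lyap_form Rp m x z z"
proof -
  have "(\<Sum>\<alpha>\<in>Rp. (\<alpha> \<bullet> (y + z)) * (\<alpha> \<bullet> (y + z)) / (\<alpha> \<bullet> x)\<^sup>2) =
      (\<Sum>\<alpha>\<in>Rp. (\<alpha> \<bullet> y) * (\<alpha> \<bullet> y) / (\<alpha> \<bullet> x)\<^sup>2) + 2 * (\<Sum>\<alpha>\<in>Rp. (\<alpha> \<bullet> y) * (\<alpha> \<bullet> z) / (\<alpha> \<bullet> x)\<^sup>2)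
      + (\<Sum>\<alpha>\<in>Rp. (\<alpha> \<bullet> z) * (\<alpha> \<bullet> z) / (\<alpha> \<bullet> x)\<^sup>2)"
    unfolding sum_distrib_left sum.distrib[symmetric]
    by (intro sum.cong refl) (simp add: inner_add_right algebra_simps add_divide_distrib)
  then show ?thesis by (simp add: lyap_form_def inner_add_right algebra_simps)
qed

text \<open>Let \<open>S\<close> be the sum of the vectors \<open>\<alpha>\<close> divided by
  \<open>\<alpha> \<bullet> x\<close>, and \<open>Q\<close> the sum of their squared norms. The root
  identities give \<open>S \<bullet> S = Q\<close> and
  \<open>S \<bullet> dunkl_drift Rp k x \<ge> \<kappa> * Q\<close>. The total coefficient of
  \<open>Q\<close> is then \<open>m * ((m + 1) / 2 - \<kappa>)\<close>, which is negative, while all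
  other terms grow at most like \<open>sqrt Q\<close>.\<close>

lemma lyap_generator_bound:
  fixes R Rp :: "(real ^ 'd) set"
  assumes R: "root_system R" and Rp: "positive_root_system R Rp" and k: "multiplicity_function R k"
    and \<kappa>: "\<And>\<alpha>. \<alpha> \<in> Rp \<Longrightarrow> \<kappa> \<le> k \<alpha>" and m: "m > 0" "m + 1 < 2 * \<kappa>" and \<beta>: "\<beta> \<ge> 0"
  shows "\<exists>C\<ge>0. \<forall>x\<in>weyl_chamber Rp. lyap_gen Rp k m \<beta> x \<le> C"
proof -
  define \<rho> where "\<rho> = (\<Sum>\<alpha>\<in>Rp. \<alpha>)"
  define p where "p = norm \<rho>"
  define K where "K = (\<Sum>\<alpha>\<in>Rp. k \<alpha>)"
  define c where "c = \<kappa> - (m + 1) / 2"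
  define A where "A = m\<^sup>2 * p + m * p * K + \<beta> * m"
  define B where "B = m\<^sup>2 * p\<^sup>2 / 2 + \<beta> * m * p"
  have kpos: "0 \<le> k \<alpha>" if "\<alpha> \<in> Rp" for \<alpha> using \<kappa>[OF that] m by simp
  have c: "c > 0" using m by (simp add: c_def)
  have p: "p \<ge> 0" by (simp add: p_def)
  show ?thesis
  \<comment> \<open>The witness is the maximum over \<open>s\<close> of the quadratic
    \<open>- (m * c) * s\<^sup>2 + A * s + B\<close>, where \<open>s\<close> stands for
    \<open>sqrt Q\<close>.\<close>
  proof (intro exI[of _ "A\<^sup>2 / (4 * (m * c)) + B"] conjI ballI)
    show "0 \<le> A\<^sup>2 / (4 * (m * c)) + B" using c m \<beta> p by (simp add: B_def)
    fix x assume "x \<in> weyl_chamber Rp"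
    then have pos: "\<alpha> \<bullet> x > 0" if "\<alpha> \<in> Rp" for \<alpha> using that by (auto simp: weyl_chamber_def)
    then have nz: "\<alpha> \<bullet> x \<noteq> 0" if "\<alpha> \<in> Rp" for \<alpha> using that by force
    define S where "S = (\<Sum>\<alpha>\<in>Rp. (1 / (\<alpha> \<bullet> x)) *\<^sub>R \<alpha>)"
    define Q where "Q = (\<Sum>\<alpha>\<in>Rp. (norm \<alpha>)\<^sup>2 / (\<alpha> \<bullet> x)\<^sup>2)"
    define s where "s = sqrt Q"
    let ?f = "dunkl_drift Rp k x"
    have fin: "finite Rp" by (rule root_finite(2)[OF R Rp])
    have Q: "Q \<ge> 0" unfolding Q_def by (intro sum_nonneg) simp
    have s: "s \<ge> 0" "s\<^sup>2 = Q" using Q by (auto simp: s_def)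
    have one: "multiplicity_function R (\<lambda>_. 1)" by (simp add: multiplicity_function_def)
    have SS: "S \<bullet> S = Q"
      using log_gradient_inner[OF R Rp one nz] by (simp add: S_def Q_def)
    then have nS: "norm S = s" by (simp add: s_def norm_eq_sqrt_inner)
    have Sf: "\<kappa> * Q \<le> S \<bullet> ?f"
    proof -
      have "\<kappa> * Q \<le> (\<Sum>\<alpha>\<in>Rp. k \<alpha> * (norm \<alpha>)\<^sup>2 / (\<alpha> \<bullet> x)\<^sup>2)"
        unfolding Q_def sum_distrib_left
        by (rule sum_mono) (use \<kappa> in \<open>auto intro!: divide_right_mono mult_right_mono\<close>)
      also have "\<dots> = S \<bullet> ?f"
        using log_gradient_inner[OF R Rp k nz] by (simp add: S_def dunkl_drift_def)
      finally show ?thesis .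
    qed
    have nf: "norm ?f \<le> K * s"
      unfolding dunkl_drift_def K_def sum_distrib_right
    proof (rule sum_norm_le)
      fix \<alpha> assume \<alpha>: "\<alpha> \<in> Rp"
      have "(norm \<alpha> / (\<alpha> \<bullet> x))\<^sup>2 \<le> Q"
        unfolding Q_def power_divide using fin \<alpha>
        by (intro member_le_sum[where f="\<lambda>\<alpha>. (norm \<alpha>)\<^sup>2 / (\<alpha> \<bullet> x)\<^sup>2"]) auto
      then have "norm \<alpha> / (\<alpha> \<bullet> x) \<le> s" unfolding s_def by (rule real_le_rsqrt)
      then have "k \<alpha> * (norm \<alpha> / (\<alpha> \<bullet> x)) \<le> k \<alpha> * s"
        using kpos[OF \<alpha>] by (rule mult_left_mono)
      then show "norm ((k \<alpha> / (\<alpha> \<bullet> x)) *\<^sub>R \<alpha>) \<le> k \<alpha> * s"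
        using kpos[OF \<alpha>] pos[OF \<alpha>] by simp
    qed
    have g: "lyap_grad Rp m x = m *\<^sub>R (\<rho> - S)"
      by (simp add: lyap_grad_def \<rho>_def S_def scaleR_sum_right sum_subtractf[symmetric]
          scaleR_diff_left scaleR_diff_right)
    have nd: "norm (\<rho> - S) \<le> p + s" using norm_triangle_ineq4[of \<rho> S] by (simp add: p_def nS)
    have ng: "norm (lyap_grad Rp m x) \<le> m * (p + s)"
      unfolding g using nd m by simp
    then have ng2: "(norm (lyap_grad Rp m x))\<^sup>2 \<le> (m * (p + s))\<^sup>2" by (intro power_mono) auto
    have "\<rho> \<bullet> ?f \<le> p * (K * s)"
      using order_trans[OF norm_cauchy_schwarz mult_left_mono[OF nf norm_ge_zero]] by (simp add: p_def)
    then have "(\<rho> - S) \<bullet> ?f \<le> p * (K * s) - \<kappa> * Q" using Sf by (simp add: inner_diff_left)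
    then have gf: "lyap_grad Rp m x \<bullet> ?f \<le> m * (p * (K * s) - \<kappa> * Q)"
      unfolding g using m by (simp add: mult_left_mono)
    have bg: "\<beta> * norm (lyap_grad Rp m x) \<le> \<beta> * (m * (p + s))" using ng \<beta> by (rule mult_left_mono)
    have "((norm (lyap_grad Rp m x))\<^sup>2 + m * Q) / 2 + lyap_grad Rp m x \<bullet> ?f
        + \<beta> * norm (lyap_grad Rp m x)
        \<le> ((m * (p + s))\<^sup>2 + m * Q) / 2 + m * (p * (K * s) - \<kappa> * Q) + \<beta> * (m * (p + s))"
      using ng2 gf bg by argo
    also have "\<dots> = - (m * c) * s\<^sup>2 + A * s + B"
      unfolding s(2)[symmetric] by (simp add: A_def B_def c_def power2_eq_square algebra_simps)
    also have "\<dots> = A\<^sup>2 / (4 * (m * c)) + B - (m * c) * (s - A / (2 * (m * c)))\<^sup>2"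
      using m c by (simp add: power2_eq_square field_simps)
    also have "\<dots> \<le> A\<^sup>2 / (4 * (m * c)) + B" using m c by simp
    finally show "lyap_gen Rp k m \<beta> x \<le> A\<^sup>2 / (4 * (m * c)) + B"
      by (simp add: lyap_gen_def Q_def)
  qed
qed

section \<open>Taylor expansion of the Lyapunov function on boxes\<close>

lemma lyap_box_bound:
  assumes "\<delta> > 0" "m \<ge> 0" "finite Rp" "x \<in> chamber_box Rp \<delta> r"
  shows "lyap Rp m x \<le> exp (real (card Rp) * (m * r - m * ln \<delta>))"
proof -
  have "(\<Sum>\<alpha>\<in>Rp. m * (\<alpha> \<bullet> x) - m * ln (\<alpha> \<bullet> x)) \<le> (\<Sum>\<alpha>\<in>Rp. m * r - m * ln \<delta>)"
  proof (rule sum_mono)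
    fix \<alpha> assume "\<alpha> \<in> Rp"
    then have "\<delta> \<le> \<alpha> \<bullet> x" "\<alpha> \<bullet> x \<le> r" using assms(4) by (auto simp: chamber_box_def)
    then show "m * (\<alpha> \<bullet> x) - m * ln (\<alpha> \<bullet> x) \<le> m * r - m * ln \<delta>"
      using assms by (intro diff_mono mult_left_mono) auto
  qed
  then show ?thesis by (simp add: lyap_def)
qed

lemma sum_inner_pow_le:
  fixes z :: "'a::real_inner"
  shows "(\<Sum>\<alpha>\<in>A. \<bar>\<alpha> \<bullet> z\<bar> ^ n) \<le> (\<Sum>\<alpha>\<in>A. norm \<alpha> ^ n) * norm z ^ n"
  unfolding sum_distrib_right power_mult_distrib[symmetric]
  by (intro sum_mono power_mono Cauchy_Schwarz_ineq2) auto

text \<open>The box is convex, so the expansion can follow the segment from \<open>x\<close> to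
  \<open>y\<close>. All pairings stay above \<open>\<delta>\<close> there, which bounds the third
  derivative uniformly.\<close>

lemma lyap_taylor:
  assumes \<delta>: "\<delta> > 0" and m: "m \<ge> 0" and fin: "finite Rp"
  shows "\<exists>C\<ge>0. \<forall>x\<in>chamber_box Rp \<delta> r. \<forall>y\<in>chamber_box Rp \<delta> r.
    lyap Rp m y \<le> lyap Rp m x * (1 + lyap_grad Rp m x \<bullet> (y - x) + lyap_form Rp m x (y - x) (y - x) / 2)
      + C * norm (y - x) ^ 3"
proof -
  define n1 where "n1 = (\<Sum>\<alpha>\<in>Rp. norm \<alpha>)"
  define n2 where "n2 = (\<Sum>\<alpha>\<in>Rp. norm \<alpha> ^ 2)"
  define n3 where "n3 = (\<Sum>\<alpha>\<in>Rp. norm \<alpha> ^ 3)"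
  \<comment> \<open>Up to powers of \<open>norm z\<close>, the numbers \<open>b1\<close>,
    \<open>b2\<close>, \<open>b3\<close> bound the first three logarithmic derivatives along the
    segment; \<open>E\<close> bounds the Lyapunov function on the box.\<close>
  define b1 where "b1 = m * (1 + 1 / \<delta>) * n1"
  define b2 where "b2 = m / \<delta>\<^sup>2 * n2"
  define b3 where "b3 = 2 * m / \<delta> ^ 3 * n3"
  define E where "E = exp (real (card Rp) * (m * r - m * ln \<delta>))"
  have n: "n1 \<ge> 0" "n2 \<ge> 0" "n3 \<ge> 0" by (auto simp: n1_def n2_def n3_def intro: sum_nonneg)
  have b: "b1 \<ge> 0" "b2 \<ge> 0" "b3 \<ge> 0" using n m \<delta> by (auto simp: b1_def b2_def b3_def)
  define C where "C = (b1 ^ 3 + 3 * b1 * b2 + b3) * E"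
  show ?thesis
  proof (intro exI[of _ C] conjI ballI)
    show "0 \<le> C" using b by (simp add: C_def E_def)
    fix x y assume x: "x \<in> chamber_box Rp \<delta> r" and y: "y \<in> chamber_box Rp \<delta> r"
    define z where "z = y - x"
    define u where "u \<alpha> t = \<alpha> \<bullet> x + t * (\<alpha> \<bullet> z)" for \<alpha> t
    define \<phi> where "\<phi> t = exp (\<Sum>\<alpha>\<in>Rp. m * u \<alpha> t - m * ln (u \<alpha> t))" for t
    \<comment> \<open>\<open>s1\<close>, \<open>s2\<close>, \<open>s3\<close> are the first three
      derivatives of \<open>ln (\<phi> t)\<close>; up to order three, \<open>D i\<close> is the
      derivative of \<open>\<phi>\<close> of order \<open>i\<close> expressed through them.\<close>
    define s1 where "s1 t = (\<Sum>\<alpha>\<in>Rp. m * (\<alpha> \<bullet> z) - m * (\<alpha> \<bullet> z) / u \<alpha> t)" for t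
    define s2 where "s2 t = (\<Sum>\<alpha>\<in>Rp. m * (\<alpha> \<bullet> z)\<^sup>2 / (u \<alpha> t)\<^sup>2)" for t
    define s3 where "s3 t = (\<Sum>\<alpha>\<in>Rp. - (2 * m * (\<alpha> \<bullet> z) ^ 3 / (u \<alpha> t) ^ 3))" for t
    define D where "D i t = (if i = 0 then \<phi> t else if i = 1 then s1 t * \<phi> t
        else if i = 2 then ((s1 t)\<^sup>2 + s2 t) * \<phi> t
        else ((s1 t) ^ 3 + 3 * s1 t * s2 t + s3 t) * \<phi> t)" for i :: nat and t
    have inbox: "x + t *\<^sub>R z \<in> chamber_box Rp \<delta> r" and u_bd: "\<And>\<alpha>. \<alpha> \<in> Rp \<Longrightarrow> \<delta> \<le> u \<alpha> t"
      if t: "0 \<le> t" "t \<le> 1" for t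
    proof -
      have *: "\<delta> \<le> u \<alpha> t \<and> u \<alpha> t \<le> r" if "\<alpha> \<in> Rp" for \<alpha>
      proof -
        have a: "\<delta> \<le> \<alpha> \<bullet> x" "\<delta> \<le> \<alpha> \<bullet> y" "\<alpha> \<bullet> x \<le> r" "\<alpha> \<bullet> y \<le> r"
          using x y that by (auto simp: chamber_box_def)
        have eq: "u \<alpha> t = (1 - t) * (\<alpha> \<bullet> x) + t * (\<alpha> \<bullet> y)"
          by (simp add: u_def z_def inner_diff_right algebra_simps)
        have "(1 - t) * \<delta> + t * \<delta> \<le> u \<alpha> t" "u \<alpha> t \<le> (1 - t) * r + t * r"
          unfolding eq using t a by (auto intro!: add_mono mult_left_mono)
        then show ?thesis by (simp add: algebra_simps)
      qed
      then show "\<And>\<alpha>. \<alpha> \<in> Rp \<Longrightarrow> \<delta> \<le> u \<alpha> t" by blast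
      show "x + t *\<^sub>R z \<in> chamber_box Rp \<delta> r"
        using * by (simp add: chamber_box_def inner_add_right u_def)
    qed
    have du: "(u \<alpha> has_real_derivative (\<alpha> \<bullet> z)) (at t)" for \<alpha> t
      unfolding u_def by (auto intro!: derivative_eq_intros)
    have der: "(D i has_real_derivative D (Suc i) t) (at t)" if i: "i < 3" and t: "0 \<le> t" "t \<le> 1" for i t
    proof -
      have up: "u \<alpha> t > 0" if "\<alpha> \<in> Rp" for \<alpha> using u_bd[OF t that] \<delta> by simp
      have d\<phi>: "(\<phi> has_real_derivative s1 t * \<phi> t) (at t)"
        unfolding \<phi>_def s1_def
        using up by (auto intro!: derivative_eq_intros du sum.cong simp: mult.commute)
      have d1: "(s1 has_real_derivative s2 t) (at t)"
        unfolding s1_def[abs_def] s2_def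
        using up by (auto intro!: derivative_eq_intros du sum.cong simp: power2_eq_square) (metis less_irrefl)
      have d2: "(s2 has_real_derivative s3 t) (at t)"
        unfolding s2_def[abs_def] s3_def
      proof (rule DERIV_sum)
        fix \<alpha> assume "\<alpha> \<in> Rp"
        then have "u \<alpha> t \<noteq> 0" using up by force
        then show "((\<lambda>t. m * (\<alpha> \<bullet> z)\<^sup>2 / (u \<alpha> t)\<^sup>2) has_real_derivative
            - (2 * m * (\<alpha> \<bullet> z) ^ 3 / (u \<alpha> t) ^ 3)) (at t)"
          by (auto intro!: derivative_eq_intros du simp: power2_eq_square power3_eq_cube field_simps)
      qed
      consider "i = 0" | "i = 1" | "i = 2" using i by linarith
      then show ?thesis
      proof cases
        case 1
        then show ?thesis using d\<phi> by (simp add: D_def[abs_def])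
      next
        case 2
        have "((\<lambda>t. s1 t * \<phi> t) has_real_derivative ((s1 t)\<^sup>2 + s2 t) * \<phi> t) (at t)"
          by (rule DERIV_cong[OF DERIV_mult[OF d1 d\<phi>]]) (simp add: power2_eq_square algebra_simps)
        then show ?thesis using 2 by (simp add: D_def[abs_def])
      next
        case 3
        have "((\<lambda>t. ((s1 t)\<^sup>2 + s2 t) * \<phi> t) has_real_derivative
            ((s1 t) ^ 3 + 3 * s1 t * s2 t + s3 t) * \<phi> t) (at t)"
          by (rule derivative_eq_intros d1 d2 d\<phi> refl)+
             (simp add: power2_eq_square power3_eq_cube algebra_simps)
        then show ?thesis using 3 by (simp add: D_def[abs_def])
      qed
    qed
    have "\<exists>t>0. t < 1 \<and> \<phi> 1 = (\<Sum>i<3. D i 0 / fact i * 1 ^ i) + D 3 t / fact 3 * 1 ^ 3"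
    proof (rule Maclaurin)
      show "D 0 = \<phi>" by (auto simp: D_def)
      show "\<forall>i t. i < 3 \<and> 0 \<le> t \<and> t \<le> 1 \<longrightarrow> (D i has_real_derivative D (Suc i) t) (at t)"
        using der by blast
    qed simp_all
    then obtain t where t: "0 < t" "t < 1"
      and eq: "\<phi> 1 = (\<Sum>i<3. D i 0 / fact i * 1 ^ i) + D 3 t / fact 3 * 1 ^ 3" by blast
    have \<phi>0: "\<phi> 0 = lyap Rp m x" by (simp add: \<phi>_def lyap_def u_def)
    have \<phi>1: "\<phi> 1 = lyap Rp m y" by (simp add: \<phi>_def lyap_def u_def z_def inner_diff_right)
    have s10: "s1 0 = lyap_grad Rp m x \<bullet> z"
      by (simp add: s1_def u_def lyap_grad_def inner_sum_left inner_diff_left algebra_simps)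
    have s20: "(s1 0)\<^sup>2 + s2 0 = lyap_form Rp m x z z"
      by (simp add: s10 s2_def lyap_form_def u_def power2_eq_square sum_distrib_left)
    have "D 3 t \<le> C * norm z ^ 3"
    proof -
      have ud: "\<delta> \<le> u \<alpha> t" if "\<alpha> \<in> Rp" for \<alpha> using u_bd[of t] t that by simp
      have "\<bar>s1 t\<bar> \<le> (\<Sum>\<alpha>\<in>Rp. m * (1 + 1 / \<delta>) * \<bar>\<alpha> \<bullet> z\<bar> ^ 1)"
        unfolding s1_def
      proof (rule order_trans[OF sum_abs sum_mono])
        fix \<alpha> assume \<alpha>: "\<alpha> \<in> Rp"
        have "\<bar>m * (\<alpha> \<bullet> z) - m * (\<alpha> \<bullet> z) / u \<alpha> t\<bar> \<le> m * \<bar>\<alpha> \<bullet> z\<bar> + m * \<bar>\<alpha> \<bullet> z\<bar> / u \<alpha> t"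
          using ud[OF \<alpha>] \<delta> m by (intro order_trans[OF abs_triangle_ineq4]) (simp add: abs_mult)
        also have "m * \<bar>\<alpha> \<bullet> z\<bar> / u \<alpha> t \<le> m * \<bar>\<alpha> \<bullet> z\<bar> / \<delta>"
          using ud[OF \<alpha>] \<delta> m by (intro divide_left_mono) auto
        finally show "\<bar>m * (\<alpha> \<bullet> z) - m * (\<alpha> \<bullet> z) / u \<alpha> t\<bar> \<le> m * (1 + 1 / \<delta>) * \<bar>\<alpha> \<bullet> z\<bar> ^ 1"
          by (simp add: algebra_simps)
      qed
      also have "\<dots> \<le> m * (1 + 1 / \<delta>) * ((\<Sum>\<alpha>\<in>Rp. norm \<alpha> ^ 1) * norm z ^ 1)"
        unfolding sum_distrib_left[symmetric]
        using m \<delta> fin by (intro mult_left_mono sum_inner_pow_le) auto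
      finally have B1: "\<bar>s1 t\<bar> \<le> b1 * norm z" by (simp add: b1_def n1_def mult_ac)
      have "\<bar>s2 t\<bar> \<le> (\<Sum>\<alpha>\<in>Rp. m / \<delta>\<^sup>2 * \<bar>\<alpha> \<bullet> z\<bar> ^ 2)"
        unfolding s2_def
      proof (rule order_trans[OF sum_abs sum_mono])
        fix \<alpha> assume \<alpha>: "\<alpha> \<in> Rp"
        have "m * (\<alpha> \<bullet> z)\<^sup>2 / (u \<alpha> t)\<^sup>2 \<le> m * (\<alpha> \<bullet> z)\<^sup>2 / \<delta>\<^sup>2"
          using ud[OF \<alpha>] \<delta> m by (intro divide_left_mono power_mono) auto
        then show "\<bar>m * (\<alpha> \<bullet> z)\<^sup>2 / (u \<alpha> t)\<^sup>2\<bar> \<le> m / \<delta>\<^sup>2 * \<bar>\<alpha> \<bullet> z\<bar> ^ 2"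
          using m by simp
      qed
      also have "\<dots> \<le> m / \<delta>\<^sup>2 * ((\<Sum>\<alpha>\<in>Rp. norm \<alpha> ^ 2) * norm z ^ 2)"
        unfolding sum_distrib_left[symmetric]
        using m \<delta> fin by (intro mult_left_mono sum_inner_pow_le) auto
      finally have B2: "\<bar>s2 t\<bar> \<le> b2 * norm z ^ 2" by (simp add: b2_def n2_def mult_ac)
      have "\<bar>s3 t\<bar> \<le> (\<Sum>\<alpha>\<in>Rp. 2 * m / \<delta> ^ 3 * \<bar>\<alpha> \<bullet> z\<bar> ^ 3)"
        unfolding s3_def
      proof (rule order_trans[OF sum_abs sum_mono])
        fix \<alpha> assume \<alpha>: "\<alpha> \<in> Rp"
        have "2 * m * \<bar>\<alpha> \<bullet> z\<bar> ^ 3 / (u \<alpha> t) ^ 3 \<le> 2 * m * \<bar>\<alpha> \<bullet> z\<bar> ^ 3 / \<delta> ^ 3"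
          using ud[OF \<alpha>] \<delta> m by (intro divide_left_mono power_mono) auto
        then show "\<bar>- (2 * m * (\<alpha> \<bullet> z) ^ 3 / (u \<alpha> t) ^ 3)\<bar> \<le> 2 * m / \<delta> ^ 3 * \<bar>\<alpha> \<bullet> z\<bar> ^ 3"
          using m ud[OF \<alpha>] \<delta> by (simp add: abs_mult power_abs)
      qed
      also have "\<dots> \<le> 2 * m / \<delta> ^ 3 * ((\<Sum>\<alpha>\<in>Rp. norm \<alpha> ^ 3) * norm z ^ 3)"
        unfolding sum_distrib_left[symmetric]
        using m \<delta> fin by (intro mult_left_mono sum_inner_pow_le) auto
      finally have B3: "\<bar>s3 t\<bar> \<le> b3 * norm z ^ 3" by (simp add: b3_def n3_def mult_ac)
      have "\<bar>s1 t\<bar> ^ 3 \<le> (b1 * norm z) ^ 3" using B1 by (intro power_mono) auto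
      then have P1: "(s1 t) ^ 3 \<le> b1 ^ 3 * norm z ^ 3"
        using abs_ge_self[of "(s1 t) ^ 3"] by (simp add: power_abs power_mult_distrib)
      have "\<bar>s1 t\<bar> * \<bar>s2 t\<bar> \<le> (b1 * norm z) * (b2 * norm z ^ 2)"
        using B1 B2 b by (intro mult_mono) auto
      then have P2: "s1 t * s2 t \<le> b1 * b2 * norm z ^ 3"
        using abs_ge_self[of "s1 t * s2 t"]
        by (simp add: abs_mult power2_eq_square power3_eq_cube mult_ac)
      have P3: "s3 t \<le> b3 * norm z ^ 3" using B3 by simp
      have P: "(s1 t) ^ 3 + 3 * s1 t * s2 t + s3 t \<le> (b1 ^ 3 + 3 * b1 * b2 + b3) * norm z ^ 3"
        using P1 P2 P3 by (simp add: algebra_simps)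
      have \<phi>: "\<phi> t \<le> E" "\<phi> t \<ge> 0"
      proof -
        have "\<phi> t = lyap Rp m (x + t *\<^sub>R z)"
          by (simp add: \<phi>_def lyap_def u_def inner_add_right)
        then show "\<phi> t \<le> E" "\<phi> t \<ge> 0"
          using lyap_box_bound[OF \<delta> m fin inbox] t lyap_pos[of Rp m "x + t *\<^sub>R z"]
          by (auto simp: E_def)
      qed
      have "D 3 t = ((s1 t) ^ 3 + 3 * s1 t * s2 t + s3 t) * \<phi> t" by (simp add: D_def)
      also have "\<dots> \<le> ((b1 ^ 3 + 3 * b1 * b2 + b3) * norm z ^ 3) * \<phi> t"
        using P \<phi> by (intro mult_right_mono) auto
      also have "\<dots> \<le> ((b1 ^ 3 + 3 * b1 * b2 + b3) * norm z ^ 3) * E"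
        using \<phi> b by (intro mult_left_mono) auto
      finally show ?thesis by (simp add: C_def mult_ac)
    qed
    moreover have "0 \<le> C * norm z ^ 3" using \<open>0 \<le> C\<close> by simp
    ultimately have "D 3 t / fact 3 * 1 ^ 3 \<le> C * norm z ^ 3"
      by (simp add: fact_numeral)
    moreover have "(\<Sum>i<3. D i 0 / fact i * 1 ^ i) =
        lyap Rp m x * (1 + lyap_grad Rp m x \<bullet> z + lyap_form Rp m x z z / 2)"
      by (simp add: eval_nat_numeral D_def s10[symmetric] s20[symmetric, unfolded eval_nat_numeral] \<phi>0 algebra_simps)
    ultimately show "lyap Rp m y \<le> lyap Rp m x * (1 + lyap_grad Rp m x \<bullet> (y - x)
        + lyap_form Rp m x (y - x) (y - x) / 2) + C * norm (y - x) ^ 3"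
      using eq \<phi>1 by (simp add: z_def)
  qed
qed

section \<open>Bounds on boxes and the pathwise one-step estimate\<close>

lemma norm_dunkl_drift_box:
  assumes "\<delta> > 0" "x \<in> chamber_box Rp \<delta> r"
  shows "norm (dunkl_drift Rp k x) \<le> (\<Sum>\<alpha>\<in>Rp. \<bar>k \<alpha>\<bar> * norm \<alpha> / \<delta>)"
  unfolding dunkl_drift_def
proof (rule sum_norm_le)
  fix \<alpha> assume "\<alpha> \<in> Rp"
  then have "\<delta> \<le> \<alpha> \<bullet> x" using assms by (auto simp: chamber_box_def)
  then have "\<bar>k \<alpha>\<bar> * norm \<alpha> / (\<alpha> \<bullet> x) \<le> \<bar>k \<alpha>\<bar> * norm \<alpha> / \<delta>"
    using assms by (intro divide_left_mono) auto
  then show "norm ((k \<alpha> / (\<alpha> \<bullet> x)) *\<^sub>R \<alpha>) \<le> \<bar>k \<alpha>\<bar> * norm \<alpha> / \<delta>"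
    using \<open>\<delta> \<le> \<alpha> \<bullet> x\<close> assms by simp
qed

lemma dunkl_drift_lipschitz_box:
  assumes "\<delta> > 0" "x \<in> chamber_box Rp \<delta> r" "y \<in> chamber_box Rp \<delta> r"
  shows "norm (dunkl_drift Rp k x - dunkl_drift Rp k y) \<le>
    (\<Sum>\<alpha>\<in>Rp. \<bar>k \<alpha>\<bar> * (norm \<alpha>)\<^sup>2 / \<delta>\<^sup>2) * norm (x - y)"
  unfolding dunkl_drift_def sum_subtractf[symmetric] sum_distrib_right
proof (rule sum_norm_le)
  fix \<alpha> assume "\<alpha> \<in> Rp"
  then have u: "\<delta> \<le> \<alpha> \<bullet> x" and v: "\<delta> \<le> \<alpha> \<bullet> y" using assms by (auto simp: chamber_box_def)
  have "(k \<alpha> / (\<alpha> \<bullet> x)) *\<^sub>R \<alpha> - (k \<alpha> / (\<alpha> \<bullet> y)) *\<^sub>R \<alpha> =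
      (k \<alpha> * (1 / (\<alpha> \<bullet> x) - 1 / (\<alpha> \<bullet> y))) *\<^sub>R \<alpha>"
    by (simp add: right_diff_distrib scaleR_diff_left)
  then have "norm ((k \<alpha> / (\<alpha> \<bullet> x)) *\<^sub>R \<alpha> - (k \<alpha> / (\<alpha> \<bullet> y)) *\<^sub>R \<alpha>) =
      \<bar>k \<alpha>\<bar> * norm \<alpha> * \<bar>1 / (\<alpha> \<bullet> x) - 1 / (\<alpha> \<bullet> y)\<bar>"
    by (simp only: norm_scaleR abs_mult mult_ac)
  also have "\<bar>1 / (\<alpha> \<bullet> x) - 1 / (\<alpha> \<bullet> y)\<bar> = \<bar>\<alpha> \<bullet> y - \<alpha> \<bullet> x\<bar> / ((\<alpha> \<bullet> x) * (\<alpha> \<bullet> y))"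
    using u v assms(1) by (simp add: diff_frac_eq)
  also have "\<bar>\<alpha> \<bullet> y - \<alpha> \<bullet> x\<bar> = \<bar>\<alpha> \<bullet> (x - y)\<bar>" by (simp add: inner_diff_right)
  also have "\<bar>k \<alpha>\<bar> * norm \<alpha> * (\<bar>\<alpha> \<bullet> (x - y)\<bar> / ((\<alpha> \<bullet> x) * (\<alpha> \<bullet> y))) \<le>
      \<bar>k \<alpha>\<bar> * norm \<alpha> * (norm \<alpha> * norm (x - y) / (\<delta> * \<delta>))"
    using u v assms(1) by (intro mult_left_mono frac_le mult_mono Cauchy_Schwarz_ineq2) auto
  finally show "norm ((k \<alpha> / (\<alpha> \<bullet> x)) *\<^sub>R \<alpha> - (k \<alpha> / (\<alpha> \<bullet> y)) *\<^sub>R \<alpha>) \<le>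
      \<bar>k \<alpha>\<bar> * (norm \<alpha>)\<^sup>2 / \<delta>\<^sup>2 * norm (x - y)"
    by (simp add: power2_eq_square mult_ac)
qed

lemma norm_lyap_grad_box:
  assumes "\<delta> > 0" "m \<ge> 0" "x \<in> chamber_box Rp \<delta> r"
  shows "norm (lyap_grad Rp m x) \<le> (\<Sum>\<alpha>\<in>Rp. (m + m / \<delta>) * norm \<alpha>)"
  unfolding lyap_grad_def
proof (rule sum_norm_le)
  fix \<alpha> assume "\<alpha> \<in> Rp"
  then have "\<delta> \<le> \<alpha> \<bullet> x" using assms by (auto simp: chamber_box_def)
  then have "m / (\<alpha> \<bullet> x) \<le> m / \<delta>" "0 \<le> m / (\<alpha> \<bullet> x)"
    using assms by (auto intro!: divide_left_mono)
  then have "\<bar>m - m / (\<alpha> \<bullet> x)\<bar> \<le> m + m / \<delta>" using assms by linarith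
  then show "norm ((m - m / (\<alpha> \<bullet> x)) *\<^sub>R \<alpha>) \<le> (m + m / \<delta>) * norm \<alpha>"
    by (simp add: mult_right_mono)
qed

lemma lyap_form_box:
  assumes "\<delta> > 0" "m \<ge> 0" "x \<in> chamber_box Rp \<delta> r"
  shows "\<bar>lyap_form Rp m x y z\<bar> \<le>
    ((\<Sum>\<alpha>\<in>Rp. (m + m / \<delta>) * norm \<alpha>)\<^sup>2 + m * (\<Sum>\<alpha>\<in>Rp. (norm \<alpha>)\<^sup>2 / \<delta>\<^sup>2)) * (norm y * norm z)"
proof -
  let ?G = "\<Sum>\<alpha>\<in>Rp. (m + m / \<delta>) * norm \<alpha>"
  have G: "?G \<ge> 0" using assms by (intro sum_nonneg) auto
  have 1: "\<bar>lyap_grad Rp m x \<bullet> y\<bar> \<le> ?G * norm y" for y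
    using Cauchy_Schwarz_ineq2[of "lyap_grad Rp m x" y]
      mult_right_mono[OF norm_lyap_grad_box[OF assms] norm_ge_zero[of y]] by linarith
  have "\<bar>(lyap_grad Rp m x \<bullet> y) * (lyap_grad Rp m x \<bullet> z)\<bar> \<le> (?G * norm y) * (?G * norm z)"
    unfolding abs_mult using G by (intro mult_mono 1) auto
  moreover have "\<bar>\<Sum>\<alpha>\<in>Rp. (\<alpha> \<bullet> y) * (\<alpha> \<bullet> z) / (\<alpha> \<bullet> x)\<^sup>2\<bar> \<le>
      (\<Sum>\<alpha>\<in>Rp. (norm \<alpha>)\<^sup>2 / \<delta>\<^sup>2 * (norm y * norm z))"
  proof (rule order_trans[OF sum_abs sum_mono])
    fix \<alpha> assume "\<alpha> \<in> Rp"
    then have "\<delta> \<le> \<alpha> \<bullet> x" using assms by (auto simp: chamber_box_def)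
    then have "\<bar>\<alpha> \<bullet> y\<bar> * \<bar>\<alpha> \<bullet> z\<bar> / (\<alpha> \<bullet> x)\<^sup>2 \<le> (norm \<alpha> * norm y) * (norm \<alpha> * norm z) / \<delta>\<^sup>2"
      using assms(1) by (intro frac_le mult_mono Cauchy_Schwarz_ineq2 power_mono) auto
    then show "\<bar>(\<alpha> \<bullet> y) * (\<alpha> \<bullet> z) / (\<alpha> \<bullet> x)\<^sup>2\<bar> \<le> (norm \<alpha>)\<^sup>2 / \<delta>\<^sup>2 * (norm y * norm z)"
      by (simp add: abs_mult power2_eq_square mult_ac)
  qed
  then have "\<bar>m * (\<Sum>\<alpha>\<in>Rp. (\<alpha> \<bullet> y) * (\<alpha> \<bullet> z) / (\<alpha> \<bullet> x)\<^sup>2)\<bar> \<le>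
      m * ((\<Sum>\<alpha>\<in>Rp. (norm \<alpha>)\<^sup>2 / \<delta>\<^sup>2) * (norm y * norm z))"
    unfolding abs_mult sum_distrib_right using assms(2) by (simp add: mult_left_mono)
  ultimately show ?thesis
    unfolding lyap_form_def by (simp add: power2_eq_square algebra_simps)
qed

text \<open>An estimate for single paths, with one constant for all starting times, step sizes and
  paths in the box. The additional drift \<open>u\<close> enters only through its bound. All
  contributions of the drift integral beyond the linear one go into the error.\<close>

lemma lyap_step:
  fixes Rp :: "(real ^ 'd) set"
  assumes \<delta>: "\<delta> > 0" and m: "m \<ge> 0" and fin: "finite Rp" and \<beta>: "\<beta> \<ge> 0" and T: "T \<ge> 0"
  shows "\<exists>C\<ge>0. \<forall>s h X B u. 0 \<le> h \<longrightarrow> h \<le> T \<longrightarrow> continuous_on {s..s+h} X \<longrightarrow>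
    continuous_on {s..s+h} B \<longrightarrow> continuous_on {s..s+h} u \<longrightarrow>
    (\<forall>r\<in>{s..s+h}. X r \<in> chamber_box Rp \<delta> c \<and> norm (u r) \<le> \<beta> \<and>
      X r = X s + (B r - B s) + integral {s..r} (\<lambda>r. dunkl_drift Rp k (X r) + u r)) \<longrightarrow>
    lyap Rp m (X (s + h)) \<le> lyap_bound Rp k m \<beta> h (X s) (B (s + h) - B s) + C * incr_error B s h"
proof -
  define F where "F = (\<Sum>\<alpha>\<in>Rp. \<bar>k \<alpha>\<bar> * norm \<alpha> / \<delta>)"
  define L where "L = (\<Sum>\<alpha>\<in>Rp. \<bar>k \<alpha>\<bar> * (norm \<alpha>)\<^sup>2 / \<delta>\<^sup>2)"
  define G where "G = (\<Sum>\<alpha>\<in>Rp. (m + m / \<delta>) * norm \<alpha>)"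
  define A where "A = G\<^sup>2 + m * (\<Sum>\<alpha>\<in>Rp. (norm \<alpha>)\<^sup>2 / \<delta>\<^sup>2)"
  define E where "E = exp (real (card Rp) * (m * c - m * ln \<delta>))"
  define N where "N = F + \<beta>"
  obtain C3 where C3: "C3 \<ge> 0" and taylor: "\<And>x y. x \<in> chamber_box Rp \<delta> c \<Longrightarrow> y \<in> chamber_box Rp \<delta> c \<Longrightarrow>
    lyap Rp m y \<le> lyap Rp m x * (1 + lyap_grad Rp m x \<bullet> (y - x) + lyap_form Rp m x (y - x) (y - x) / 2)
      + C3 * norm (y - x) ^ 3"
    using lyap_taylor[OF \<delta> m fin, of c] by blast
  have nn: "F \<ge> 0" "L \<ge> 0" "G \<ge> 0" "A \<ge> 0" "E \<ge> 0" "N \<ge> 0"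
    using \<delta> m \<beta> by (auto simp: F_def L_def G_def A_def E_def N_def intro!: sum_nonneg add_nonneg_nonneg mult_nonneg_nonneg)
  \<comment> \<open>The summands match the pieces below: variation of the drift
    (\<open>G * L * N\<close>, \<open>G * L\<close>), mixed and quadratic terms of the form
    (\<open>A * N\<close>, \<open>A * N\<^sup>2\<close>), and the cubic remainder.\<close>
  define C where "C = E * (G * L * N + G * L + A * N + A * N\<^sup>2) + 4 * C3 + 4 * C3 * N ^ 3 * T"
  show ?thesis
  proof (intro exI[of _ C] conjI allI impI)
    show "C \<ge> 0" using nn C3 T by (simp add: C_def)
    fix s h and X B u :: "real \<Rightarrow> real ^ 'd"
    assume h: "0 \<le> h" "h \<le> T" and X: "continuous_on {s..s+h} X" and B: "continuous_on {s..s+h} B"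
      and u: "continuous_on {s..s+h} u"
      and H: "\<forall>r\<in>{s..s+h}. X r \<in> chamber_box Rp \<delta> c \<and> norm (u r) \<le> \<beta> \<and>
      X r = X s + (B r - B s) + integral {s..r} (\<lambda>r. dunkl_drift Rp k (X r) + u r)"
    let ?f = "dunkl_drift Rp k"
    define x where "x = X s"
    define w where "w = B (s + h) - B s"
    define v where "v r = ?f (X r) + u r" for r
    define D where "D = integral {s..s+h} v"
    define I where "I = integral {s..s+h} (\<lambda>r. norm (B r - B s))"
    define g where "g = lyap_grad Rp m x"
    have box: "X r \<in> chamber_box Rp \<delta> c" and ub: "norm (u r) \<le> \<beta>"
      and Xr: "X r = X s + (B r - B s) + integral {s..r} v" if "r \<in> {s..s+h}" for r
      using H that unfolding v_def[abs_def] by blast+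
    have xbox: "x \<in> chamber_box Rp \<delta> c" using box h by (simp add: x_def)
    have nz: "\<alpha> \<bullet> X r \<noteq> 0" if "r \<in> {s..s+h}" "\<alpha> \<in> Rp" for \<alpha> r
      using box[OF that(1)] that(2) \<delta> by (force simp: chamber_box_def)
    have fc: "continuous_on {s..s+h} (\<lambda>r. ?f (X r))"
      unfolding dunkl_drift_def using nz by (intro continuous_intros X) auto
    have vc: "continuous_on {s..s+h} v"
      unfolding v_def using fc u by (intro continuous_intros)
    have vN: "norm (v r) \<le> N" if "r \<in> {s..s+h}" for r
      unfolding v_def N_def F_def
      by (intro norm_triangle_mono norm_dunkl_drift_box[OF \<delta> box[OF that]] ub[OF that])
    have int: "norm (integral {s..r} v) \<le> N * (r - s)" if "r \<in> {s..s+h}" for r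
      using that nn by (intro integral_bound continuous_on_subset[OF vc] vN) auto
    have DN: "norm D \<le> N * h" using int[of "s + h"] h by (simp add: D_def)
    have XX: "norm (X r - x) \<le> norm (B r - B s) + N * h" if r: "r \<in> {s..s+h}" for r
    proof -
      have "X r - x = (B r - B s) + integral {s..r} v" using Xr[OF r] by (simp add: x_def)
      then have "norm (X r - x) \<le> norm (B r - B s) + norm (integral {s..r} v)"
        by (simp add: norm_triangle_ineq)
      also have "norm (integral {s..r} v) \<le> N * h"
        using int[OF r] mult_left_mono[of "r - s" h N] r nn by auto
      finally show ?thesis by simp
    qed
    have gG: "norm g \<le> G" unfolding g_def G_def by (rule norm_lyap_grad_box[OF \<delta> m xbox])
    have vI: "v integrable_on {s..s+h}" using vc by (rule integrable_continuous_real)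
    have "g \<bullet> D = integral {s..s+h} (\<lambda>r. g \<bullet> v r)"
      using integral_linear[OF vI bounded_linear_inner_right[of g]] by (simp add: D_def o_def)
    \<comment> \<open>Freezing the drift at the start of the step costs
      \<open>L * norm (X r - x)\<close>, and the path moves by at most
      \<open>norm (B r - B s) + N * h\<close>. This is the origin of the time integral in
      \<open>incr_error\<close>.\<close>
    also have "\<dots> \<le> integral {s..s+h} (\<lambda>r. (g \<bullet> ?f x + \<beta> * norm g + G * L * N * h)
        + G * L * norm (B r - B s))"
    proof (rule integral_le)
      show "(\<lambda>r. g \<bullet> v r) integrable_on {s..s+h}"
        by (intro integrable_continuous_real continuous_intros vc)
      show "(\<lambda>r. (g \<bullet> ?f x + \<beta> * norm g + G * L * N * h) + G * L * norm (B r - B s)) integrable_on {s..s+h}"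
        by (intro integrable_continuous_real continuous_intros B)
      fix r assume r: "r \<in> {s..s+h}"
      have "g \<bullet> (?f (X r) - ?f x) \<le> norm g * (L * norm (X r - x))"
        unfolding L_def
        by (rule order_trans[OF norm_cauchy_schwarz])
           (intro mult_left_mono dunkl_drift_lipschitz_box[OF \<delta> box[OF r] xbox] norm_ge_zero)
      also have "\<dots> \<le> G * (L * (norm (B r - B s) + N * h))"
        using gG XX[OF r] nn h by (intro mult_mono) auto
      finally have 1: "g \<bullet> ?f (X r) \<le> g \<bullet> ?f x + G * (L * (norm (B r - B s) + N * h))"
        by (simp add: inner_diff_right)
      have "g \<bullet> u r \<le> norm g * \<beta>"
        by (rule order_trans[OF norm_cauchy_schwarz]) (intro mult_left_mono ub[OF r] norm_ge_zero)
      then show "g \<bullet> v r \<le> (g \<bullet> ?f x + \<beta> * norm g + G * L * N * h) + G * L * norm (B r - B s)"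
        using 1 by (simp add: v_def inner_add_right algebra_simps)
    qed
    also have "\<dots> = h * (g \<bullet> ?f x + \<beta> * norm g + G * L * N * h) + G * L * I"
    proof -
      have "(\<lambda>r. G * L * norm (B r - B s)) integrable_on {s..s+h}"
        by (intro integrable_continuous_real continuous_intros B)
      then show ?thesis using h
        by (subst Henstock_Kurzweil_Integration.integral_add) (auto simp: I_def)
    qed
    finally have gD: "g \<bullet> D \<le> h * (g \<bullet> ?f x + \<beta> * norm g) + (G * L * N * h\<^sup>2 + G * L * I)"
      by (simp add: algebra_simps power2_eq_square)
    have y: "X (s + h) - x = w + D"
      using Xr[of "s + h"] h by (simp add: x_def w_def D_def)
    have Ab: "\<bar>lyap_form Rp m x p q\<bar> \<le> A * (norm p * norm q)" for p q
      unfolding A_def G_def by (rule lyap_form_box[OF \<delta> m xbox])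
    have "\<bar>lyap_form Rp m x w D\<bar> \<le> A * (norm w * (N * h))"
      using DN nn by (intro order_trans[OF Ab] mult_left_mono) auto
    moreover have "\<bar>lyap_form Rp m x D D\<bar> \<le> A * ((N * h) * (N * h))"
      using DN nn h by (intro order_trans[OF Ab] mult_left_mono mult_mono) auto
    moreover have "(p + 2 * q + r) / 2 \<le> p / 2 + (q' + r')" if "\<bar>q\<bar> \<le> q'" "\<bar>r\<bar> \<le> r'" for p q r q' r' :: real
      using that by (simp add: abs_le_iff field_simps)
    ultimately have form: "lyap_form Rp m x (w + D) (w + D) / 2 \<le> lyap_form Rp m x w w / 2
        + (A * (norm w * (N * h)) + A * ((N * h) * (N * h)))"
      unfolding lyap_form_add by blast
    have V: "0 \<le> lyap Rp m x" "lyap Rp m x \<le> E"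
      using lyap_pos[of Rp m x] lyap_box_bound[OF \<delta> m fin xbox] by (auto simp: E_def)
    have I: "0 \<le> I" unfolding I_def
      by (intro integral_nonneg integrable_continuous_real continuous_intros B) auto
    define e where "e = G * L * N * h\<^sup>2 + G * L * I + A * (norm w * (N * h)) + A * ((N * h) * (N * h))"
    have e: "e \<ge> 0" using nn h I by (simp add: e_def)
    \<comment> \<open>Convexity of the cube gives the factor 4, and \<open>h \<le> T\<close> absorbs
      one of the three powers of \<open>h\<close>.\<close>
    have cube: "norm (w + D) ^ 3 \<le> 4 * norm w ^ 3 + 4 * N ^ 3 * T * h\<^sup>2"
    proof -
      have "norm (w + D) \<le> norm w + N * h" using DN norm_triangle_ineq[of w D] by simp
      then have "norm (w + D) ^ 3 \<le> (norm w + N * h) ^ 3" by (intro power_mono) auto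
      also have "\<dots> \<le> 4 * (norm w ^ 3 + (N * h) ^ 3)"
      proof -
        have "4 * (a ^ 3 + b ^ 3) - (a + b) ^ 3 = 3 * (a + b) * (a - b)\<^sup>2" for a b :: real
          by (simp add: power2_eq_square power3_eq_cube algebra_simps)
        moreover have "0 \<le> 3 * (norm w + N * h) * (norm w - N * h)\<^sup>2" using nn h by simp
        ultimately show ?thesis by (metis diff_ge_0_iff_ge)
      qed
      also have "(N * h) ^ 3 = N ^ 3 * (h * h\<^sup>2)"
        by (simp add: power2_eq_square power3_eq_cube)
      also have "N ^ 3 * (h * h\<^sup>2) \<le> N ^ 3 * (T * h\<^sup>2)"
        using nn h by (intro mult_left_mono mult_right_mono) auto
      finally show ?thesis by (simp add: algebra_simps)
    qed
    have inner: "1 + g \<bullet> (w + D) + lyap_form Rp m x (w + D) (w + D) / 2 \<le>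
        (1 + g \<bullet> w + lyap_form Rp m x w w / 2 + h * (g \<bullet> ?f x + \<beta> * norm g)) + e"
      unfolding e_def inner_add_right using gD form by linarith
    have "lyap Rp m (X (s + h)) \<le> lyap Rp m x * (1 + g \<bullet> (w + D) + lyap_form Rp m x (w + D) (w + D) / 2)
        + C3 * norm (w + D) ^ 3"
      using taylor[OF xbox box[of "s + h"]] h unfolding y g_def by simp
    also have "\<dots> \<le> lyap Rp m x * ((1 + g \<bullet> w + lyap_form Rp m x w w / 2
        + h * (g \<bullet> ?f x + \<beta> * norm g)) + e) + C3 * (4 * norm w ^ 3 + 4 * N ^ 3 * T * h\<^sup>2)"
      by (rule add_mono[OF mult_left_mono[OF inner V(1)] mult_left_mono[OF cube C3]])
    also have "\<dots> \<le> lyap Rp m x * (1 + g \<bullet> w + lyap_form Rp m x w w / 2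
        + h * (g \<bullet> ?f x + \<beta> * norm g)) + (E * e + C3 * (4 * norm w ^ 3 + 4 * N ^ 3 * T * h\<^sup>2))"
      using mult_right_mono[OF V(2) e] by (simp add: distrib_left)
    also have "E * e + C3 * (4 * norm w ^ 3 + 4 * N ^ 3 * T * h\<^sup>2) \<le>
        C * (h * norm w + h\<^sup>2 + norm w ^ 3 + I)"
    proof -
      define p1 p2 p3 where "p1 = h * norm w" and "p2 = h\<^sup>2" and "p3 = norm w ^ 3"
      have p: "p1 \<ge> 0" "p2 \<ge> 0" "p3 \<ge> 0" using h by (auto simp: p1_def p2_def p3_def)
      define c1 c2 c3 c4 c5 c6 where "c1 = E * (G * L * N)" and "c2 = E * (G * L)" and "c3 = E * (A * N)"
        and "c4 = E * (A * N\<^sup>2)" and "c5 = 4 * C3" and "c6 = 4 * C3 * N ^ 3 * T"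
      have c: "c1 \<ge> 0" "c2 \<ge> 0" "c3 \<ge> 0" "c4 \<ge> 0" "c5 \<ge> 0" "c6 \<ge> 0"
        using nn C3 T by (auto simp: c1_def c2_def c3_def c4_def c5_def c6_def)
      have Ceq: "C = c1 + c2 + c3 + c4 + c5 + c6"
        by (simp add: C_def c1_def c2_def c3_def c4_def c5_def c6_def algebra_simps)
      have "E * e + C3 * (4 * norm w ^ 3 + 4 * N ^ 3 * T * h\<^sup>2) =
          c1 * p2 + c2 * I + c3 * p1 + c4 * p2 + c5 * p3 + c6 * p2"
        unfolding e_def c1_def c2_def c3_def c4_def c5_def c6_def p1_def p2_def p3_def
        by (simp add: algebra_simps power2_eq_square)
      also have "\<dots> \<le> C * p2 + C * I + C * p1 + C * p3"
      proof -
        have "(c1 + c4 + c6) * p2 \<le> C * p2" "c2 * I \<le> C * I" "c3 * p1 \<le> C * p1" "c5 * p3 \<le> C * p3"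
          using c p I by (auto simp: Ceq intro!: mult_right_mono)
        then show ?thesis by (simp add: algebra_simps)
      qed
      finally show ?thesis by (simp add: p1_def p2_def p3_def algebra_simps)
    qed
    finally show "lyap Rp m (X (s + h)) \<le>
        lyap_bound Rp k m \<beta> h (X s) (B (s + h) - B s) + C * incr_error B s h"
      by (simp add: lyap_bound_def incr_error_def x_def g_def w_def I_def)
  qed
qed

section \<open>Inverse moments of the radial Dunkl process\<close>

text \<open>Estimates are first proved for the nonnegative integral, where integrability is no
  issue; this brings them back to expectations.\<close>

lemma integral_le_of_nn_integral_le:
  fixes f :: "'a \<Rightarrow> real"
  assumes "f \<in> borel_measurable M" "\<And>x. x \<in> space M \<Longrightarrow> 0 \<le> f x" "(\<integral>\<^sup>+x. f x \<partial>M) \<le> ennreal c" "0 \<le> c"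
  shows "integrable M f" "(\<integral>x. f x \<partial>M) \<le> c"
proof -
  show i: "integrable M f"
    using assms by (intro integrableI_nonneg) (auto intro: le_less_trans)
  have "ennreal (\<integral>x. f x \<partial>M) = (\<integral>\<^sup>+x. f x \<partial>M)"
    using assms i by (intro nn_integral_eq_integral[symmetric]) auto
  then show "(\<integral>x. f x \<partial>M) \<le> c" using assms by (metis ennreal_le_iff)
qed

text \<open>A discrete Gronwall inequality in which the increments of the decreasing sequence
  \<open>P\<close> telescope, so that their factor \<open>e\<close> is paid once and not
  \<open>n\<close> times.\<close>

lemma real_sequence_growth:
  fixes a P :: "nat \<Rightarrow> real"
  assumes "c \<ge> 0" "d \<ge> 0" "e \<ge> 0" "\<And>l. l < n \<Longrightarrow> P (Suc l) \<le> P l"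
    and step: "\<And>l. l < n \<Longrightarrow> a (Suc l) \<le> (1 + c) * a l + d + e * (P l - P (Suc l))"
  shows "a n \<le> (1 + c) ^ n * (a 0 + real n * d + e * (P 0 - P n))"
  using assms(4,5)
proof (induction n)
  case 0
  then show ?case by simp
next
  case (Suc n)
  have c1: "1 \<le> (1 + c) ^ Suc n" using assms(1) by (intro one_le_power) auto
  have "0 \<le> d + e * (P n - P (Suc n))" using assms(2,3) Suc.prems(1)[of n] by simp
  then have 1: "d + e * (P n - P (Suc n)) \<le> (1 + c) ^ Suc n * (d + e * (P n - P (Suc n)))"
    using mult_right_mono[OF c1] by fastforce
  have "a (Suc n) \<le> (1 + c) * a n + (d + e * (P n - P (Suc n)))" using Suc.prems(2)[of n] by simp
  also have "\<dots> \<le> (1 + c) * ((1 + c) ^ n * (a 0 + real n * d + e * (P 0 - P n)))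
      + (1 + c) ^ Suc n * (d + e * (P n - P (Suc n)))"
    using Suc assms(1) 1 by (intro add_mono mult_left_mono) auto
  also have "\<dots> = (1 + c) ^ Suc n * (a 0 + real (Suc n) * d + e * (P 0 - P (Suc n)))"
    by (simp add: algebra_simps)
  finally show ?case .
qed

text \<open>The increment is split at \<open>b r (\<gamma> s)\<close>: the Lipschitz condition
  controls the change in space, the Hoelder condition the change in time.\<close>

lemma continuous_on_drift_path:
  fixes b :: "real \<Rightarrow> real ^ 'd \<Rightarrow> real ^ 'd"
  assumes \<gamma>: "continuous_on {0..T} \<gamma>"
    and lip: "\<And>t x y. t \<in> {0..T} \<Longrightarrow> norm (b t x - b t y) \<le> Lb * norm (x - y)"
    and hoelder: "\<And>t s x. t \<in> {0..T} \<Longrightarrow> s \<in> {0..T} \<Longrightarrow> norm (b t x - b s x) \<le> Hb * sqrt \<bar>t - s\<bar>"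
  shows "continuous_on {0..T} (\<lambda>r. b r (\<gamma> r))"
  unfolding continuous_on_def
proof
  fix s assume s: "s \<in> {0..T}"
  have X: "(\<gamma> \<longlongrightarrow> \<gamma> s) (at s within {0..T})"
    using \<gamma> s by (auto simp: continuous_on_def)
  have "((\<lambda>r. Lb * norm (\<gamma> r - \<gamma> s) + Hb * sqrt \<bar>r - s\<bar>) \<longlongrightarrow>
      Lb * norm (\<gamma> s - \<gamma> s) + Hb * sqrt \<bar>s - s\<bar>) (at s within {0..T})"
    by (intro tendsto_intros X)
  then have lim: "((\<lambda>r. Lb * norm (\<gamma> r - \<gamma> s) + Hb * sqrt \<bar>r - s\<bar>) \<longlongrightarrow> 0) (at s within {0..T})"
    by simp
  have "((\<lambda>r. b r (\<gamma> r) - b s (\<gamma> s)) \<longlongrightarrow> 0) (at s within {0..T})"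
  proof (rule Lim_null_comparison[OF _ lim])
    have "norm (b r (\<gamma> r) - b s (\<gamma> s)) \<le> Lb * norm (\<gamma> r - \<gamma> s) + Hb * sqrt \<bar>r - s\<bar>"
      if r: "r \<in> {0..T}" for r
    proof -
      have "b r (\<gamma> r) - b s (\<gamma> s) = (b r (\<gamma> r) - b r (\<gamma> s)) + (b r (\<gamma> s) - b s (\<gamma> s))"
        by simp
      then show ?thesis
        using norm_triangle_mono[OF lip[OF r] hoelder[OF r s]] by metis
    qed
    then show "\<forall>\<^sub>F r in at s within {0..T}. norm (b r (\<gamma> r) - b s (\<gamma> s)) \<le>
        Lb * norm (\<gamma> r - \<gamma> s) + Hb * sqrt \<bar>r - s\<bar>"
      by (auto simp: eventually_at_filter)
  qed
  then show "((\<lambda>r. b r (\<gamma> r)) \<longlongrightarrow> b s (\<gamma> s)) (at s within {0..T})"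
    by (simp add: LIM_zero_iff)
qed

text \<open>Path properties are assumed at every point of the space, and the equation between
  arbitrary times \<open>s \<le> t\<close>; a modification on a null set will provide an instance.
  \<open>\<kappa>\<close> is a lower bound of \<open>k\<close>, and \<open>\<beta>\<close>,
  \<open>Lb\<close>, \<open>Hb\<close> quantify the regularity of \<open>b\<close>.\<close>

locale dunkl_sde = prob_space M
  for M :: "'w measure" +
  fixes F :: "real \<Rightarrow> 'w measure" and T :: real
    and B X :: "real \<Rightarrow> 'w \<Rightarrow> real ^ 'd"
    and R Rp :: "(real ^ 'd) set" and k :: "real ^ 'd \<Rightarrow> real"
    and b :: "real \<Rightarrow> real ^ 'd \<Rightarrow> real ^ 'd" and x0 :: "real ^ 'd"
    and \<beta> Lb Hb \<kappa> :: real
  assumes T: "T > 0"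
    and subalg: "t \<in> {0..T} \<Longrightarrow> subalgebra M (F t)"
    and filt: "0 \<le> s \<Longrightarrow> s \<le> t \<Longrightarrow> t \<le> T \<Longrightarrow> sets (F s) \<subseteq> sets (F t)"
    and X_adapted: "t \<in> {0..T} \<Longrightarrow> X t \<in> borel_measurable (F t)"
    and B_indep: "0 \<le> s \<Longrightarrow> s < t \<Longrightarrow> t \<le> T \<Longrightarrow>
      indep_set (sets (F s)) {(\<lambda>\<omega>. B t \<omega> - B s \<omega>) -` A \<inter> space M | A. A \<in> sets borel}"
    and B_gauss: "0 \<le> s \<Longrightarrow> s < t \<Longrightarrow> t \<le> T \<Longrightarrow> gauss_vec (sqrt (t - s)) (\<lambda>\<omega>. B t \<omega> - B s \<omega>)"
    and X_cont: "\<omega> \<in> space M \<Longrightarrow> continuous_on {0..T} (\<lambda>t. X t \<omega>)"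
    and B_cont: "\<omega> \<in> space M \<Longrightarrow> continuous_on {0..T} (\<lambda>t. B t \<omega>)"
    and X_chamber: "t \<in> {0..T} \<Longrightarrow> \<omega> \<in> space M \<Longrightarrow> X t \<omega> \<in> weyl_chamber Rp"
    and X_init: "\<omega> \<in> space M \<Longrightarrow> X 0 \<omega> = x0"
    and X_eq: "0 \<le> s \<Longrightarrow> s \<le> t \<Longrightarrow> t \<le> T \<Longrightarrow> \<omega> \<in> space M \<Longrightarrow> X t \<omega> = X s \<omega> + (B t \<omega> - B s \<omega>)
      + integral {s..t} (\<lambda>r. dunkl_drift Rp k (X r \<omega>) + b r (X r \<omega>))"
    and root_sys: "root_system R" and pos_sys: "positive_root_system R Rp"
    and mult: "multiplicity_function R k"
    and \<kappa>: "\<alpha> \<in> Rp \<Longrightarrow> \<kappa> \<le> k \<alpha>" and \<kappa>_pos: "\<kappa> > 0"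
    and b_bound: "t \<in> {0..T} \<Longrightarrow> norm (b t x) \<le> \<beta>"
    and b_lip: "t \<in> {0..T} \<Longrightarrow> norm (b t x - b t y) \<le> Lb * norm (x - y)"
    and Lb_nonneg: "0 \<le> Lb" and Hb_nonneg: "0 \<le> Hb"
    and b_hoelder: "t \<in> {0..T} \<Longrightarrow> s \<in> {0..T} \<Longrightarrow> norm (b t x - b s x) \<le> Hb * sqrt \<bar>t - s\<bar>"
begin

lemma fin_Rp: "finite Rp"
  by (rule root_finite(2)[OF root_sys pos_sys])

lemma \<beta>_nonneg: "\<beta> \<ge> 0"
  using order_trans[OF norm_ge_zero b_bound[of 0]] T by simp

lemma X_pos: "t \<in> {0..T} \<Longrightarrow> \<omega> \<in> space M \<Longrightarrow> \<alpha> \<in> Rp \<Longrightarrow> \<alpha> \<bullet> X t \<omega> > 0"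
  using X_chamber by (auto simp: weyl_chamber_def)

lemma space_F: "t \<in> {0..T} \<Longrightarrow> space (F t) = space M"
  using subalg by (auto simp: subalgebra_def)

lemma measurable_F_mono:
  assumes "0 \<le> s" "s \<le> t" "t \<le> T" "f \<in> measurable (F s) N"
  shows "f \<in> measurable (F t) N"
  using assms filt[OF assms(1-3)] space_F[of s] space_F[of t]
  by (auto simp: measurable_def)

lemma X_measurable: "t \<in> {0..T} \<Longrightarrow> X t \<in> borel_measurable M"
  using measurable_from_subalg[OF subalg X_adapted] by blast

lemma b_path_continuous:
  "\<omega> \<in> space M \<Longrightarrow> continuous_on {0..T} (\<lambda>r. b r (X r \<omega>))"
  by (rule continuous_on_drift_path[OF X_cont b_lip b_hoelder])

lemma drift_path_continuous:
  assumes "\<omega> \<in> space M"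
  shows "continuous_on {0..T} (\<lambda>r. dunkl_drift Rp k (X r \<omega>))"
  unfolding dunkl_drift_def
  using X_pos[OF _ assms] by (intro continuous_intros X_cont assms) force

text \<open>This family of events, decreasing in \<open>t\<close>, takes the place of the exit time
  from the box.\<close>

definition stay :: "real \<Rightarrow> real \<Rightarrow> real \<Rightarrow> 'w set" where
  "stay \<delta> c t = {\<omega>\<in>space M. \<forall>s\<in>{0..t}. X s \<omega> \<in> chamber_box Rp \<delta> c}"

lemma closed_chamber_box: "closed (chamber_box Rp \<delta> c)"
proof -
  have "chamber_box Rp \<delta> c = (\<Inter>\<alpha>\<in>Rp. {x. \<delta> \<le> \<alpha> \<bullet> x} \<inter> {x. \<alpha> \<bullet> x \<le> c})"
    by (auto simp: chamber_box_def)
  also have "closed \<dots>"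
    by (intro closed_INT ballI closed_Int closed_Collect_le continuous_intros)
  finally show ?thesis .
qed

text \<open>Paths are continuous and the box is closed, so only the countably many times
  \<open>q * t\<close> with rational \<open>q\<close> between 0 and 1 have to be tested, and none of
  them exceeds \<open>t\<close>.\<close>

lemma stay_sets:
  assumes t: "t \<in> {0..T}"
  shows "stay \<delta> c t \<in> sets (F t)"
proof -
  let ?K = "chamber_box Rp \<delta> c"
  let ?Q = "{0<..<1} \<inter> \<rat> :: real set"
  have cl: "closure ?Q = {0..1}"
    by (subst closure_open_Int_superset) (auto simp: Rats_closure_real)
  have qt: "0 \<le> q * t" "q * t \<le> t" if "q \<in> {0..1}" for q
    using that t by (auto intro: mult_left_le_one_le)
  have "stay \<delta> c t = {\<omega>\<in>space M. \<forall>q\<in>?Q. X (q * t) \<omega> \<in> ?K}"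
  proof (intro equalityI subsetI)
    fix \<omega> assume "\<omega> \<in> stay \<delta> c t"
    then show "\<omega> \<in> {\<omega>\<in>space M. \<forall>q\<in>?Q. X (q * t) \<omega> \<in> ?K}"
      using qt by (auto simp: stay_def)
  next
    fix \<omega> assume "\<omega> \<in> {\<omega>\<in>space M. \<forall>q\<in>?Q. X (q * t) \<omega> \<in> ?K}"
    then have \<omega>: "\<omega> \<in> space M" and K: "(\<lambda>q. X (q * t) \<omega>) ` ?Q \<subseteq> ?K" by blast+
    have "q * t \<in> {0..T}" if "q \<in> {0..1}" for q using qt[OF that] t by auto
    then have "continuous_on {0..1} (\<lambda>q. X (q * t) \<omega>)"
      by (intro continuous_on_compose2[OF X_cont[OF \<omega>]] continuous_intros) blast
    then have in_K: "(\<lambda>q. X (q * t) \<omega>) ` {0..1} \<subseteq> ?K"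
      using image_closure_subset[OF _ closed_chamber_box K] unfolding cl by blast
    have "X s \<omega> \<in> ?K" if s: "s \<in> {0..t}" for s
    proof -
      \<comment> \<open>For \<open>t = 0\<close> this rests on \<open>0 / 0 = 0\<close>.\<close>
      have "s = s / t * t" "s / t \<in> {0..1}" using s by (auto simp: divide_le_eq_1)
      then show ?thesis using in_K by (metis image_subset_iff)
    qed
    then show "\<omega> \<in> stay \<delta> c t" using \<omega> by (simp add: stay_def)
  qed
  also have "\<dots> = space (F t) \<inter> (\<Inter>q\<in>?Q. X (q * t) -` ?K \<inter> space (F t))"
    using space_F[OF t] by auto
  also have "\<dots> \<in> sets (F t)"
  proof -
    have m: "X (q * t) -` ?K \<inter> space (F t) \<in> sets (F t)" if "q \<in> {0..1}" for q
    proof (rule measurable_sets)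
      show "X (q * t) \<in> borel_measurable (F t)"
        using qt[OF that] t by (intro measurable_F_mono[OF _ _ _ X_adapted]) auto
    qed (simp add: closed_chamber_box)
    have "(\<Inter>q\<in>?Q. X (q * t) -` ?K \<inter> space (F t)) \<in> sets (F t)"
    proof (rule sets.countable_INT')
      show "countable ?Q" by (simp add: countable_rat)
      have "(1 / 2 :: real) \<in> ?Q" by simp
      then show "?Q \<noteq> {}" by blast
    qed (use m in auto)
    then show ?thesis by simp
  qed
  finally show ?thesis .
qed

lemma stay_mono: "s \<le> t \<Longrightarrow> stay \<delta> c t \<subseteq> stay \<delta> c s"
  by (auto simp: stay_def)

lemma stay_sets_M: "t \<in> {0..T} \<Longrightarrow> stay \<delta> c t \<in> sets M"
  using stay_sets[of t \<delta> c] subalg[of t] unfolding subalgebra_def by blast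

end

section \<open>The one-step estimate in expectation\<close>

text \<open>This separates coefficients depending on \<open>x\<close> alone from products of two
  components of the increment, so that independence can be used term by term.\<close>

lemma lyap_form_components:
  fixes w :: "real ^ 'd"
  shows "lyap_form Rp m x w w =
    (\<Sum>i\<in>UNIV. \<Sum>j\<in>UNIV. lyap_form Rp m x (axis i 1) (axis j 1) * (w $ i * w $ j))"
proof -
  have sq: "(v \<bullet> w) * (v \<bullet> w) = (\<Sum>i\<in>UNIV. \<Sum>j\<in>UNIV. (v $ i * v $ j) * (w $ i * w $ j))"
    for v :: "real ^ 'd"
    unfolding inner_vec_def sum_product by (intro sum.cong) auto
  have "(\<Sum>\<alpha>\<in>Rp. (\<alpha> \<bullet> w) * (\<alpha> \<bullet> w) / (\<alpha> \<bullet> x)\<^sup>2) =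
      (\<Sum>\<alpha>\<in>Rp. \<Sum>i\<in>UNIV. \<Sum>j\<in>UNIV. \<alpha> $ i * \<alpha> $ j / (\<alpha> \<bullet> x)\<^sup>2 * (w $ i * w $ j))"
    unfolding sq sum_divide_distrib by (intro sum.cong) auto
  also have "\<dots> = (\<Sum>i\<in>UNIV. \<Sum>j\<in>UNIV. \<Sum>\<alpha>\<in>Rp. \<alpha> $ i * \<alpha> $ j / (\<alpha> \<bullet> x)\<^sup>2 * (w $ i * w $ j))"
    by (subst sum.swap, intro sum.cong refl, rule sum.swap)
  finally show ?thesis
    unfolding lyap_form_def sq[of "lyap_grad Rp m x"]
    by (simp add: inner_axis sum.distrib[symmetric] sum_distrib_left sum_distrib_right algebra_simps)
qed

text \<open>The trace is what remains of the form after averaging over a Gaussian increment; half of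
  it is the second-order part of \<open>lyap_gen\<close>.\<close>

lemma lyap_form_trace:
  fixes x :: "real ^ 'd"
  shows "(\<Sum>i\<in>UNIV. lyap_form Rp m x (axis i 1) (axis i 1)) =
    (norm (lyap_grad Rp m x))\<^sup>2 + m * (\<Sum>\<alpha>\<in>Rp. (norm \<alpha>)\<^sup>2 / (\<alpha> \<bullet> x)\<^sup>2)"
proof -
  have sq: "(norm v)\<^sup>2 = (\<Sum>i\<in>UNIV. v $ i * v $ i)" for v :: "real ^ 'd"
    unfolding power2_norm_eq_inner inner_vec_def by simp
  have "(\<Sum>\<alpha>\<in>Rp. (norm \<alpha>)\<^sup>2 / (\<alpha> \<bullet> x)\<^sup>2) = (\<Sum>i\<in>UNIV. \<Sum>\<alpha>\<in>Rp. \<alpha> $ i * \<alpha> $ i / (\<alpha> \<bullet> x)\<^sup>2)"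
    unfolding sq sum_divide_distrib by (rule sum.swap)
  then show ?thesis
    unfolding lyap_form_def sq[of "lyap_grad Rp m x"]
    by (simp add: inner_axis sum.distrib sum_distrib_left)
qed

lemma lyap_measurable [measurable]:
  "lyap Rp m \<in> borel_measurable borel"
  "lyap_grad Rp m \<in> borel_measurable borel"
  "dunkl_drift Rp k \<in> borel_measurable borel"
  "(\<lambda>x. lyap_form Rp m x y z) \<in> borel_measurable borel"
  unfolding lyap_def[abs_def] lyap_grad_def[abs_def] dunkl_drift_def[abs_def] lyap_form_def[abs_def]
  by measurable

context dunkl_sde
begin

lemma B_increment_measurable:
  assumes "0 \<le> s" "s \<le> t" "t \<le> T"
  shows "(\<lambda>\<omega>. B t \<omega> - B s \<omega>) \<in> borel_measurable M"
  using gauss_vec_measurable[OF B_gauss[of s t]] assms by (cases "s = t") auto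

lemma B_increment_moments:
  assumes "q \<ge> 1"
  shows "\<exists>C\<ge>0. \<forall>s t. 0 \<le> s \<longrightarrow> s \<le> t \<longrightarrow> t \<le> T \<longrightarrow>
    (\<integral>\<^sup>+\<omega>. ennreal (norm (B t \<omega> - B s \<omega>) powr q) \<partial>M) \<le> ennreal (C * sqrt (t - s) powr q)"
proof -
  obtain C where C: "C \<ge> 0" and le: "\<And>\<sigma> (W :: 'w \<Rightarrow> real ^ 'd). \<sigma> > 0 \<Longrightarrow> gauss_vec \<sigma> W \<Longrightarrow>
      (\<integral>\<^sup>+\<omega>. ennreal (norm (W \<omega>) powr q) \<partial>M) \<le> ennreal (C * \<sigma> powr q)"
    using gauss_vec_moments[OF assms] by blast
  show ?thesis
  proof (intro exI[of _ C] conjI allI impI C)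
    fix s t assume "0 \<le> s" "s \<le> t" "t \<le> T"
    then show "(\<integral>\<^sup>+\<omega>. ennreal (norm (B t \<omega> - B s \<omega>) powr q) \<partial>M) \<le> ennreal (C * sqrt (t - s) powr q)"
      using le[OF _ B_gauss[of s t]] by (cases "s = t") auto
  qed
qed

text \<open>An increment over time \<open>h\<close> has size \<open>sqrt h\<close>, which gives
  order \<open>h * sqrt h\<close> or better for all four terms. Summed over \<open>t / h\<close>
  steps the errors are of order \<open>sqrt h\<close> and vanish in the limit.\<close>

lemma increment_errors:
  "\<exists>C\<ge>0. \<forall>s h. 0 \<le> s \<longrightarrow> 0 < h \<longrightarrow> s + h \<le> T \<longrightarrow>
    integrable M (\<lambda>\<omega>. incr_error (\<lambda>r. B r \<omega>) s h) \<and>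
    expectation (\<lambda>\<omega>. incr_error (\<lambda>r. B r \<omega>) s h) \<le> C * (h * sqrt h)"
proof -
  obtain M1 where M1: "M1 \<ge> 0" and m1: "\<And>s t. 0 \<le> s \<Longrightarrow> s \<le> t \<Longrightarrow> t \<le> T \<Longrightarrow>
    (\<integral>\<^sup>+\<omega>. ennreal (norm (B t \<omega> - B s \<omega>) powr 1) \<partial>M) \<le> ennreal (M1 * sqrt (t - s) powr 1)"
    using B_increment_moments[of 1] by auto
  obtain M3 where M3: "M3 \<ge> 0" and m3: "\<And>s t. 0 \<le> s \<Longrightarrow> s \<le> t \<Longrightarrow> t \<le> T \<Longrightarrow>
    (\<integral>\<^sup>+\<omega>. ennreal (norm (B t \<omega> - B s \<omega>) powr 3) \<partial>M) \<le> ennreal (M3 * sqrt (t - s) powr 3)"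
    using B_increment_moments[of 3] by auto
  show ?thesis
  proof (intro exI[of _ "M1 + sqrt T + M3 + M1"] conjI allI impI)
    show "0 \<le> M1 + sqrt T + M3 + M1" using M1 M3 T by simp
    fix s h assume s: "0 \<le> s" and h: "0 < h" and sh: "s + h \<le> T"
    let ?w = "\<lambda>\<omega>. B (s + h) \<omega> - B s \<omega>"
    let ?I = "\<lambda>\<omega>. integral {s..s+h} (\<lambda>r. norm (B r \<omega> - B s \<omega>))"
    have [measurable]: "?w \<in> borel_measurable M" using s h sh by (intro B_increment_measurable) auto
    have "(\<integral>\<^sup>+\<omega>. ennreal (norm (?w \<omega>)) \<partial>M) \<le> ennreal (M1 * sqrt h)"
      using m1[of s "s + h"] s h sh by simp
    from integral_le_of_nn_integral_le[OF _ _ this]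
    have i1: "integrable M (\<lambda>\<omega>. norm (?w \<omega>))" and e1: "expectation (\<lambda>\<omega>. norm (?w \<omega>)) \<le> M1 * sqrt h"
      using M1 h by auto
    have "sqrt h powr 3 = h * sqrt h" using h by (simp add: powr_numeral power3_eq_cube)
    then have "(\<integral>\<^sup>+\<omega>. ennreal (norm (?w \<omega>) ^ 3) \<partial>M) \<le> ennreal (M3 * (h * sqrt h))"
      using m3[of s "s + h"] s h sh by (simp add: powr_numeral)
    from integral_le_of_nn_integral_le[OF _ _ this]
    have i3: "integrable M (\<lambda>\<omega>. norm (?w \<omega>) ^ 3)"
      and e3: "expectation (\<lambda>\<omega>. norm (?w \<omega>) ^ 3) \<le> M3 * (h * sqrt h)"
      using M3 h by auto
    have cont: "continuous_on {s..s+h} (\<lambda>r. norm (B r \<omega> - B s \<omega>))" if "\<omega> \<in> space M" for \<omega>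
      using s sh by (intro continuous_intros continuous_on_subset[OF B_cont[OF that]]) auto
    have meas: "(\<lambda>\<omega>. norm (B r \<omega> - B s \<omega>)) \<in> borel_measurable M" if "r \<in> {s..s+h}" for r
      using B_increment_measurable[of s r] that s sh by simp
    have Inn: "0 \<le> ?I \<omega>" if "\<omega> \<in> space M" for \<omega>
      using cont[OF that] by (intro integral_nonneg integrable_continuous_real) auto
    have "(\<integral>\<^sup>+\<omega>. ennreal (?I \<omega>) \<partial>M) \<le> ennreal ((s + h - s) * (M1 * sqrt h))"
    proof (rule nn_integral_time_integral_le)
      fix r assume r: "r \<in> {s..s+h}"
      have "(\<integral>\<^sup>+\<omega>. ennreal (norm (B r \<omega> - B s \<omega>)) \<partial>M) \<le> ennreal (M1 * sqrt (r - s))"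
        using m1[of s r] r s sh by simp
      also have "\<dots> \<le> ennreal (M1 * sqrt h)"
        using r M1 by (intro ennreal_leI mult_left_mono) auto
      finally show "(\<integral>\<^sup>+\<omega>. ennreal (norm (B r \<omega> - B s \<omega>)) \<partial>M) \<le> ennreal (M1 * sqrt h)" .
    qed (use h cont meas in auto)
    from integral_le_of_nn_integral_le[OF borel_measurable_time_integral[OF _ cont meas] Inn this]
    have iI: "integrable M ?I" and eI: "expectation ?I \<le> h * (M1 * sqrt h)"
      using M1 h by auto
    show "integrable M (\<lambda>\<omega>. incr_error (\<lambda>r. B r \<omega>) s h)"
      unfolding incr_error_def using i1 i3 iI by auto
    have "expectation (\<lambda>\<omega>. incr_error (\<lambda>r. B r \<omega>) s h) =
        h * expectation (\<lambda>\<omega>. norm (?w \<omega>)) + h\<^sup>2 + expectation (\<lambda>\<omega>. norm (?w \<omega>) ^ 3) + expectation ?I"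
      unfolding incr_error_def using i1 i3 iI by (simp add: prob_space)
    also have "\<dots> \<le> h * (M1 * sqrt h) + h * (sqrt T * sqrt h) + M3 * (h * sqrt h) + h * (M1 * sqrt h)"
    proof (intro add_mono mult_left_mono e1 e3 eI)
      \<comment> \<open>One factor \<open>sqrt h\<close> is replaced by \<open>sqrt T\<close>, which
        explains this summand of the constant.\<close>
      have "h = sqrt h * sqrt h" using h by simp
      also have "\<dots> \<le> sqrt T * sqrt h" using h s sh by (intro mult_right_mono) auto
      finally show "h\<^sup>2 \<le> h * (sqrt T * sqrt h)"
        using h by (simp add: power2_eq_square mult_left_mono)
    qed (use h in auto)
    finally show "expectation (\<lambda>\<omega>. incr_error (\<lambda>r. B r \<omega>) s h) \<le> (M1 + sqrt T + M3 + M1) * (h * sqrt h)"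
      by (simp add: algebra_simps)
  qed
qed

text \<open>The Taylor polynomial is nonnegative up to \<open>O(h)\<close>, so the paths that leave the box during the
  step may be added on the right-hand side at the price of the last term, which telescopes.\<close>

lemma lyap_expectation_step:
  fixes \<delta> c m C0 :: real
  assumes \<delta>: "\<delta> > 0" and m: "m > 0" and C0: "C0 \<ge> 0"
    and gen: "\<And>x. x \<in> weyl_chamber Rp \<Longrightarrow> lyap_gen Rp k m \<beta> x \<le> C0"
  defines "a \<equiv> \<lambda>t. expectation (\<lambda>\<omega>. indicator (stay \<delta> c t) \<omega> * lyap Rp m (X t \<omega>))"
  shows "\<exists>C1\<ge>0. \<exists>C2\<ge>0. \<forall>s h. 0 \<le> s \<longrightarrow> 0 < h \<longrightarrow> s + h \<le> T \<longrightarrow>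
    a (s + h) \<le> (1 + C0 * h) * a s + C1 * (h * sqrt h)
      + C2 * h * (prob (stay \<delta> c s) - prob (stay \<delta> c (s + h)))"
proof -
  define Fb where "Fb = (\<Sum>\<alpha>\<in>Rp. \<bar>k \<alpha>\<bar> * norm \<alpha> / \<delta>)"
  define G where "G = (\<Sum>\<alpha>\<in>Rp. (m + m / \<delta>) * norm \<alpha>)"
  define A where "A = G\<^sup>2 + m * (\<Sum>\<alpha>\<in>Rp. (norm \<alpha>)\<^sup>2 / \<delta>\<^sup>2)"
  define E where "E = exp (real (card Rp) * (m * c - m * ln \<delta>))"
  have m0: "m \<ge> 0" using m by simp
  have nn: "Fb \<ge> 0" "G \<ge> 0" "A \<ge> 0" "E \<ge> 0"
    using \<delta> m by (auto simp: Fb_def G_def A_def E_def intro!: sum_nonneg add_nonneg_nonneg mult_nonneg_nonneg)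
  have bV: "0 \<le> lyap Rp m x" "lyap Rp m x \<le> E" and bG: "norm (lyap_grad Rp m x) \<le> G"
    and bF: "norm (dunkl_drift Rp k x) \<le> Fb"
    and bA: "\<And>y z. \<bar>lyap_form Rp m x y z\<bar> \<le> A * (norm y * norm z)"
    if "x \<in> chamber_box Rp \<delta> c" for x
    using lyap_pos[of Rp m x] lyap_box_bound[OF \<delta> m0 fin_Rp that] norm_lyap_grad_box[OF \<delta> m0 that]
      norm_dunkl_drift_box[OF \<delta> that] lyap_form_box[OF \<delta> m0 that]
    unfolding E_def G_def Fb_def A_def by auto
  obtain C where C: "C \<ge> 0" and step: "\<And>s h Y W u. 0 \<le> h \<Longrightarrow> h \<le> T \<Longrightarrow> continuous_on {s..s+h} Y \<Longrightarrow>
    continuous_on {s..s+h} W \<Longrightarrow> continuous_on {s..s+h} u \<Longrightarrow>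
    (\<forall>r\<in>{s..s+h}. Y r \<in> chamber_box Rp \<delta> c \<and> norm (u r) \<le> \<beta> \<and>
      Y r = Y s + (W r - W s) + integral {s..r} (\<lambda>r. dunkl_drift Rp k (Y r) + u r)) \<Longrightarrow>
    lyap Rp m (Y (s + h)) \<le> lyap_bound Rp k m \<beta> h (Y s) (W (s + h) - W s) + C * incr_error W s h"
    using lyap_step[OF \<delta> m0 fin_Rp \<beta>_nonneg less_imp_le[OF T], of c k] by blast
  obtain C' where C': "C' \<ge> 0" and err: "\<And>s h. 0 \<le> s \<Longrightarrow> 0 < h \<Longrightarrow> s + h \<le> T \<Longrightarrow>
    integrable M (\<lambda>\<omega>. incr_error (\<lambda>r. B r \<omega>) s h) \<and>
    expectation (\<lambda>\<omega>. incr_error (\<lambda>r. B r \<omega>) s h) \<le> C' * (h * sqrt h)"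
    using increment_errors by blast
  show ?thesis
  proof (intro exI conjI allI impI)
    \<comment> \<open>\<open>C * C'\<close> combines the pathwise error with its mean;
      \<open>E * (G * Fb)\<close>, times \<open>h\<close>, bounds how far the expansion can fall
      below zero on the box.\<close>
    show "0 \<le> C * C'" "0 \<le> E * (G * Fb)" using C C' nn by auto
    fix s h assume s: "0 \<le> s" and h: "0 < h" and sh: "s + h \<le> T"
    let ?w = "\<lambda>\<omega>. B (s + h) \<omega> - B s \<omega>"
    define Er where "Er \<omega> = incr_error (\<lambda>r. B r \<omega>) s h" for \<omega>
    define V where "V \<omega> = lyap Rp m (X s \<omega>)" for \<omega>
    define g where "g \<omega> = lyap_grad Rp m (X s \<omega>)" for \<omega>
    define f where "f \<omega> = dunkl_drift Rp k (X s \<omega>)" for \<omega>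
    define q where "q i j \<omega> = lyap_form Rp m (X s \<omega>) (axis i 1) (axis j 1)" for i j :: 'd and \<omega>
    \<comment> \<open>\<open>I\<close> is known at time \<open>s\<close> and may be combined with
      the independent increment, whereas \<open>J\<close> depends on the path during the
      step.\<close>
    define I where "I \<omega> = (indicator (stay \<delta> c s) \<omega> :: real)" for \<omega>
    define J where "J \<omega> = (indicator (stay \<delta> c (s + h)) \<omega> :: real)" for \<omega>
    have sT: "s \<in> {0..T}" "s + h \<in> {0..T}" using s h sh by auto
    note [measurable] = X_adapted[OF sT(1)] stay_sets[OF sT(1)]
    have I_meas [measurable]: "I \<in> borel_measurable (F s)" unfolding I_def[abs_def] by measurable
    have V_meas [measurable]: "V \<in> borel_measurable (F s)" unfolding V_def[abs_def] by measurable
    have g_meas [measurable]: "g \<in> borel_measurable (F s)" unfolding g_def[abs_def] by measurable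
    have f_meas [measurable]: "f \<in> borel_measurable (F s)" unfolding f_def[abs_def] by measurable
    have q_meas [measurable]: "q i j \<in> borel_measurable (F s)" for i j unfolding q_def[abs_def] by measurable
    have box: "I \<omega> = 0 \<or> (I \<omega> = 1 \<and> X s \<omega> \<in> chamber_box Rp \<delta> c)" for \<omega>
      using s by (auto simp: I_def stay_def indicator_def)
    have JI: "0 \<le> J \<omega>" "J \<omega> \<le> I \<omega>" for \<omega>
      using stay_mono[of s "s + h" \<delta> c] h by (auto simp: I_def J_def indicator_def)
    \<comment> \<open>The constant, linear and quadratic coefficients of the expansion in the
      increment. They are known at time \<open>s\<close>, and bounded because \<open>I\<close>
      confines \<open>X s\<close> to the box.\<close>
    define Y0 where "Y0 \<omega> = I \<omega> * (V \<omega> * (1 + h * (g \<omega> \<bullet> f \<omega> + \<beta> * norm (g \<omega>))))" for \<omega>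
    define Y1 where "Y1 i \<omega> = I \<omega> * (V \<omega> * g \<omega> $ i)" for i \<omega>
    define Y2 where "Y2 i j \<omega> = I \<omega> * (V \<omega> * q i j \<omega> / 2)" for i j \<omega>
    have Y_meas: "Y0 \<in> borel_measurable (F s)" "Y1 i \<in> borel_measurable (F s)"
      "Y2 i j \<in> borel_measurable (F s)" for i j
      unfolding Y0_def[abs_def] Y1_def[abs_def] Y2_def[abs_def] by measurable
    have gf: "\<bar>g \<omega> \<bullet> f \<omega>\<bar> \<le> G * Fb" if "X s \<omega> \<in> chamber_box Rp \<delta> c" for \<omega>
      unfolding g_def f_def using bG[OF that] bF[OF that] nn
      by (intro order_trans[OF Cauchy_Schwarz_ineq2] mult_mono) auto
    have Y0_bd: "\<bar>Y0 \<omega>\<bar> \<le> E * (1 + h * (G * Fb + \<beta> * G))" for \<omega>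
    proof (cases "I \<omega> = 0")
      case False
      then have x: "X s \<omega> \<in> chamber_box Rp \<delta> c" "I \<omega> = 1" using box[of \<omega>] by auto
      have "\<bar>1 + h * (g \<omega> \<bullet> f \<omega> + \<beta> * norm (g \<omega>))\<bar> \<le> 1 + h * (G * Fb + \<beta> * G)"
      proof -
        have "\<bar>g \<omega> \<bullet> f \<omega> + \<beta> * norm (g \<omega>)\<bar> \<le> G * Fb + \<beta> * G"
          using gf[OF x(1)] bG[OF x(1)] \<beta>_nonneg
          by (intro order_trans[OF abs_triangle_ineq] add_mono) (auto simp: g_def intro!: mult_left_mono)
        then have "h * \<bar>g \<omega> \<bullet> f \<omega> + \<beta> * norm (g \<omega>)\<bar> \<le> h * (G * Fb + \<beta> * G)"
          using h by simp
        moreover have "\<bar>1 + h * (g \<omega> \<bullet> f \<omega> + \<beta> * norm (g \<omega>))\<bar> \<le>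
            \<bar>1\<bar> + \<bar>h * (g \<omega> \<bullet> f \<omega> + \<beta> * norm (g \<omega>))\<bar>" by (rule abs_triangle_ineq)
        moreover have "\<bar>h * (g \<omega> \<bullet> f \<omega> + \<beta> * norm (g \<omega>))\<bar> = h * \<bar>g \<omega> \<bullet> f \<omega> + \<beta> * norm (g \<omega>)\<bar>"
          using h by (simp add: abs_mult)
        ultimately show ?thesis by linarith
      qed
      then show ?thesis
        unfolding Y0_def x(2) abs_mult using bV[OF x(1)] nn by (auto simp: V_def intro!: mult_mono)
    qed (use nn \<beta>_nonneg h in \<open>simp add: Y0_def\<close>)
    have Y1_bd: "\<bar>Y1 i \<omega>\<bar> \<le> E * G" for i \<omega>
    proof (cases "I \<omega> = 0")
      case False
      then have x: "X s \<omega> \<in> chamber_box Rp \<delta> c" "I \<omega> = 1" using box[of \<omega>] by auto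
      have "\<bar>g \<omega> $ i\<bar> \<le> G"
        using bG[OF x(1)] component_le_norm_cart[of "g \<omega>" i] by (simp add: g_def)
      then show ?thesis
        unfolding Y1_def x(2) abs_mult using bV[OF x(1)] nn by (auto simp: V_def intro!: mult_mono)
    qed (use nn in \<open>simp add: Y1_def\<close>)
    have Y2_bd: "\<bar>Y2 i j \<omega>\<bar> \<le> E * A" for i j \<omega>
    proof (cases "I \<omega> = 0")
      case False
      then have x: "X s \<omega> \<in> chamber_box Rp \<delta> c" "I \<omega> = 1" using box[of \<omega>] by auto
      have "\<bar>q i j \<omega> / 2\<bar> \<le> A"
        using bA[OF x(1), of "axis i 1" "axis j 1"] nn by (simp add: q_def norm_axis_1)
      moreover have "\<bar>V \<omega>\<bar> \<le> E" using bV[OF x(1)] by (simp add: V_def)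
      ultimately have "\<bar>V \<omega>\<bar> * \<bar>q i j \<omega> / 2\<bar> \<le> E * A"
        using nn by (intro mult_mono) simp_all
      then show ?thesis unfolding Y2_def x(2) by (simp add: abs_mult)
    qed (use nn in \<open>simp add: Y2_def\<close>)
    have st: "s < s + h" using h by simp
    note W = B_gauss[OF s st sh, simplified]
    note ind = B_indep[OF s st sh]
    have sq: "sqrt h > 0" using h by simp
    note moments = indep_bounded_moments[OF W sq ind subalg[OF sT(1)]]
    have bd_int: "integrable M Y" if "Y \<in> borel_measurable (F s)" "\<And>\<omega>. \<bar>Y \<omega>\<bar> \<le> K"
      for Y :: "'w \<Rightarrow> real" and K
      using measurable_from_subalg[OF subalg[OF sT(1)] that(1)] that(2)
      by (intro Bochner_Integration.integrable_bound[of M "\<lambda>_. K" Y] AE_I2)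
         (auto intro: order_trans[OF _ abs_ge_self])
    have intY: "integrable M Y0" "integrable M (Y1 i)" "integrable M (Y2 i j)" for i j
      using bd_int[OF Y_meas(1) Y0_bd] bd_int[OF Y_meas(2) Y1_bd] bd_int[OF Y_meas(3) Y2_bd] by auto
    define Z where "Z \<omega> = Y0 \<omega> + (\<Sum>i\<in>UNIV. Y1 i \<omega> * ?w \<omega> $ i)
      + (\<Sum>i\<in>UNIV. \<Sum>j\<in>UNIV. Y2 i j \<omega> * (?w \<omega> $ i * ?w \<omega> $ j))" for \<omega>
    \<comment> \<open>The linear terms and the products of different components average to zero, and
      the squares to \<open>h\<close>.\<close>
    have "has_bochner_integral M Z (expectation Y0 + (\<Sum>i\<in>(UNIV::'d set). 0)
      + (\<Sum>i\<in>UNIV. \<Sum>j\<in>UNIV. (if i = j then (sqrt h)\<^sup>2 else 0) * expectation (Y2 i j)))"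
      unfolding Z_def[abs_def]
      by (intro has_bochner_integral_add has_bochner_integral_sum has_bochner_integral_integrable intY(1)
          moments(1)[OF Y_meas(2) Y1_bd] moments(2)[OF Y_meas(3) Y2_bd])
    also have "expectation Y0 + (\<Sum>i\<in>(UNIV::'d set). 0)
      + (\<Sum>i\<in>UNIV. \<Sum>j\<in>UNIV. (if i = j then (sqrt h)\<^sup>2 else 0) * expectation (Y2 i j)) =
        expectation (\<lambda>\<omega>. Y0 \<omega> + h * (\<Sum>i\<in>UNIV. Y2 i i \<omega>))"
      using h intY by (simp add: if_distrib[of "\<lambda>c. c * _"] sum.delta sum_distrib_left cong: if_cong)
    finally have Z: "integrable M Z" "expectation Z = expectation (\<lambda>\<omega>. Y0 \<omega> + h * (\<Sum>i\<in>UNIV. Y2 i i \<omega>))"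
      by (auto simp: has_bochner_integral_iff)
    have IV_int: "integrable M (\<lambda>\<omega>. I \<omega> * V \<omega>)"
    proof (rule bd_int)
      show "\<bar>I \<omega> * V \<omega>\<bar> \<le> E" for \<omega>
        using box[of \<omega>] bV[of "X s \<omega>"] nn by (auto simp: V_def)
    qed measurable
    \<comment> \<open>What is left after averaging is \<open>V\<close> times one plus
      \<open>h\<close> times the generator, so \<open>gen\<close> applies pointwise.\<close>
    have "expectation Z \<le> expectation (\<lambda>\<omega>. (1 + C0 * h) * (I \<omega> * V \<omega>))"
      unfolding Z(2)
    proof (rule integral_mono)
      show "integrable M (\<lambda>\<omega>. Y0 \<omega> + h * (\<Sum>i\<in>UNIV. Y2 i i \<omega>))" using intY by auto
      show "integrable M (\<lambda>\<omega>. (1 + C0 * h) * (I \<omega> * V \<omega>))" using IV_int by auto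
      fix \<omega> assume \<omega>: "\<omega> \<in> space M"
      show "Y0 \<omega> + h * (\<Sum>i\<in>UNIV. Y2 i i \<omega>) \<le> (1 + C0 * h) * (I \<omega> * V \<omega>)"
      proof (cases "I \<omega> = 0")
        case False
        then have x: "X s \<omega> \<in> chamber_box Rp \<delta> c" "I \<omega> = 1" using box[of \<omega>] by auto
        define tr where "tr = (\<Sum>i\<in>UNIV. q i i \<omega>)"
        have tr: "tr = (norm (g \<omega>))\<^sup>2 + m * (\<Sum>\<alpha>\<in>Rp. (norm \<alpha>)\<^sup>2 / (\<alpha> \<bullet> X s \<omega>)\<^sup>2)"
          unfolding tr_def q_def g_def by (rule lyap_form_trace)
        have "tr / 2 + g \<omega> \<bullet> f \<omega> + \<beta> * norm (g \<omega>) \<le> C0"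
          using gen[OF X_chamber[OF sT(1) \<omega>]] unfolding tr g_def f_def lyap_gen_def by simp
        then have le: "V \<omega> * (1 + h * (tr / 2 + g \<omega> \<bullet> f \<omega> + \<beta> * norm (g \<omega>))) \<le> V \<omega> * (1 + h * C0)"
          using bV(1)[OF x(1)] h by (intro mult_left_mono add_left_mono) (auto simp: V_def)
        have sumY: "(\<Sum>i\<in>UNIV. Y2 i i \<omega>) = V \<omega> * tr / 2"
          by (simp add: Y2_def x(2) tr_def sum_distrib_left sum_divide_distrib)
        have "Y0 \<omega> + h * (\<Sum>i\<in>UNIV. Y2 i i \<omega>) =
            V \<omega> * (1 + h * (tr / 2 + g \<omega> \<bullet> f \<omega> + \<beta> * norm (g \<omega>)))"
          unfolding sumY by (simp add: Y0_def x(2) algebra_simps)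
        then show ?thesis using le x(2) by (simp add: mult.commute)
      qed (simp add: Y0_def Y2_def)
    qed
    then have EZ: "expectation Z \<le> (1 + C0 * h) * a s"
      by (simp add: a_def I_def V_def)
    have Zform: "Z \<omega> = I \<omega> * lyap_bound Rp k m \<beta> h (X s \<omega>) (?w \<omega>)" for \<omega>
    proof -
      have "(\<Sum>i\<in>UNIV. Y1 i \<omega> * ?w \<omega> $ i) = I \<omega> * (V \<omega> * (g \<omega> \<bullet> ?w \<omega>))"
        unfolding inner_vec_def sum_distrib_left by (intro sum.cong) (auto simp: Y1_def)
      moreover have "(\<Sum>i\<in>UNIV. \<Sum>j\<in>UNIV. Y2 i j \<omega> * (?w \<omega> $ i * ?w \<omega> $ j)) =
          I \<omega> * (V \<omega> * (lyap_form Rp m (X s \<omega>) (?w \<omega>) (?w \<omega>) / 2))"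
        unfolding lyap_form_components[of Rp m _ "?w \<omega>"] sum_distrib_left sum_divide_distrib
        by (intro sum.cong) (auto simp: Y2_def q_def)
      ultimately show ?thesis
        unfolding Z_def Y0_def lyap_bound_def V_def[symmetric] g_def[symmetric] f_def[symmetric]
        by (simp add: algebra_simps)
    qed
    have path: "J \<omega> * lyap Rp m (X (s + h) \<omega>) \<le> Z \<omega> + (E * (G * Fb) * h * (I \<omega> - J \<omega>) + C * Er \<omega>)"
      if \<omega>: "\<omega> \<in> space M" for \<omega>
    proof -
      have sub: "{s..s+h} \<subseteq> {0..T}" using s sh by auto
      have cB: "continuous_on {s..s+h} (\<lambda>r. B r \<omega>)" by (rule continuous_on_subset[OF B_cont[OF \<omega>] sub])
      have "0 \<le> integral {s..s+h} (\<lambda>r. norm (B r \<omega> - B s \<omega>))"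
        by (intro integral_nonneg integrable_continuous_real continuous_intros cB) auto
      then have Er: "0 \<le> Er \<omega>" using h by (simp add: Er_def incr_error_def)
      \<comment> \<open>Only \<open>h * (g \<omega> \<bullet> f \<omega>)\<close> can be negative,
        since the quadratic polynomial and the term with \<open>\<beta>\<close> are not.\<close>
      have low: "- (E * (G * Fb) * h) \<le> Z \<omega>"
      proof (cases "I \<omega> = 0")
        case True
        then show ?thesis using nn h by (simp add: Zform)
      next
        case False
        then have x: "X s \<omega> \<in> chamber_box Rp \<delta> c" "I \<omega> = 1" using box[of \<omega>] by auto
        have "- (h * (G * Fb)) \<le> h * (g \<omega> \<bullet> f \<omega>)"
          using mult_left_mono[of "- (G * Fb)" "g \<omega> \<bullet> f \<omega>" h] gf[OF x(1)] h by (simp add: abs_le_iff)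
        moreover have "0 \<le> h * (\<beta> * norm (g \<omega>))" using h \<beta>_nonneg by simp
        moreover have "0 \<le> 1 + g \<omega> \<bullet> ?w \<omega> + lyap_form Rp m (X s \<omega>) (?w \<omega>) (?w \<omega>) / 2"
          unfolding g_def by (rule lyap_taylor_nonneg[OF m0])
        ultimately have "- (h * (G * Fb)) \<le> 1 + g \<omega> \<bullet> ?w \<omega> + lyap_form Rp m (X s \<omega>) (?w \<omega>) (?w \<omega>) / 2
            + h * (g \<omega> \<bullet> f \<omega> + \<beta> * norm (g \<omega>))" by (simp add: algebra_simps)
        then have "V \<omega> * - (h * (G * Fb)) \<le> Z \<omega>"
          unfolding Zform x(2) mult_1 lyap_bound_def V_def g_def f_def
          using bV(1)[OF x(1)] by (intro mult_left_mono)
        moreover have "V \<omega> * (h * (G * Fb)) \<le> E * (h * (G * Fb))"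
          using bV(2)[OF x(1)] nn h by (intro mult_right_mono) (auto simp: V_def)
        ultimately show ?thesis by (simp add: algebra_simps)
      qed
      \<comment> \<open>As \<open>J \<le> I\<close>, three cases remain: the path has left by time
        \<open>s\<close>, leaves during the step, or stays throughout. In the second the correction
        compensates a negative \<open>Z\<close>; in the third the pathwise estimate applies.\<close>
      consider "I \<omega> = 0" "J \<omega> = 0" | "I \<omega> = 1" "J \<omega> = 0" | "I \<omega> = 1" "J \<omega> = 1" "\<omega> \<in> stay \<delta> c (s + h)"
        using JI[of \<omega>] by (auto simp: I_def J_def indicator_def split: if_splits)
      then show ?thesis
      proof cases
        case 1
        then show ?thesis using Er C by (simp add: Zform)
      next
        case 2
        moreover have "0 \<le> C * Er \<omega>" using Er C by simp
        ultimately show ?thesis using low by simp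
      next
        case 3
        have "lyap Rp m (X (s + h) \<omega>) \<le> lyap_bound Rp k m \<beta> h (X s \<omega>) (?w \<omega>)
            + C * incr_error (\<lambda>r. B r \<omega>) s h"
        proof (rule step[of h s "\<lambda>r. X r \<omega>" "\<lambda>r. B r \<omega>" "\<lambda>r. b r (X r \<omega>)"])
          show "continuous_on {s..s+h} (\<lambda>r. X r \<omega>)" by (rule continuous_on_subset[OF X_cont[OF \<omega>] sub])
          show "continuous_on {s..s+h} (\<lambda>r. B r \<omega>)" by (rule cB)
          show "continuous_on {s..s+h} (\<lambda>r. b r (X r \<omega>))"
            by (rule continuous_on_subset[OF b_path_continuous[OF \<omega>] sub])
          show "\<forall>r\<in>{s..s+h}. X r \<omega> \<in> chamber_box Rp \<delta> c \<and> norm (b r (X r \<omega>)) \<le> \<beta> \<and>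
              X r \<omega> = X s \<omega> + (B r \<omega> - B s \<omega>) + integral {s..r} (\<lambda>r. dunkl_drift Rp k (X r \<omega>) + b r (X r \<omega>))"
          proof (intro ballI conjI)
            fix r assume r: "r \<in> {s..s+h}"
            show "X r \<omega> \<in> chamber_box Rp \<delta> c" using 3(3) r s by (auto simp: stay_def)
            show "norm (b r (X r \<omega>)) \<le> \<beta>" using r s sh by (intro b_bound) auto
            show "X r \<omega> = X s \<omega> + (B r \<omega> - B s \<omega>) + integral {s..r} (\<lambda>r. dunkl_drift Rp k (X r \<omega>) + b r (X r \<omega>))"
              using r s sh \<omega> by (intro X_eq) auto
          qed
        qed (use h s sh in auto)
        then show ?thesis
          unfolding Zform 3(1,2) by (simp add: Er_def)
      qed
    qed
    have Er_int: "integrable M Er" and Er_le: "expectation Er \<le> C' * (h * sqrt h)"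
      using err[OF s h sh] unfolding Er_def[abs_def] by auto
    have [measurable]: "stay \<delta> c s \<in> sets M" "stay \<delta> c (s + h) \<in> sets M"
      using stay_sets_M sT by auto
    have IJ: "integrable M I" "integrable M J" "expectation I = prob (stay \<delta> c s)"
      "expectation J = prob (stay \<delta> c (s + h))"
      unfolding I_def[abs_def] J_def[abs_def]
      by (auto simp: integrable_indicator_iff emeasure_eq_measure)
    have JV_int: "integrable M (\<lambda>\<omega>. J \<omega> * lyap Rp m (X (s + h) \<omega>))"
    proof (rule Bochner_Integration.integrable_bound[of M "\<lambda>_. E"])
      have [measurable]: "X (s + h) \<in> borel_measurable M" using X_measurable sT by blast
      have [measurable]: "J \<in> borel_measurable M" unfolding J_def[abs_def] by measurable
      show "(\<lambda>\<omega>. J \<omega> * lyap Rp m (X (s + h) \<omega>)) \<in> borel_measurable M" by measurable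
      show "AE \<omega> in M. norm (J \<omega> * lyap Rp m (X (s + h) \<omega>)) \<le> norm E"
      proof (rule AE_I2)
        fix \<omega>
        show "norm (J \<omega> * lyap Rp m (X (s + h) \<omega>)) \<le> norm E"
          using bV[of "X (s + h) \<omega>"] nn s h by (auto simp: J_def indicator_def stay_def)
      qed
    qed simp
    have "a (s + h) \<le> expectation (\<lambda>\<omega>. Z \<omega> + (E * (G * Fb) * h * (I \<omega> - J \<omega>) + C * Er \<omega>))"
      unfolding a_def J_def[symmetric] using path JV_int Z(1) IJ(1,2) Er_int
      by (intro integral_mono) auto
    also have "\<dots> = expectation Z + (E * (G * Fb) * h * (prob (stay \<delta> c s) - prob (stay \<delta> c (s + h))) + C * expectation Er)"
      using Z(1) IJ Er_int by simp
    also have "\<dots> \<le> (1 + C0 * h) * a s + (E * (G * Fb) * h * (prob (stay \<delta> c s) - prob (stay \<delta> c (s + h)))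
        + C * (C' * (h * sqrt h)))"
      by (rule add_mono[OF EZ add_mono[OF order_refl mult_left_mono[OF Er_le C]]])
    finally show "a (s + h) \<le> (1 + C0 * h) * a s + C * C' * (h * sqrt h)
        + E * (G * Fb) * h * (prob (stay \<delta> c s) - prob (stay \<delta> c (s + h)))"
      by (simp add: algebra_simps)
  qed
qed

end

section \<open>From one step to moments uniform in time\<close>

context dunkl_sde
begin

text \<open>Over equal steps of length \<open>h\<close> the errors amount to
  \<open>C1 * t * sqrt h\<close> and, as the probabilities telescope, \<open>C2 * h\<close>. Both
  vanish with \<open>h\<close>, so the constants that depend on the box disappear from the
  bound.\<close>

lemma lyap_stopped_bound:
  fixes \<delta> c m C0 :: real
  assumes \<delta>: "\<delta> > 0" and m: "m > 0" and C0: "C0 \<ge> 0"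
    and gen: "\<And>x. x \<in> weyl_chamber Rp \<Longrightarrow> lyap_gen Rp k m \<beta> x \<le> C0"
    and t: "t \<in> {0..T}"
  shows "expectation (\<lambda>\<omega>. indicator (stay \<delta> c t) \<omega> * lyap Rp m (X t \<omega>)) \<le> exp (C0 * t) * lyap Rp m x0"
proof -
  define a where "a t = expectation (\<lambda>\<omega>. indicator (stay \<delta> c t) \<omega> * lyap Rp m (X t \<omega>))" for t
  obtain C1 C2 where C: "C1 \<ge> 0" "C2 \<ge> 0" and step: "\<And>s h. 0 \<le> s \<Longrightarrow> 0 < h \<Longrightarrow> s + h \<le> T \<Longrightarrow>
    a (s + h) \<le> (1 + C0 * h) * a s + C1 * (h * sqrt h)
      + C2 * h * (prob (stay \<delta> c s) - prob (stay \<delta> c (s + h)))"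
    using lyap_expectation_step[OF \<delta> m C0 gen, of c] unfolding a_def by blast
  have [measurable]: "stay \<delta> c 0 \<in> sets M" using T by (intro stay_sets_M) auto
  have "a 0 = expectation (\<lambda>\<omega>. indicator (stay \<delta> c 0) \<omega> * lyap Rp m x0)"
    unfolding a_def using X_init by (intro Bochner_Integration.integral_cong) auto
  also have "\<dots> = prob (stay \<delta> c 0) * lyap Rp m x0" by simp
  also have "\<dots> \<le> 1 * lyap Rp m x0"
    using lyap_pos[of Rp m x0] by (intro mult_right_mono prob_le_1) auto
  finally have a0: "a 0 \<le> lyap Rp m x0" by simp
  show ?thesis
  proof (cases "t = 0")
    case True
    then show ?thesis using a0 by (simp add: a_def)
  next
    case False
    then have t0: "t > 0" using t by simp
    have le: "a t \<le> exp (C0 * t) * (lyap Rp m x0 + C1 * t * sqrt (t / real (Suc n)) + C2 * (t / real (Suc n)))" for n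
    proof -
      define N where "N = Suc n"
      define h where "h = t / real N"
      have h: "h > 0" and Nh: "real N * h = t" using t0 by (auto simp: h_def N_def)
      define P where "P l = prob (stay \<delta> c (real l * h))" for l
      have Pl: "P (Suc l) \<le> P l" if "l < N" for l
      proof -
        have "real l * h \<le> real N * h" using that h by (intro mult_right_mono) auto
        then have "real l * h \<in> {0..T}" using Nh t h by auto
        then show ?thesis unfolding P_def using h
          by (intro finite_measure_mono stay_mono stay_sets_M) (auto intro: mult_right_mono)
      qed
      have st: "a (real (Suc l) * h) \<le> (1 + C0 * h) * a (real l * h) + C1 * (h * sqrt h)
          + C2 * h * (P l - P (Suc l))" if "l < N" for l
      proof -
        have eq: "real (Suc l) * h = real l * h + h" by (simp add: algebra_simps)
        have "real (Suc l) * h \<le> real N * h" using that h by (intro mult_right_mono) auto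
        then show ?thesis unfolding P_def eq using h t Nh by (intro step) auto
      qed
      have "a (real N * h) \<le> (1 + C0 * h) ^ N * (a (real 0 * h) + real N * (C1 * (h * sqrt h)) + C2 * h * (P 0 - P N))"
        using C C0 h Pl st
        by (intro real_sequence_growth[where a="\<lambda>l. a (real l * h)" and P=P]) auto
      also have "\<dots> \<le> (1 + C0 * h) ^ N * (lyap Rp m x0 + C1 * t * sqrt h + C2 * h)"
      proof (intro mult_left_mono add_mono)
        show "real N * (C1 * (h * sqrt h)) \<le> C1 * t * sqrt h"
          by (simp add: Nh[symmetric] mult_ac)
        have "P 0 - P N \<le> 1" using prob_le_1 measure_nonneg unfolding P_def
          by (smt (verit, best))
        then show "C2 * h * (P 0 - P N) \<le> C2 * h"
          using mult_left_mono[of "P 0 - P N" 1 "C2 * h"] C h by simp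
      qed (use a0 C0 h in auto)
      also have "\<dots> \<le> exp (C0 * t) * (lyap Rp m x0 + C1 * t * sqrt h + C2 * h)"
      proof (rule mult_right_mono)
        have "(1 + C0 * h) ^ N \<le> exp (C0 * h) ^ N"
          using C0 h by (intro power_mono exp_ge_add_one_self) auto
        also have "\<dots> = exp (C0 * t)" by (simp add: exp_of_nat_mult[symmetric] Nh[symmetric] mult_ac)
        finally show "(1 + C0 * h) ^ N \<le> exp (C0 * t)" .
        show "0 \<le> lyap Rp m x0 + C1 * t * sqrt h + C2 * h"
          using C h t0 lyap_pos[of Rp m x0] by (auto intro!: add_nonneg_nonneg)
      qed
      finally show ?thesis unfolding Nh by (simp add: h_def N_def)
    qed
    have lim: "(\<lambda>n. exp (C0 * t) * (lyap Rp m x0 + C1 * t * sqrt (t / real (Suc n)) + C2 * (t / real (Suc n))))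
        \<longlonglongrightarrow> exp (C0 * t) * (lyap Rp m x0 + C1 * t * sqrt 0 + C2 * 0)"
    proof -
      have "(\<lambda>n. t / real (Suc n)) \<longlonglongrightarrow> 0"
        using LIMSEQ_inverse_real_of_nat[THEN tendsto_mult_left, of t] by (simp add: divide_inverse)
      then show ?thesis by (intro tendsto_intros)
    qed
    have "a t \<le> exp (C0 * t) * (lyap Rp m x0 + C1 * t * sqrt 0 + C2 * 0)"
      by (rule LIMSEQ_le_const[OF lim]) (use le in blast)
    then show ?thesis by (simp add: a_def)
  qed
qed

text \<open>On a compact time interval each of the finitely many pairings attains a positive minimum
  and a maximum.\<close>

lemma eventually_stay:
  assumes \<omega>: "\<omega> \<in> space M" and t: "t \<in> {0..T}"
  shows "\<forall>\<^sub>F n in sequentially. \<omega> \<in> stay (1 / real (Suc n)) (real (Suc n)) t"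
proof -
  have "\<forall>\<alpha>\<in>Rp. \<forall>\<^sub>F n in sequentially. \<forall>s\<in>{0..t}. 1 / real (Suc n) \<le> \<alpha> \<bullet> X s \<omega> \<and> \<alpha> \<bullet> X s \<omega> \<le> real (Suc n)"
  proof
    fix \<alpha> assume \<alpha>: "\<alpha> \<in> Rp"
    have cont: "continuous_on {0..t} (\<lambda>s. \<alpha> \<bullet> X s \<omega>)"
      using t by (intro continuous_intros continuous_on_subset[OF X_cont[OF \<omega>]]) auto
    have ne: "{0..t} \<noteq> {}" using t by auto
    obtain s1 where s1: "s1 \<in> {0..t}" "\<And>s. s \<in> {0..t} \<Longrightarrow> \<alpha> \<bullet> X s1 \<omega> \<le> \<alpha> \<bullet> X s \<omega>"
      using continuous_attains_inf[OF compact_Icc ne cont] by blast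
    obtain s2 where s2: "s2 \<in> {0..t}" "\<And>s. s \<in> {0..t} \<Longrightarrow> \<alpha> \<bullet> X s \<omega> \<le> \<alpha> \<bullet> X s2 \<omega>"
      using continuous_attains_sup[OF compact_Icc ne cont] by blast
    have p: "\<alpha> \<bullet> X s1 \<omega> > 0" using X_pos[OF _ \<omega> \<alpha>] s1(1) t by auto
    have "\<forall>\<^sub>F n in sequentially. inverse (real (Suc n)) < \<alpha> \<bullet> X s1 \<omega>"
      using LIMSEQ_inverse_real_of_nat p by (rule order_tendstoD(2))
    moreover have "\<forall>\<^sub>F n in sequentially. \<alpha> \<bullet> X s2 \<omega> \<le> real (Suc n)"
      by (intro eventually_sequentiallyI[of "nat \<lceil>\<alpha> \<bullet> X s2 \<omega>\<rceil>"]) linarith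
    ultimately show "\<forall>\<^sub>F n in sequentially. \<forall>s\<in>{0..t}. 1 / real (Suc n) \<le> \<alpha> \<bullet> X s \<omega> \<and> \<alpha> \<bullet> X s \<omega> \<le> real (Suc n)"
    proof eventually_elim
      case (elim n)
      show ?case
      proof
        fix s assume "s \<in> {0..t}"
        then show "1 / real (Suc n) \<le> \<alpha> \<bullet> X s \<omega> \<and> \<alpha> \<bullet> X s \<omega> \<le> real (Suc n)"
          using s1(2)[of s] s2(2)[of s] elim by (simp add: inverse_eq_divide)
      qed
    qed
  qed
  then have "\<forall>\<^sub>F n in sequentially. \<forall>\<alpha>\<in>Rp. \<forall>s\<in>{0..t}. 1 / real (Suc n) \<le> \<alpha> \<bullet> X s \<omega> \<and> \<alpha> \<bullet> X s \<omega> \<le> real (Suc n)"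
    by (rule eventually_ball_finite[OF fin_Rp])
  then show ?thesis
    by eventually_elim (use \<omega> in \<open>auto simp: stay_def chamber_box_def\<close>)
qed

text \<open>The stopped bound does not depend on the box, and along growing boxes the indicators
  eventually equal one on every path, so Fatou's lemma removes them.\<close>

lemma lyap_moment_bound:
  assumes m: "m > 0" "m + 1 < 2 * \<kappa>"
  shows "\<exists>C\<ge>0. \<forall>t\<in>{0..T}. (\<integral>\<^sup>+\<omega>. lyap Rp m (X t \<omega>) \<partial>M) \<le> ennreal C"
proof -
  obtain C0 where C0: "C0 \<ge> 0" and gen: "\<And>x. x \<in> weyl_chamber Rp \<Longrightarrow> lyap_gen Rp k m \<beta> x \<le> C0"
    using lyap_generator_bound[OF root_sys pos_sys mult \<kappa> m \<beta>_nonneg] by blast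
  define C where "C = exp (C0 * T) * lyap Rp m x0"
  show ?thesis
  proof (intro exI[of _ C] conjI ballI)
    show "0 \<le> C" using lyap_pos[of Rp m x0] by (simp add: C_def)
    fix t assume t: "t \<in> {0..T}"
    note [measurable] = X_measurable[OF t]
    let ?A = "\<lambda>n. stay (1 / real (Suc n)) (real (Suc n)) t"
    let ?V = "\<lambda>n \<omega>. indicator (?A n) \<omega> * lyap Rp m (X t \<omega>) :: real"
    have [measurable]: "?A n \<in> sets M" for n by (rule stay_sets_M[OF t])
    have V: "(\<integral>\<^sup>+\<omega>. ?V n \<omega> \<partial>M) \<le> ennreal C" for n
    proof -
      define E where "E = exp (real (card Rp) * (m * real (Suc n) - m * ln (1 / real (Suc n))))"
      have bd: "norm (?V n \<omega>) \<le> norm E" for \<omega>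
      proof (cases "\<omega> \<in> ?A n")
        case True
        then have "X t \<omega> \<in> chamber_box Rp (1 / real (Suc n)) (real (Suc n))"
          using t by (auto simp: stay_def)
        then have "lyap Rp m (X t \<omega>) \<le> E"
          unfolding E_def using m by (intro lyap_box_bound fin_Rp) auto
        then show ?thesis using True lyap_pos[of Rp m "X t \<omega>"] by simp
      qed simp
      have int: "integrable M (?V n)"
      proof (rule Bochner_Integration.integrable_bound[of M "\<lambda>_. E"])
        show "?V n \<in> borel_measurable M" by measurable
      qed (use bd in auto)
      have "(\<integral>\<^sup>+\<omega>. ?V n \<omega> \<partial>M) = ennreal (expectation (?V n))"
        using lyap_pos[of Rp m] by (intro nn_integral_eq_integral[OF int] AE_I2) (simp add: less_imp_le)
      also have "\<dots> \<le> ennreal (exp (C0 * t) * lyap Rp m x0)"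
        using m C0 gen t by (intro ennreal_leI lyap_stopped_bound) auto
      also have "\<dots> \<le> ennreal C"
        unfolding C_def using t C0 lyap_pos[of Rp m x0]
        by (intro ennreal_leI mult_right_mono) (auto intro: mult_left_mono)
      finally show ?thesis .
    qed
    have "(\<integral>\<^sup>+\<omega>. lyap Rp m (X t \<omega>) \<partial>M) = (\<integral>\<^sup>+\<omega>. liminf (\<lambda>n. ennreal (?V n \<omega>)) \<partial>M)"
    proof (rule nn_integral_cong)
      fix \<omega> assume \<omega>: "\<omega> \<in> space M"
      have "\<forall>\<^sub>F n in sequentially. ennreal (?V n \<omega>) = ennreal (lyap Rp m (X t \<omega>))"
        using eventually_stay[OF \<omega> t] by eventually_elim simp
      then have "(\<lambda>n. ennreal (?V n \<omega>)) \<longlonglongrightarrow> ennreal (lyap Rp m (X t \<omega>))"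
        by (rule tendsto_eventually)
      then show "ennreal (lyap Rp m (X t \<omega>)) = liminf (\<lambda>n. ennreal (?V n \<omega>))"
        by (simp add: lim_imp_Liminf)
    qed
    also have "\<dots> \<le> liminf (\<lambda>n. \<integral>\<^sup>+\<omega>. ennreal (?V n \<omega>) \<partial>M)"
      by (intro nn_integral_liminf) measurable
    also have "\<dots> \<le> ennreal C"
      using V by (intro Liminf_le) auto
    finally show "(\<integral>\<^sup>+\<omega>. lyap Rp m (X t \<omega>) \<partial>M) \<le> ennreal C" .
  qed
qed

end

section \<open>Strong error of the scheme\<close>

lemma add_powr_le:
  fixes x y :: real
  assumes "0 \<le> x" "0 \<le> y" "1 \<le> p"
  shows "(x + y) powr p \<le> 2 powr (p - 1) * (x powr p + y powr p)"
  using sum_powr_le[of "{..<2::nat}" "\<lambda>i. if i = 0 then x else y" p] assms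
  by (simp add: eval_nat_numeral)

lemma cube_powr:
  fixes x :: real
  assumes "0 \<le> x"
  shows "(x ^ 3) powr p = x powr (3 * p)"
proof (cases "x = 0")
  case False
  then have "x ^ 3 = x powr 3" using assms by (simp add: powr_numeral)
  then show ?thesis by (simp add: powr_powr)
qed simp

text \<open>Both sides are compared with the cube of the maximum. Splitting an increment times two
  inverse pairings in this way is what requires moments of order \<open>3 * p\<close>.\<close>

lemma mult3_le_cubes:
  fixes x y z :: real
  assumes "0 \<le> x" "0 \<le> y" "0 \<le> z"
  shows "x * y * z \<le> x ^ 3 + y ^ 3 + z ^ 3"
proof -
  define w where "w = max x (max y z)"
  have "x \<le> w" "y \<le> w" "z \<le> w" by (auto simp: w_def)
  then have "x * y * z \<le> w * w * w" using assms by (intro mult_mono) auto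
  also have "\<dots> = w ^ 3" by (simp add: power3_eq_cube)
  also have "w ^ 3 \<le> x ^ 3 + y ^ 3 + z ^ 3"
    using assms zero_le_power[of x 3] zero_le_power[of y 3] zero_le_power[of z 3]
    unfolding w_def max_def by auto
  finally show ?thesis .
qed

lemma power_le_one_plus_cube:
  fixes x :: real
  assumes "0 \<le> x" "n \<le> 3"
  shows "x ^ n \<le> 1 + x ^ 3"
proof (cases "x \<le> 1")
  case True
  then show ?thesis using assms power_le_one[of x n] zero_le_power[of x 3] by linarith
next
  case False
  then have "x ^ n \<le> x ^ 3" using assms by (intro power_increasing) auto
  then show ?thesis by simp
qed

text \<open>A single scalar that dominates every inverse pairing in the chamber, which keeps the
  error estimates free of double sums over roots.\<close>

definition inv_sum :: "(real ^ 'd) set \<Rightarrow> real ^ 'd \<Rightarrow> real" where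
  "inv_sum Rp x = (\<Sum>\<alpha>\<in>Rp. 1 / (\<alpha> \<bullet> x))"

lemma inv_sum_nonneg: "x \<in> weyl_chamber Rp \<Longrightarrow> 0 \<le> inv_sum Rp x"
  unfolding inv_sum_def weyl_chamber_def by (intro sum_nonneg) (auto simp: less_imp_le)

lemma inverse_le_inv_sum:
  assumes "finite Rp" "x \<in> weyl_chamber Rp" "\<alpha> \<in> Rp"
  shows "1 / (\<alpha> \<bullet> x) \<le> inv_sum Rp x"
  unfolding inv_sum_def using assms
  by (intro member_le_sum[of \<alpha> Rp "\<lambda>\<alpha>. 1 / (\<alpha> \<bullet> x)"]) (auto simp: weyl_chamber_def less_imp_le)

lemma norm_dunkl_drift_le:
  assumes "finite Rp" "x \<in> weyl_chamber Rp"
  shows "norm (dunkl_drift Rp k x) \<le> (\<Sum>\<alpha>\<in>Rp. \<bar>k \<alpha>\<bar> * norm \<alpha>) * inv_sum Rp x"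
  unfolding dunkl_drift_def sum_distrib_right
proof (rule sum_norm_le)
  fix \<alpha> assume \<alpha>: "\<alpha> \<in> Rp"
  then have "\<alpha> \<bullet> x > 0" using assms by (auto simp: weyl_chamber_def)
  then show "norm ((k \<alpha> / (\<alpha> \<bullet> x)) *\<^sub>R \<alpha>) \<le> \<bar>k \<alpha>\<bar> * norm \<alpha> * inv_sum Rp x"
    using mult_left_mono[OF inverse_le_inv_sum[OF assms \<alpha>], of "\<bar>k \<alpha>\<bar> * norm \<alpha>"] by simp
qed

text \<open>The difference is split at \<open>trunc_inverse \<epsilon> u\<close>. Truncation acts
  only for \<open>u < \<epsilon>\<close>, where its error is at most \<open>1 / u\<close> and hence
  at most \<open>\<epsilon> * (1 / u)\<^sup>2\<close>. For the change of argument the maxima are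
  bounded below by \<open>u\<close> and \<open>v\<close>.\<close>

lemma trunc_inverse_error:
  assumes "\<epsilon> > 0" "u > 0" "v > 0"
  shows "\<bar>1 / u - trunc_inverse \<epsilon> v\<bar> \<le> \<epsilon> * (1 / u)\<^sup>2 + \<bar>u - v\<bar> * (1 / u) * (1 / v)"
proof -
  have "\<bar>1 / u - trunc_inverse \<epsilon> u\<bar> \<le> \<epsilon> * (1 / u)\<^sup>2"
  proof (cases "\<epsilon> \<le> u")
    case True
    then show ?thesis using assms by (simp add: trunc_inverse_def max_def)
  next
    case False
    then have "\<bar>1 / u - trunc_inverse \<epsilon> u\<bar> = 1 / u - 1 / \<epsilon>"
      using assms by (simp add: trunc_inverse_def max_def frac_le)
    also have "\<dots> \<le> 1 / u * 1" using assms by simp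
    also have "\<dots> \<le> 1 / u * (\<epsilon> / u)" using False assms by (intro mult_left_mono) auto
    finally show ?thesis by (simp add: power2_eq_square)
  qed
  moreover have "\<bar>trunc_inverse \<epsilon> u - trunc_inverse \<epsilon> v\<bar> \<le> \<bar>u - v\<bar> * (1 / u) * (1 / v)"
  proof -
    have "\<bar>trunc_inverse \<epsilon> u - trunc_inverse \<epsilon> v\<bar> \<le> \<bar>u - v\<bar> / (max u \<epsilon> * max v \<epsilon>)"
      by (rule trunc_inverse_diff[OF assms(1)])
    also have "\<dots> \<le> \<bar>u - v\<bar> / (u * v)"
      using assms by (intro frac_le mult_mono) auto
    finally show ?thesis by simp
  qed
  ultimately show ?thesis by linarith
qed

text \<open>In the application \<open>x\<close> is the value at an intermediate time and
  \<open>y\<close> the value at the right end of the step, where the implicit scheme evaluates its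
  drift.\<close>

lemma trunc_drift_error:
  assumes fin: "finite Rp" and x: "x \<in> weyl_chamber Rp" and y: "y \<in> weyl_chamber Rp" and \<epsilon>: "\<epsilon> > 0"
  shows "norm (dunkl_drift Rp k x - trunc_drift Rp k \<epsilon> y) \<le>
    (\<Sum>\<alpha>\<in>Rp. \<bar>k \<alpha>\<bar> * norm \<alpha> * (1 + norm \<alpha>)) *
    (\<epsilon> * (inv_sum Rp x)\<^sup>2 + norm (x - y) * inv_sum Rp x * inv_sum Rp y)"
  unfolding dunkl_drift_def trunc_drift_def sum_subtractf[symmetric] sum_distrib_right
proof (rule sum_norm_le)
  fix \<alpha> assume \<alpha>: "\<alpha> \<in> Rp"
  let ?U = "inv_sum Rp x" and ?V = "inv_sum Rp y"
  have pos: "\<alpha> \<bullet> x > 0" "\<alpha> \<bullet> y > 0" using \<alpha> x y by (auto simp: weyl_chamber_def)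
  note U = inverse_le_inv_sum[OF fin x \<alpha>] and V = inverse_le_inv_sum[OF fin y \<alpha>]
  have UV: "0 \<le> ?U" "0 \<le> ?V" using inv_sum_nonneg x y by auto
  have "\<bar>\<alpha> \<bullet> x - \<alpha> \<bullet> y\<bar> \<le> norm \<alpha> * norm (x - y)"
    using Cauchy_Schwarz_ineq2[of \<alpha> "x - y"] by (simp add: inner_diff_right)
  then have "\<bar>\<alpha> \<bullet> x - \<alpha> \<bullet> y\<bar> * (1 / (\<alpha> \<bullet> x)) * (1 / (\<alpha> \<bullet> y)) \<le> norm \<alpha> * norm (x - y) * ?U * ?V"
    using U V pos UV by (intro mult_mono) auto
  moreover have "\<epsilon> * (1 / (\<alpha> \<bullet> x))\<^sup>2 \<le> \<epsilon> * ?U\<^sup>2"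
    using U pos \<epsilon> by (intro mult_left_mono power_mono) auto
  moreover have "0 \<le> norm \<alpha> * (\<epsilon> * ?U\<^sup>2)" "0 \<le> norm (x - y) * ?U * ?V" using \<epsilon> UV by auto
  ultimately have "\<bar>1 / (\<alpha> \<bullet> x) - trunc_inverse \<epsilon> (\<alpha> \<bullet> y)\<bar> \<le>
      (1 + norm \<alpha>) * (\<epsilon> * ?U\<^sup>2 + norm (x - y) * ?U * ?V)"
    using trunc_inverse_error[OF \<epsilon> pos] by (simp add: algebra_simps)
  then have "\<bar>k \<alpha>\<bar> * norm \<alpha> * \<bar>1 / (\<alpha> \<bullet> x) - trunc_inverse \<epsilon> (\<alpha> \<bullet> y)\<bar> \<le>
      \<bar>k \<alpha>\<bar> * norm \<alpha> * ((1 + norm \<alpha>) * (\<epsilon> * ?U\<^sup>2 + norm (x - y) * ?U * ?V))"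
    by (intro mult_left_mono) auto
  moreover have "(k \<alpha> / (\<alpha> \<bullet> x)) *\<^sub>R \<alpha> - (k \<alpha> * trunc_inverse \<epsilon> (\<alpha> \<bullet> y)) *\<^sub>R \<alpha> =
      (k \<alpha> * (1 / (\<alpha> \<bullet> x) - trunc_inverse \<epsilon> (\<alpha> \<bullet> y))) *\<^sub>R \<alpha>"
    by (simp add: right_diff_distrib scaleR_diff_left)
  ultimately show "norm ((k \<alpha> / (\<alpha> \<bullet> x)) *\<^sub>R \<alpha> - (k \<alpha> * trunc_inverse \<epsilon> (\<alpha> \<bullet> y)) *\<^sub>R \<alpha>) \<le>
      \<bar>k \<alpha>\<bar> * norm \<alpha> * (1 + norm \<alpha>) * (\<epsilon> * ?U\<^sup>2 + norm (x - y) * ?U * ?V)"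
    by (simp only: norm_scaleR abs_mult mult_ac)
qed

section \<open>Moments of inverse pairings and of increments\<close>

context dunkl_sde
begin

lemma inv_sum_measurable: "t \<in> {0..T} \<Longrightarrow> (\<lambda>\<omega>. inv_sum Rp (X t \<omega>)) \<in> borel_measurable M"
  unfolding inv_sum_def using X_measurable[of t] by measurable

lemma inv_sum_continuous:
  "\<omega> \<in> space M \<Longrightarrow> continuous_on {0..T} (\<lambda>t. inv_sum Rp (X t \<omega>))"
  unfolding inv_sum_def using X_pos by (intro continuous_intros X_cont) force+

lemma inv_sum_moments:
  assumes q: "q \<ge> 1" "q + 1 < 2 * \<kappa>"
  shows "\<exists>C\<ge>0. \<forall>t\<in>{0..T}. (\<integral>\<^sup>+\<omega>. inv_sum Rp (X t \<omega>) powr q \<partial>M) \<le> ennreal C"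
proof -
  obtain C where C: "C \<ge> 0" "\<And>t. t \<in> {0..T} \<Longrightarrow> (\<integral>\<^sup>+\<omega>. lyap Rp q (X t \<omega>) \<partial>M) \<le> ennreal C"
    using lyap_moment_bound[of q] q by auto
  define N where "N = real (card Rp)"
  show ?thesis
  proof (intro exI[of _ "N powr (q - 1) * N * C"] conjI ballI)
    show "0 \<le> N powr (q - 1) * N * C" using C by (simp add: N_def)
    fix t assume t: "t \<in> {0..T}"
    note [measurable] = X_measurable[OF t]
    have "(\<integral>\<^sup>+\<omega>. inv_sum Rp (X t \<omega>) powr q \<partial>M) \<le> (\<integral>\<^sup>+\<omega>. ennreal (N powr (q - 1) * N) * ennreal (lyap Rp q (X t \<omega>)) \<partial>M)"
    proof (rule nn_integral_mono)
      fix \<omega> assume \<omega>: "\<omega> \<in> space M"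
      have "inv_sum Rp (X t \<omega>) powr q \<le> N powr (q - 1) * (\<Sum>\<alpha>\<in>Rp. (1 / (\<alpha> \<bullet> X t \<omega>)) powr q)"
        unfolding inv_sum_def N_def using X_pos[OF t \<omega>] q
        by (intro sum_powr_le fin_Rp) (auto simp: less_imp_le)
      also have "\<dots> \<le> N powr (q - 1) * (\<Sum>\<alpha>\<in>Rp. lyap Rp q (X t \<omega>))"
      proof (intro mult_left_mono sum_mono)
        fix \<alpha> assume \<alpha>: "\<alpha> \<in> Rp"
        have "(1 / (\<alpha> \<bullet> X t \<omega>)) powr q = (\<alpha> \<bullet> X t \<omega>) powr (- q)"
          using X_pos[OF t \<omega> \<alpha>] by (simp add: powr_divide powr_minus_divide)
        also have "\<dots> \<le> lyap Rp q (X t \<omega>)"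
          using q by (intro powr_le_lyap fin_Rp X_chamber t \<omega> \<alpha>) auto
        finally show "(1 / (\<alpha> \<bullet> X t \<omega>)) powr q \<le> lyap Rp q (X t \<omega>)" .
      qed simp
      finally have "inv_sum Rp (X t \<omega>) powr q \<le> N powr (q - 1) * N * lyap Rp q (X t \<omega>)"
        by (simp add: N_def mult.assoc)
      then show "ennreal (inv_sum Rp (X t \<omega>) powr q) \<le> ennreal (N powr (q - 1) * N) * ennreal (lyap Rp q (X t \<omega>))"
        by (simp add: ennreal_mult'[symmetric] N_def ennreal_leI)
    qed
    also have "\<dots> = ennreal (N powr (q - 1) * N) * (\<integral>\<^sup>+\<omega>. lyap Rp q (X t \<omega>) \<partial>M)"
      by (intro nn_integral_cmult) measurable
    also have "\<dots> \<le> ennreal (N powr (q - 1) * N) * ennreal C"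
      by (intro mult_left_mono C(2) t) auto
    also have "\<dots> = ennreal (N powr (q - 1) * N * C)"
      by (rule ennreal_mult[symmetric]) (use C in \<open>auto simp: N_def\<close>)
    finally show "(\<integral>\<^sup>+\<omega>. inv_sum Rp (X t \<omega>) powr q \<partial>M) \<le> ennreal (N powr (q - 1) * N * C)" .
  qed
qed

text \<open>The Brownian part has size \<open>sqrt (t - s)\<close>. The drift is dominated by
  inverse pairings with bounded moments, so its integral has size \<open>t - s\<close>, which is at
  most \<open>sqrt T * sqrt (t - s)\<close>.\<close>

lemma X_increment_moments:
  assumes q: "q \<ge> 1" "q + 1 < 2 * \<kappa>"
  shows "\<exists>C\<ge>0. \<forall>s t. 0 \<le> s \<longrightarrow> s \<le> t \<longrightarrow> t \<le> T \<longrightarrow>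
    (\<integral>\<^sup>+\<omega>. ennreal (norm (X t \<omega> - X s \<omega>) powr q) \<partial>M) \<le> ennreal (C * sqrt (t - s) powr q)"
proof -
  obtain Ci where Ci: "Ci \<ge> 0" "\<And>t. t \<in> {0..T} \<Longrightarrow> (\<integral>\<^sup>+\<omega>. inv_sum Rp (X t \<omega>) powr q \<partial>M) \<le> ennreal Ci"
    using inv_sum_moments[OF q] by blast
  obtain Cb where Cb: "Cb \<ge> 0" "\<And>s t. 0 \<le> s \<Longrightarrow> s \<le> t \<Longrightarrow> t \<le> T \<Longrightarrow>
    (\<integral>\<^sup>+\<omega>. ennreal (norm (B t \<omega> - B s \<omega>) powr q) \<partial>M) \<le> ennreal (Cb * sqrt (t - s) powr q)"
    using B_increment_moments[OF q(1)] by blast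
  define K where "K = (\<Sum>\<alpha>\<in>Rp. \<bar>k \<alpha>\<bar> * norm \<alpha>)"
  have K: "K \<ge> 0" unfolding K_def by (intro sum_nonneg) auto
  define P where "P = (2::real) powr (q - 1)"
  have P: "P \<ge> 0" by (simp add: P_def)
  define Cv where "Cv = P * (K powr q * Ci + \<beta> powr q)"
  have Cv: "Cv \<ge> 0" using P Ci by (simp add: Cv_def)
  define C where "C = P * (Cb + sqrt T powr q * Cv)"
  show ?thesis
  proof (intro exI[of _ C] conjI allI impI)
    show "0 \<le> C" using P Cb Cv by (simp add: C_def)
    fix s t assume s: "0 \<le> s" and st: "s \<le> t" and t: "t \<le> T"
    define v where "v r \<omega> = K * inv_sum Rp (X r \<omega>) + \<beta>" for r \<omega>
    have sub: "{s..t} \<subseteq> {0..T}" using s t by auto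
    have v_nn: "0 \<le> v r \<omega>" if "r \<in> {s..t}" "\<omega> \<in> space M" for r \<omega>
      unfolding v_def using K \<beta>_nonneg inv_sum_nonneg[OF X_chamber[of r \<omega>]] that sub by auto
    have vc: "continuous_on {s..t} (\<lambda>r. v r \<omega>)" if "\<omega> \<in> space M" for \<omega>
      unfolding v_def by (intro continuous_intros continuous_on_subset[OF inv_sum_continuous[OF that] sub])
    have vpc: "continuous_on {s..t} (\<lambda>r. v r \<omega> powr q)" if "\<omega> \<in> space M" for \<omega>
      by (rule continuous_on_powr'[OF vc[OF that]]) (use v_nn[OF _ that] q in auto)
    have vm: "(\<lambda>\<omega>. v r \<omega> powr q) \<in> borel_measurable M" if "r \<in> {s..t}" for r
      unfolding v_def using inv_sum_measurable[of r] that sub by auto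
    have vmom: "(\<integral>\<^sup>+\<omega>. v r \<omega> powr q \<partial>M) \<le> ennreal Cv" if r: "r \<in> {s..t}" for r
    proof -
      have r': "r \<in> {0..T}" using r sub by auto
      note [measurable] = inv_sum_measurable[OF r']
      have "(\<integral>\<^sup>+\<omega>. v r \<omega> powr q \<partial>M) \<le> (\<integral>\<^sup>+\<omega>. ennreal (P * K powr q) * ennreal (inv_sum Rp (X r \<omega>) powr q)
          + ennreal (P * \<beta> powr q) \<partial>M)"
      proof (rule nn_integral_mono)
        fix \<omega> assume \<omega>: "\<omega> \<in> space M"
        have i: "0 \<le> inv_sum Rp (X r \<omega>)" by (intro inv_sum_nonneg X_chamber r' \<omega>)
        have "v r \<omega> powr q \<le> P * ((K * inv_sum Rp (X r \<omega>)) powr q + \<beta> powr q)"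
          unfolding v_def P_def using i K \<beta>_nonneg q by (intro add_powr_le) auto
        also have "\<dots> = P * K powr q * inv_sum Rp (X r \<omega>) powr q + P * \<beta> powr q"
          using i K by (simp add: powr_mult algebra_simps)
        finally show "ennreal (v r \<omega> powr q) \<le> ennreal (P * K powr q) * ennreal (inv_sum Rp (X r \<omega>) powr q)
            + ennreal (P * \<beta> powr q)"
          using P by (simp add: ennreal_mult'[symmetric] ennreal_plus[symmetric] ennreal_leI del: ennreal_plus)
      qed
      also have "\<dots> = ennreal (P * K powr q) * (\<integral>\<^sup>+\<omega>. ennreal (inv_sum Rp (X r \<omega>) powr q) \<partial>M) + ennreal (P * \<beta> powr q)"
        by (simp add: nn_integral_add nn_integral_cmult emeasure_space_1)
      also have "\<dots> \<le> ennreal (P * K powr q) * ennreal Ci + ennreal (P * \<beta> powr q)"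
        by (intro add_mono mult_left_mono Ci(2) r') auto
      also have "\<dots> = ennreal Cv"
        using P Ci by (simp add: Cv_def ennreal_mult[symmetric] ennreal_plus[symmetric] algebra_simps del: ennreal_plus)
      finally show ?thesis .
    qed
    define I where "I \<omega> = integral {s..t} (\<lambda>r. v r \<omega> powr q)" for \<omega>
    have I_meas: "I \<in> borel_measurable M"
      unfolding I_def[abs_def] by (rule borel_measurable_time_integral[OF st vpc vm])
    have I_le: "(\<integral>\<^sup>+\<omega>. I \<omega> \<partial>M) \<le> ennreal ((t - s) * Cv)"
      unfolding I_def by (rule nn_integral_time_integral_le[OF st vpc vm _ vmom]) auto
    have I_nn: "0 \<le> I \<omega>" if "\<omega> \<in> space M" for \<omega>
      unfolding I_def using vpc[OF that] by (intro integral_nonneg integrable_continuous_real) auto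
    note [measurable] = I_meas B_increment_measurable[OF s st t]
    have "(\<integral>\<^sup>+\<omega>. ennreal (norm (X t \<omega> - X s \<omega>) powr q) \<partial>M) \<le>
        (\<integral>\<^sup>+\<omega>. ennreal P * ennreal (norm (B t \<omega> - B s \<omega>) powr q)
          + ennreal (P * (t - s) powr (q - 1)) * ennreal (I \<omega>) \<partial>M)"
    proof (rule nn_integral_mono)
      fix \<omega> assume \<omega>: "\<omega> \<in> space M"
      let ?d = "\<lambda>r. dunkl_drift Rp k (X r \<omega>) + b r (X r \<omega>)"
      have dc: "continuous_on {s..t} ?d"
        by (intro continuous_intros continuous_on_subset[OF drift_path_continuous[OF \<omega>] sub]
            continuous_on_subset[OF b_path_continuous[OF \<omega>] sub])
      have "X t \<omega> - X s \<omega> = (B t \<omega> - B s \<omega>) + integral {s..t} ?d"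
        using X_eq[OF s st t \<omega>] by simp
      then have "norm (X t \<omega> - X s \<omega>) \<le> norm (B t \<omega> - B s \<omega>) + norm (integral {s..t} ?d)"
        by (simp add: norm_triangle_ineq)
      also have "norm (integral {s..t} ?d) \<le> integral {s..t} (\<lambda>r. v r \<omega>)"
      proof (rule integral_norm_bound_integral)
        fix r assume r: "r \<in> {s..t}"
        then have r': "r \<in> {0..T}" using sub by auto
        show "norm (?d r) \<le> v r \<omega>"
          unfolding v_def K_def
          by (intro norm_triangle_mono norm_dunkl_drift_le fin_Rp X_chamber r' \<omega> b_bound)
      qed (use dc vc[OF \<omega>] in \<open>auto intro: integrable_continuous_real\<close>)
      finally have "norm (X t \<omega> - X s \<omega>) powr q \<le> (norm (B t \<omega> - B s \<omega>) + integral {s..t} (\<lambda>r. v r \<omega>)) powr q"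
        using q by (intro powr_mono2) auto
      also have "\<dots> \<le> P * (norm (B t \<omega> - B s \<omega>) powr q + integral {s..t} (\<lambda>r. v r \<omega>) powr q)"
        unfolding P_def using v_nn[OF _ \<omega>] vc[OF \<omega>] q
        by (intro add_powr_le integral_nonneg integrable_continuous_real) auto
      also have "\<dots> \<le> P * (norm (B t \<omega> - B s \<omega>) powr q + (t - s) powr (q - 1) * I \<omega>)"
        unfolding I_def
        by (intro mult_left_mono add_left_mono integral_powr_le st vc \<omega> v_nn q P)
      finally show "ennreal (norm (X t \<omega> - X s \<omega>) powr q) \<le> ennreal P * ennreal (norm (B t \<omega> - B s \<omega>) powr q)
          + ennreal (P * (t - s) powr (q - 1)) * ennreal (I \<omega>)"
        using P I_nn[OF \<omega>]
        by (simp add: ennreal_mult[symmetric] ennreal_plus[symmetric] ennreal_leI algebra_simps del: ennreal_plus)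
    qed
    also have "\<dots> = ennreal P * (\<integral>\<^sup>+\<omega>. ennreal (norm (B t \<omega> - B s \<omega>) powr q) \<partial>M)
          + ennreal (P * (t - s) powr (q - 1)) * (\<integral>\<^sup>+\<omega>. I \<omega> \<partial>M)"
      by (simp add: nn_integral_add nn_integral_cmult)
    also have "\<dots> \<le> ennreal P * ennreal (Cb * sqrt (t - s) powr q)
          + ennreal (P * (t - s) powr (q - 1)) * ennreal ((t - s) * Cv)"
      by (intro add_mono mult_left_mono Cb(2) I_le s st t) auto
    also have "\<dots> = ennreal (P * (Cb * sqrt (t - s) powr q) + P * (t - s) powr (q - 1) * ((t - s) * Cv))"
      using P Cb Cv st
      by (simp add: ennreal_mult[symmetric] ennreal_plus[symmetric] del: ennreal_plus)
    also have "\<dots> \<le> ennreal (C * sqrt (t - s) powr q)"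
    proof (rule ennreal_leI)
      have "(t - s) powr (q - 1) * (t - s) = (t - s) powr q"
        using st q by (cases "s = t") (auto simp: powr_mult_base mult.commute)
      also have "\<dots> = sqrt (t - s) powr q * sqrt (t - s) powr q"
        using st by (simp add: powr_mult[symmetric])
      also have "\<dots> \<le> sqrt T powr q * sqrt (t - s) powr q"
        using s st t q by (intro mult_right_mono powr_mono2) auto
      finally have "(t - s) powr (q - 1) * (t - s) * (P * Cv) \<le> sqrt T powr q * sqrt (t - s) powr q * (P * Cv)"
        using P Cv by (intro mult_right_mono) auto
      then show "P * (Cb * sqrt (t - s) powr q) + P * (t - s) powr (q - 1) * ((t - s) * Cv) \<le> C * sqrt (t - s) powr q"
        unfolding C_def by (simp add: algebra_simps)
    qed
    finally show "(\<integral>\<^sup>+\<omega>. ennreal (norm (X t \<omega> - X s \<omega>) powr q) \<partial>M) \<le> ennreal (C * sqrt (t - s) powr q)" .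
  qed
qed

end

section \<open>The residuals of the exact solution in the scheme\<close>

context dunkl_sde
begin

lemma grid_in: "l \<le> n \<Longrightarrow> grid T n l \<in> {0..T}"
proof (cases "n = 0")
  case False
  assume "l \<le> n"
  then have "real l * T \<le> real n * T" using T by (intro mult_right_mono) auto
  then show ?thesis using T False by (simp add: grid_def pos_divide_le_eq mult.commute)
qed (use T in \<open>simp add: grid_def\<close>)

text \<open>One random variable \<open>S\<close> dominates the errors at all grid points, so the
  maximum over the grid needs no separate estimate. \<open>S\<close> may depend on \<open>n\<close>
  and \<open>\<epsilon>\<close>, while \<open>C\<close> may not.\<close>

lemma scheme_error_bound:
  assumes p: "p \<ge> 1" "3 * p + 1 < 2 * \<kappa>"
  shows "\<exists>C\<ge>0. \<forall>n \<epsilon>. 1 \<le> n \<longrightarrow> 0 < \<epsilon> \<longrightarrow> T / real n * trunc_const Rp k < \<epsilon>\<^sup>2 \<longrightarrow>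
    (\<exists>S. S \<in> borel_measurable M \<and> (\<forall>\<omega>\<in>space M. 0 \<le> S \<omega>) \<and>
      (\<forall>\<omega>\<in>space M. \<forall>l\<le>n. norm (X (grid T n l) \<omega> - em_scheme Rp k b T x0 \<epsilon> n (\<lambda>t. B t \<omega>) l)
        \<le> (\<epsilon> + sqrt (T / real n)) * S \<omega>) \<and>
      (\<integral>\<^sup>+\<omega>. S \<omega> powr p \<partial>M) \<le> ennreal C)"
proof -
  define q where "q = 3 * p"
  have q: "q \<ge> 1" "q + 1 < 2 * \<kappa>" using p by (auto simp: q_def)
  obtain Ci where Ci: "Ci \<ge> 0" "\<And>t. t \<in> {0..T} \<Longrightarrow> (\<integral>\<^sup>+\<omega>. inv_sum Rp (X t \<omega>) powr q \<partial>M) \<le> ennreal Ci"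
    using inv_sum_moments[OF q] by blast
  obtain Cx where Cx: "Cx \<ge> 0" "\<And>s t. 0 \<le> s \<Longrightarrow> s \<le> t \<Longrightarrow> t \<le> T \<Longrightarrow>
    (\<integral>\<^sup>+\<omega>. ennreal (norm (X t \<omega> - X s \<omega>) powr q) \<partial>M) \<le> ennreal (Cx * sqrt (t - s) powr q)"
    using X_increment_moments[OF q] by blast
  define K1 where "K1 = (\<Sum>\<alpha>\<in>Rp. \<bar>k \<alpha>\<bar> * norm \<alpha> * (1 + norm \<alpha>))"
  have K1: "K1 \<ge> 0" unfolding K1_def by (intro sum_nonneg) auto
  \<comment> \<open>The exponential comes from the stability estimate. \<open>2 * K1\<close>
    accounts for the two parts of the drift error, \<open>Lb\<close> and \<open>Hb\<close> for the
    variation of \<open>b\<close> in space and in time.\<close>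
  define K3 where "K3 = exp (Lb * T) * (2 * K1 + Lb + Hb)"
  have K3: "K3 \<ge> 0" using K1 Lb_nonneg Hb_nonneg by (simp add: K3_def)
  \<comment> \<open>Five is the number of summands of \<open>H\<close> below, and \<open>P\<close>
    is the resulting power mean constant.\<close>
  define P where "P = (5::real) powr (p - 1)"
  define CH where "CH = P * (1 + Ci + Ci + Cx + Cx)"
  have P: "P \<ge> 0" by (simp add: P_def)
  have CH: "CH \<ge> 0" using P Ci Cx by (simp add: CH_def)
  show ?thesis
  proof (intro exI[of _ "K3 powr p * (T powr p * CH)"] conjI allI impI)
    show "0 \<le> K3 powr p * (T powr p * CH)" using CH by simp
    fix n :: nat and \<epsilon> :: real
    assume n: "1 \<le> n" and \<epsilon>: "0 < \<epsilon>" and cfl: "T / real n * trunc_const Rp k < \<epsilon>\<^sup>2"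
    define h where "h = T / real n"
    define t where "t l = grid T n l" for l
    have h: "h > 0" "real n * h = T" using T n by (auto simp: h_def)
    have t_eq: "t l = real l * h" for l by (simp add: t_def grid_def h_def)
    have t_Suc: "t (Suc l) = t l + h" for l by (simp add: t_eq algebra_simps)
    have tT: "t l \<in> {0..T}" if "l \<le> n" for l unfolding t_def by (rule grid_in[OF that])
    have sub: "{t l..t (Suc l)} \<subseteq> {0..T}" if "l < n" for l
      using tT[of l] tT[of "Suc l"] that by auto
    define U where "U s \<omega> = inv_sum Rp (X s \<omega>)" for s \<omega>
    \<comment> \<open>Up to constants, this dominates every term of the residual: products are split
      into cubes, and the \<open>1\<close> absorbs lower powers. Increments are divided by
      \<open>sqrt h\<close>, so that their moments are bounded uniformly in
      \<open>n\<close>.\<close>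
    define H where "H l s \<omega> = 1 + U s \<omega> ^ 3 + U (t (Suc l)) \<omega> ^ 3
      + (norm (X s \<omega> - X (t (Suc l)) \<omega>) / sqrt h) ^ 3 + (norm (X s \<omega> - X (t l) \<omega>) / sqrt h) ^ 3" for l s \<omega>
    have U_nn: "0 \<le> U s \<omega>" if "s \<in> {0..T}" "\<omega> \<in> space M" for s \<omega>
      unfolding U_def by (intro inv_sum_nonneg X_chamber that)
    have U_meas: "U s \<in> borel_measurable M" if "s \<in> {0..T}" for s
      unfolding U_def[abs_def] by (rule inv_sum_measurable[OF that])
    have H_nn: "1 \<le> H l s \<omega>" if "l < n" "s \<in> {t l..t (Suc l)}" "\<omega> \<in> space M" for l s \<omega>
      unfolding H_def using U_nn[of s \<omega>] U_nn[of "t (Suc l)" \<omega>] sub[OF that(1)] tT[of "Suc l"] that h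
      by auto
    have H_cont: "continuous_on {t l..t (Suc l)} (\<lambda>s. H l s \<omega>)" if "l < n" "\<omega> \<in> space M" for l \<omega>
      unfolding H_def U_def using h
      by (intro continuous_intros continuous_on_subset[OF inv_sum_continuous[OF that(2)] sub[OF that(1)]]
          continuous_on_subset[OF X_cont[OF that(2)] sub[OF that(1)]]) auto
    have H_meas: "H l s \<in> borel_measurable M" if "l < n" "s \<in> {t l..t (Suc l)}" for l s
    proof -
      have "s \<in> {0..T}" "t l \<in> {0..T}" "t (Suc l) \<in> {0..T}"
        using sub[OF that(1)] that tT[of l] tT[of "Suc l"] by auto
      note [measurable] = this[THEN X_measurable] this[THEN U_meas]
      show ?thesis unfolding H_def[abs_def] by measurable
    qed
    have Xmom: "(\<integral>\<^sup>+\<omega>. ennreal ((norm (X r \<omega> - X s \<omega>) / sqrt h) powr q) \<partial>M) \<le> ennreal Cx"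
      if "s \<in> {0..T}" "r \<in> {0..T}" "\<bar>r - s\<bar> \<le> h" for s r
    proof -
      note [measurable] = that(1,2)[THEN X_measurable]
      have *: "(\<integral>\<^sup>+\<omega>. ennreal (norm (X r \<omega> - X s \<omega>) powr q) \<partial>M) \<le> ennreal (Cx * sqrt \<bar>r - s\<bar> powr q)"
        using Cx(2)[of s r] Cx(2)[of r s] that by (cases "s \<le> r") (auto simp: norm_minus_commute)
      have "(\<integral>\<^sup>+\<omega>. ennreal ((norm (X r \<omega> - X s \<omega>) / sqrt h) powr q) \<partial>M) =
          (\<integral>\<^sup>+\<omega>. ennreal (1 / sqrt h powr q) * ennreal (norm (X r \<omega> - X s \<omega>) powr q) \<partial>M)"
        using h by (intro nn_integral_cong) (simp add: powr_divide ennreal_mult[symmetric])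
      also have "\<dots> = ennreal (1 / sqrt h powr q) * (\<integral>\<^sup>+\<omega>. ennreal (norm (X r \<omega> - X s \<omega>) powr q) \<partial>M)"
        by (intro nn_integral_cmult) measurable
      also have "\<dots> \<le> ennreal (1 / sqrt h powr q) * ennreal (Cx * sqrt h powr q)"
      proof (rule mult_left_mono, rule order_trans[OF *], rule ennreal_leI)
        show "Cx * sqrt \<bar>r - s\<bar> powr q \<le> Cx * sqrt h powr q"
          using that Cx q by (intro mult_left_mono powr_mono2) auto
      qed simp
      also have "\<dots> = ennreal Cx" using h Cx by (simp add: ennreal_mult[symmetric])
      finally show ?thesis .
    qed
    have H_mom: "(\<integral>\<^sup>+\<omega>. H l s \<omega> powr p \<partial>M) \<le> ennreal CH" if l: "l < n" and s: "s \<in> {t l..t (Suc l)}" for l s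
    proof -
      have sT: "s \<in> {0..T}" and tl: "t l \<in> {0..T}" "t (Suc l) \<in> {0..T}"
        using sub[OF l] s l tT[of l] tT[of "Suc l"] by auto
      note [measurable] = sT[THEN X_measurable] tl[THEN X_measurable] sT[THEN U_meas] tl[THEN U_meas]
      \<comment> \<open>The five summands of \<open>H\<close> as an indexed family, the form needed
        for \<open>sum_powr_le\<close>.\<close>
      define x where "x = (\<lambda>i \<omega>. [1, U s \<omega> ^ 3, U (t (Suc l)) \<omega> ^ 3,
        (norm (X s \<omega> - X (t (Suc l)) \<omega>) / sqrt h) ^ 3, (norm (X s \<omega> - X (t l) \<omega>) / sqrt h) ^ 3] ! i)"
      have five: "(\<Sum>i<5. g i) = g 0 + g 1 + g 2 + g 3 + g 4" for g :: "nat \<Rightarrow> real"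
        by (simp add: eval_nat_numeral)
      have "(\<integral>\<^sup>+\<omega>. H l s \<omega> powr p \<partial>M) \<le> (\<integral>\<^sup>+\<omega>. ennreal P * (1 + ennreal (U s \<omega> powr q) + ennreal (U (t (Suc l)) \<omega> powr q)
          + ennreal ((norm (X s \<omega> - X (t (Suc l)) \<omega>) / sqrt h) powr q)
          + ennreal ((norm (X s \<omega> - X (t l) \<omega>) / sqrt h) powr q)) \<partial>M)"
      proof (rule nn_integral_mono)
        fix \<omega> assume \<omega>: "\<omega> \<in> space M"
        have nn: "0 \<le> U s \<omega>" "0 \<le> U (t (Suc l)) \<omega>" using U_nn \<omega> sT tl by auto
        have "H l s \<omega> = (\<Sum>i<5. x i \<omega>)" unfolding five by (simp add: H_def x_def)
        moreover have "(\<Sum>i<5. x i \<omega>) powr p \<le> real (card {..<5::nat}) powr (p - 1) * (\<Sum>i<5. x i \<omega> powr p)"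
        proof (rule sum_powr_le)
          fix i :: nat assume "i \<in> {..<5}"
          then have "i = 0 \<or> i = 1 \<or> i = 2 \<or> i = 3 \<or> i = 4" by auto
          then show "0 \<le> x i \<omega>" using nn h by (auto simp: x_def)
        qed (use p in auto)
        moreover have "(\<Sum>i<5. x i \<omega> powr p) = 1 + U s \<omega> powr q + U (t (Suc l)) \<omega> powr q
          + (norm (X s \<omega> - X (t (Suc l)) \<omega>) / sqrt h) powr q
          + (norm (X s \<omega> - X (t l) \<omega>) / sqrt h) powr q"
          unfolding five q_def using nn h by (simp add: x_def cube_powr)
        ultimately have "H l s \<omega> powr p \<le> P * (1 + U s \<omega> powr q + U (t (Suc l)) \<omega> powr q
          + (norm (X s \<omega> - X (t (Suc l)) \<omega>) / sqrt h) powr q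
          + (norm (X s \<omega> - X (t l) \<omega>) / sqrt h) powr q)" by (simp add: P_def)
        then show "ennreal (H l s \<omega> powr p) \<le> ennreal P * (1 + ennreal (U s \<omega> powr q) + ennreal (U (t (Suc l)) \<omega> powr q)
          + ennreal ((norm (X s \<omega> - X (t (Suc l)) \<omega>) / sqrt h) powr q)
          + ennreal ((norm (X s \<omega> - X (t l) \<omega>) / sqrt h) powr q))"
          using P by (simp add: ennreal_mult[symmetric] ennreal_plus[symmetric] ennreal_1[symmetric] ennreal_leI
              del: ennreal_plus ennreal_1)
      qed
      also have "\<dots> = ennreal P * (1 + (\<integral>\<^sup>+\<omega>. U s \<omega> powr q \<partial>M) + (\<integral>\<^sup>+\<omega>. U (t (Suc l)) \<omega> powr q \<partial>M)
          + (\<integral>\<^sup>+\<omega>. (norm (X s \<omega> - X (t (Suc l)) \<omega>) / sqrt h) powr q \<partial>M)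
          + (\<integral>\<^sup>+\<omega>. (norm (X s \<omega> - X (t l) \<omega>) / sqrt h) powr q \<partial>M))"
        by (simp add: nn_integral_cmult nn_integral_add emeasure_space_1)
      also have "\<dots> \<le> ennreal P * (1 + ennreal Ci + ennreal Ci + ennreal Cx + ennreal Cx)"
      proof (intro mult_left_mono add_mono order_refl)
        show "(\<integral>\<^sup>+\<omega>. U s \<omega> powr q \<partial>M) \<le> ennreal Ci" unfolding U_def by (rule Ci(2)[OF sT])
        show "(\<integral>\<^sup>+\<omega>. U (t (Suc l)) \<omega> powr q \<partial>M) \<le> ennreal Ci" unfolding U_def by (rule Ci(2)[OF tl(2)])
        show "(\<integral>\<^sup>+\<omega>. (norm (X s \<omega> - X (t (Suc l)) \<omega>) / sqrt h) powr q \<partial>M) \<le> ennreal Cx"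
          using s t_Suc[of l] by (intro Xmom sT tl) auto
        show "(\<integral>\<^sup>+\<omega>. (norm (X s \<omega> - X (t l) \<omega>) / sqrt h) powr q \<partial>M) \<le> ennreal Cx"
          using s t_Suc[of l] by (intro Xmom sT tl) auto
      qed simp
      also have "\<dots> = ennreal CH"
        using P Ci Cx by (simp add: CH_def ennreal_mult[symmetric] ennreal_plus[symmetric]
            ennreal_1[symmetric] del: ennreal_plus ennreal_1)
      finally show ?thesis .
    qed
    define S where "S \<omega> = (\<Sum>l<n. integral {t l..t (Suc l)} (\<lambda>s. H l s \<omega>))" for \<omega>
    have le: "t l \<le> t (Suc l)" for l using h by (simp add: t_Suc)
    have I_meas: "(\<lambda>\<omega>. integral {t l..t (Suc l)} (\<lambda>s. H l s \<omega>)) \<in> borel_measurable M" if "l < n" for l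
      by (rule borel_measurable_time_integral[OF le H_cont[OF that] H_meas[OF that]])
    have I_nn: "0 \<le> integral {t l..t (Suc l)} (\<lambda>s. H l s \<omega>)" if "l < n" "\<omega> \<in> space M" for l \<omega>
      using H_cont[OF that] H_nn[OF that(1) _ that(2)]
      by (intro integral_nonneg integrable_continuous_real) force+
    have S_meas: "S \<in> borel_measurable M"
      unfolding S_def[abs_def] by (intro borel_measurable_sum I_meas) simp
    have S_nn: "0 \<le> S \<omega>" if "\<omega> \<in> space M" for \<omega>
      unfolding S_def using I_nn that by (intro sum_nonneg) auto
    have Hp_cont: "continuous_on {t l..t (Suc l)} (\<lambda>s. H l s \<omega> powr p)" if "l < n" "\<omega> \<in> space M" for l \<omega>
      by (rule continuous_on_powr'[OF H_cont[OF that]]) (use H_nn[OF that(1) _ that(2)] p in force)+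
    have Hp_meas: "(\<lambda>\<omega>. H l s \<omega> powr p) \<in> borel_measurable M" if "l < n" "s \<in> {t l..t (Suc l)}" for l s
      using H_meas[OF that] by measurable
    define J where "J l \<omega> = integral {t l..t (Suc l)} (\<lambda>s. H l s \<omega> powr p)" for l \<omega>
    have J_meas: "J l \<in> borel_measurable M" if "l < n" for l
      unfolding J_def[abs_def]
      by (rule borel_measurable_time_integral[OF le Hp_cont[OF that] Hp_meas[OF that]])
    have J_le: "(\<integral>\<^sup>+\<omega>. J l \<omega> \<partial>M) \<le> ennreal (h * CH)" if "l < n" for l
    proof -
      have "(\<integral>\<^sup>+\<omega>. J l \<omega> \<partial>M) \<le> ennreal ((t (Suc l) - t l) * CH)"
        unfolding J_def
        by (rule nn_integral_time_integral_le[OF le Hp_cont[OF that] Hp_meas[OF that] _ H_mom[OF that]]) auto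
      then show ?thesis by (simp add: t_Suc)
    qed
    have J_nn: "0 \<le> J l \<omega>" if "l < n" "\<omega> \<in> space M" for l \<omega>
      unfolding J_def using Hp_cont[OF that] by (intro integral_nonneg integrable_continuous_real) auto
    \<comment> \<open>The power mean inequality is used over the steps and within each step. The
      factors \<open>real n powr (p - 1)\<close> and \<open>h powr (p - 1)\<close> combine to
      \<open>T powr (p - 1)\<close>, which removes \<open>n\<close>.\<close>
    have Sp: "(\<integral>\<^sup>+\<omega>. S \<omega> powr p \<partial>M) \<le> ennreal (T powr p * CH)"
    proof -
      have "(\<integral>\<^sup>+\<omega>. S \<omega> powr p \<partial>M) \<le> (\<integral>\<^sup>+\<omega>. ennreal (T powr (p - 1)) * (\<Sum>l<n. ennreal (J l \<omega>)) \<partial>M)"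
      proof (rule nn_integral_mono)
        fix \<omega> assume \<omega>: "\<omega> \<in> space M"
        have "S \<omega> powr p \<le> real (card {..<n}) powr (p - 1) *
            (\<Sum>l<n. integral {t l..t (Suc l)} (\<lambda>s. H l s \<omega>) powr p)"
          unfolding S_def using I_nn[OF _ \<omega>] p by (intro sum_powr_le) auto
        also have "\<dots> \<le> real n powr (p - 1) * (\<Sum>l<n. h powr (p - 1) * J l \<omega>)"
        proof (simp only: card_lessThan, intro mult_left_mono sum_mono)
          fix l assume "l \<in> {..<n}"
          then have l: "l < n" by simp
          have "integral {t l..t (Suc l)} (\<lambda>s. H l s \<omega>) powr p \<le> (t (Suc l) - t l) powr (p - 1) * J l \<omega>"
            unfolding J_def using H_nn[OF l _ \<omega>] p by (intro integral_powr_le le H_cont l \<omega>) force+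
          then show "integral {t l..t (Suc l)} (\<lambda>s. H l s \<omega>) powr p \<le> h powr (p - 1) * J l \<omega>"
            by (simp add: t_Suc)
        qed simp
        also have "\<dots> = T powr (p - 1) * (\<Sum>l<n. J l \<omega>)"
          using h by (simp add: sum_distrib_left[symmetric] powr_mult[symmetric] flip: mult.assoc)
        finally have "S \<omega> powr p \<le> T powr (p - 1) * (\<Sum>l<n. J l \<omega>)" .
        moreover have "ennreal (T powr (p - 1)) * (\<Sum>l<n. ennreal (J l \<omega>)) = ennreal (T powr (p - 1) * (\<Sum>l<n. J l \<omega>))"
          using J_nn[OF _ \<omega>] by (subst sum_ennreal) (auto simp: ennreal_mult' sum_nonneg)
        ultimately show "ennreal (S \<omega> powr p) \<le> ennreal (T powr (p - 1)) * (\<Sum>l<n. ennreal (J l \<omega>))"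
          by (simp add: ennreal_leI)
      qed
      also have "\<dots> = ennreal (T powr (p - 1)) * (\<Sum>l<n. \<integral>\<^sup>+\<omega>. J l \<omega> \<partial>M)"
        using J_meas by (subst nn_integral_cmult, (auto; fail), subst nn_integral_sum) auto
      also have "\<dots> \<le> ennreal (T powr (p - 1)) * (\<Sum>l<n. ennreal (h * CH))"
        using J_le by (intro mult_left_mono sum_mono) auto
      also have "\<dots> = ennreal (T powr (p - 1)) * ennreal (T * CH)"
        using h CH by (simp add: ennreal_of_nat_eq_real_of_nat ennreal_mult[symmetric] mult.assoc[symmetric])
      also have "\<dots> = ennreal (T powr (p - 1) * (T * CH))"
        using T CH by (simp add: ennreal_mult)
      also have "T powr (p - 1) * (T * CH) = T powr p * CH"
        using T powr_mult_base[of T "p - 1"] by (simp add: mult_ac)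
      finally show ?thesis .
    qed
    have resid: "norm (X (t l) \<omega> - em_scheme Rp k b T x0 \<epsilon> n (\<lambda>t. B t \<omega>) l) \<le> (\<epsilon> + sqrt h) * (K3 * S \<omega>)"
      if \<omega>: "\<omega> \<in> space M" and "l \<le> n" for l \<omega>
    proof -
      let ?f = "dunkl_drift Rp k" and ?fe = "trunc_drift Rp k \<epsilon>"
      define x where "x l = X (t l) \<omega>" for l
      \<comment> \<open>With this residual the exact solution satisfies the recursion of the scheme
        up to \<open>r\<close>: the truncated drift is taken at the right end of the step, and
        \<open>b\<close> at the left end.\<close>
      define r where "r l = x (Suc l) - x l - (B (t (Suc l)) \<omega> - B (t l) \<omega>)
        - h *\<^sub>R (?fe (x (Suc l)) + b (t l) (x l))" for l
      have r_le: "norm (r l) \<le> (2 * K1 + Lb + Hb) * (\<epsilon> + sqrt h) * integral {t l..t (Suc l)} (\<lambda>s. H l s \<omega>)"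
        if l: "l < n" for l
      proof -
        let ?G = "\<lambda>s. (?f (X s \<omega>) + b s (X s \<omega>)) - (?fe (x (Suc l)) + b (t l) (x l))"
        have tl: "t l \<in> {0..T}" "t (Suc l) \<in> {0..T}" using l tT by auto
        have dc: "continuous_on {t l..t (Suc l)} (\<lambda>s. ?f (X s \<omega>) + b s (X s \<omega>))"
          by (intro continuous_intros continuous_on_subset[OF drift_path_continuous[OF \<omega>] sub[OF l]]
              continuous_on_subset[OF b_path_continuous[OF \<omega>] sub[OF l]])
        have di: "(\<lambda>s. ?f (X s \<omega>) + b s (X s \<omega>)) integrable_on {t l..t (Suc l)}"
          using dc by (rule integrable_continuous_real)
        have "r l = integral {t l..t (Suc l)} (\<lambda>s. ?f (X s \<omega>) + b s (X s \<omega>))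
            - h *\<^sub>R (?fe (x (Suc l)) + b (t l) (x l))"
          using X_eq[OF _ le _ \<omega>, of l] tl by (simp add: r_def x_def)
        also have "\<dots> = integral {t l..t (Suc l)} ?G"
          using di h by (subst Henstock_Kurzweil_Integration.integral_diff) (auto simp: t_Suc)
        finally have "norm (r l) = norm (integral {t l..t (Suc l)} ?G)" by simp
        also have "\<dots> \<le> integral {t l..t (Suc l)} (\<lambda>s. (2 * K1 + Lb + Hb) * (\<epsilon> + sqrt h) * H l s \<omega>)"
        proof (rule integral_norm_bound_integral)
          show "?G integrable_on {t l..t (Suc l)}" using di by (intro integrable_diff) auto
          show "(\<lambda>s. (2 * K1 + Lb + Hb) * (\<epsilon> + sqrt h) * H l s \<omega>) integrable_on {t l..t (Suc l)}"
            by (intro integrable_continuous_real continuous_intros H_cont l \<omega>)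
          fix s assume s: "s \<in> {t l..t (Suc l)}"
          then have sT: "s \<in> {0..T}" using sub[OF l] by auto
          define u v a a' where "u = U s \<omega>" and "v = U (t (Suc l)) \<omega>"
            and "a = norm (X s \<omega> - X (t (Suc l)) \<omega>) / sqrt h" and "a' = norm (X s \<omega> - X (t l) \<omega>) / sqrt h"
          have nn: "0 \<le> u" "0 \<le> v" "0 \<le> a" "0 \<le> a'"
            using U_nn[OF sT \<omega>] U_nn[OF tl(2) \<omega>] h by (auto simp: u_def v_def a_def a'_def)
          have na: "norm (X s \<omega> - X (t (Suc l)) \<omega>) = sqrt h * a" "norm (X s \<omega> - X (t l) \<omega>) = sqrt h * a'"
            using h by (auto simp: a_def a'_def)
          have Heq: "H l s \<omega> = 1 + u ^ 3 + v ^ 3 + a ^ 3 + a' ^ 3"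
            by (simp add: H_def u_def v_def a_def a'_def)
          have Hge: "1 + u ^ 3 \<le> H l s \<omega>" "u ^ 3 + v ^ 3 + a ^ 3 \<le> H l s \<omega>" "1 + a' ^ 3 \<le> H l s \<omega>" "1 \<le> H l s \<omega>"
            unfolding Heq using nn by auto
          define \<eta> where "\<eta> = \<epsilon> + sqrt h"
          have \<eta>: "\<epsilon> \<le> \<eta>" "sqrt h \<le> \<eta>" "0 \<le> \<eta>" using \<epsilon> h by (auto simp: \<eta>_def)
          have "norm (?f (X s \<omega>) - ?fe (x (Suc l))) \<le> K1 * (\<epsilon> * u\<^sup>2 + sqrt h * a * u * v)"
            using trunc_drift_error[OF fin_Rp X_chamber[OF sT \<omega>] X_chamber[OF tl(2) \<omega>] \<epsilon>, of k]
            unfolding K1_def x_def u_def v_def U_def na .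
          also have "\<dots> \<le> K1 * (\<eta> * H l s \<omega> + \<eta> * H l s \<omega>)"
          proof (intro mult_left_mono add_mono K1)
            have "u\<^sup>2 \<le> H l s \<omega>" using power_le_one_plus_cube[OF nn(1), of 2] Hge(1) by simp
            then show "\<epsilon> * u\<^sup>2 \<le> \<eta> * H l s \<omega>" using \<eta> by (intro mult_mono) auto
            have "a * u * v \<le> H l s \<omega>" using mult3_le_cubes[OF nn(3,1,2)] Hge(2) by simp
            then have "sqrt h * (a * u * v) \<le> \<eta> * H l s \<omega>" using \<eta> nn by (intro mult_mono) auto
            then show "sqrt h * a * u * v \<le> \<eta> * H l s \<omega>" by (simp add: mult_ac)
          qed
          finally have 1: "norm (?f (X s \<omega>) - ?fe (x (Suc l))) \<le> 2 * K1 * \<eta> * H l s \<omega>" by simp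
          have "norm (b s (X s \<omega>) - b s (x l)) \<le> Lb * (sqrt h * a')"
            using b_lip[OF sT, of "X s \<omega>" "x l"] by (simp add: x_def na)
          also have "\<dots> \<le> Lb * (\<eta> * H l s \<omega>)"
            using power_le_one_plus_cube[OF nn(4), of 1] Hge(3) nn \<eta>
            by (intro mult_left_mono mult_mono Lb_nonneg) auto
          finally have 2: "norm (b s (X s \<omega>) - b s (x l)) \<le> Lb * \<eta> * H l s \<omega>" by simp
          have "norm (b s (x l) - b (t l) (x l)) \<le> Hb * sqrt \<bar>s - t l\<bar>" by (rule b_hoelder[OF sT tl(1)])
          also have "\<dots> \<le> Hb * (\<eta> * H l s \<omega>)"
          proof (intro mult_left_mono Hb_nonneg)
            have "sqrt \<bar>s - t l\<bar> \<le> sqrt h * 1" using s t_Suc[of l] by simp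
            also have "\<dots> \<le> \<eta> * H l s \<omega>" using \<eta> Hge(4) by (intro mult_mono) auto
            finally show "sqrt \<bar>s - t l\<bar> \<le> \<eta> * H l s \<omega>" .
          qed
          finally have 3: "norm (b s (x l) - b (t l) (x l)) \<le> Hb * \<eta> * H l s \<omega>" by simp
          \<comment> \<open>Three sources of error: truncation together with the move to the right
            end of the step, the variation of \<open>b\<close> in space, and its variation in
            time.\<close>
          have "?G s = (?f (X s \<omega>) - ?fe (x (Suc l))) + ((b s (X s \<omega>) - b s (x l)) + (b s (x l) - b (t l) (x l)))"
            by simp
          then have "norm (?G s) \<le> 2 * K1 * \<eta> * H l s \<omega> + (Lb * \<eta> * H l s \<omega> + Hb * \<eta> * H l s \<omega>)"
            using norm_triangle_mono[OF 1 norm_triangle_mono[OF 2 3]] by metis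
          then show "norm (?G s) \<le> (2 * K1 + Lb + Hb) * (\<epsilon> + sqrt h) * H l s \<omega>"
            by (simp add: \<eta>_def[symmetric] algebra_simps)
        qed
        also have "\<dots> = (2 * K1 + Lb + Hb) * (\<epsilon> + sqrt h) * integral {t l..t (Suc l)} (\<lambda>s. H l s \<omega>)"
          by simp
        finally show ?thesis .
      qed
      have "norm (x l - em_scheme Rp k b T x0 \<epsilon> n (\<lambda>t. B t \<omega>) l) \<le> exp (Lb * T) * (\<Sum>j<n. norm (r j))"
      proof (rule em_scheme_stability[OF \<epsilon> _ n cfl _ Lb_nonneg])
        show "0 \<le> T" using T by simp
        show "0 \<le> k \<alpha>" if "\<alpha> \<in> Rp" for \<alpha> using \<kappa>[OF that] \<kappa>_pos by simp
        show "norm (b (grid T n l) u - b (grid T n l) v) \<le> Lb * norm (u - v)" if "l < n" for l u v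
          using that by (intro b_lip grid_in) auto
        show "x 0 = x0" using X_init[OF \<omega>] by (simp add: x_def t_eq)
        show "x (Suc l) = x l + (B (grid T n (Suc l)) \<omega> - B (grid T n l) \<omega>)
          + (T / real n) *\<^sub>R (?fe (x (Suc l)) + b (grid T n l) (x l)) + r l" for l
          by (simp add: r_def t_def[symmetric] h_def[symmetric])
      qed (rule \<open>l \<le> n\<close>)
      also have "\<dots> \<le> exp (Lb * T) * (\<Sum>j<n. (2 * K1 + Lb + Hb) * (\<epsilon> + sqrt h) * integral {t j..t (Suc j)} (\<lambda>s. H j s \<omega>))"
        using r_le by (intro mult_left_mono sum_mono) auto
      also have "\<dots> = (\<epsilon> + sqrt h) * (K3 * S \<omega>)"
        unfolding sum_distrib_left[symmetric] S_def[symmetric] K3_def by (simp add: mult_ac)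
      finally show ?thesis by (simp add: x_def)
    qed
    show "\<exists>S. S \<in> borel_measurable M \<and> (\<forall>\<omega>\<in>space M. 0 \<le> S \<omega>) \<and>
      (\<forall>\<omega>\<in>space M. \<forall>l\<le>n. norm (X (grid T n l) \<omega> - em_scheme Rp k b T x0 \<epsilon> n (\<lambda>t. B t \<omega>) l)
        \<le> (\<epsilon> + sqrt (T / real n)) * S \<omega>) \<and>
      (\<integral>\<^sup>+\<omega>. S \<omega> powr p \<partial>M) \<le> ennreal (K3 powr p * (T powr p * CH))"
    proof (intro exI[of _ "\<lambda>\<omega>. K3 * S \<omega>"] conjI ballI allI impI)
      show "(\<lambda>\<omega>. K3 * S \<omega>) \<in> borel_measurable M" using S_meas by measurable
      show "0 \<le> K3 * S \<omega>" if "\<omega> \<in> space M" for \<omega> using K3 S_nn[OF that] by simp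
      show "norm (X (grid T n l) \<omega> - em_scheme Rp k b T x0 \<epsilon> n (\<lambda>t. B t \<omega>) l) \<le>
          (\<epsilon> + sqrt (T / real n)) * (K3 * S \<omega>)" if "\<omega> \<in> space M" "l \<le> n" for \<omega> l
        using resid[OF that] by (simp add: t_def h_def)
      have "(\<integral>\<^sup>+\<omega>. (K3 * S \<omega>) powr p \<partial>M) = (\<integral>\<^sup>+\<omega>. ennreal (K3 powr p) * ennreal (S \<omega> powr p) \<partial>M)"
        using K3 S_nn by (intro nn_integral_cong) (simp add: powr_mult ennreal_mult)
      also have "\<dots> = ennreal (K3 powr p) * (\<integral>\<^sup>+\<omega>. S \<omega> powr p \<partial>M)"
        using S_meas by (intro nn_integral_cmult) measurable
      also have "\<dots> \<le> ennreal (K3 powr p) * ennreal (T powr p * CH)"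
        by (intro mult_left_mono Sp) simp
      also have "\<dots> = ennreal (K3 powr p * (T powr p * CH))" using CH by (simp add: ennreal_mult)
      finally show "(\<integral>\<^sup>+\<omega>. (K3 * S \<omega>) powr p \<partial>M) \<le> ennreal (K3 powr p * (T powr p * CH))" .
    qed
  qed
qed

end

section \<open>Versions without exceptional paths and the final estimate\<close>

lemma borel_measurable_MAX:
  fixes f :: "'i \<Rightarrow> 'a \<Rightarrow> real"
  assumes "finite I" "I \<noteq> {}" "\<And>i. i \<in> I \<Longrightarrow> f i \<in> borel_measurable M"
  shows "(\<lambda>x. MAX i\<in>I. f i x) \<in> borel_measurable M"
  using assms
proof (induction I rule: finite_ne_induct)
  case (insert i I)
  then have "(\<lambda>x. MAX i\<in>insert i I. f i x) = (\<lambda>x. max (f i x) (MAX i\<in>I. f i x))" by simp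
  then show ?case using insert by simp
qed simp

text \<open>On the null set where the defining properties may fail, the process is frozen at its starting
  point and the Brownian path is redefined such that the integral equation still holds.\<close>

lemma dunkl_sde_modification:
  fixes M :: "'w measure" and B X :: "real \<Rightarrow> 'w \<Rightarrow> real ^ 'd"
  assumes T: "T > 0" and space: "usual_filtered_prob_space M F T" and bm: "brownian_motion M F T B"
    and root: "root_system R" and pos: "positive_root_system R Rp" and mult: "multiplicity_function R k"
    and \<kappa>: "\<And>\<alpha>. \<alpha> \<in> Rp \<Longrightarrow> \<kappa> \<le> k \<alpha>" "\<kappa> > 0"
    and bd: "bounded_drift T b" and lip: "lipschitz_in_space T b" and hoelder: "half_hoelder_in_time T b"
    and x0: "x0 \<in> weyl_chamber Rp" and X: "radial_dunkl_process M F T B Rp k b x0 X"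
  shows "\<exists>B' X' \<beta> Lb Hb. dunkl_sde M F T B' X' R Rp k b x0 \<beta> Lb Hb \<kappa> \<and>
    (AE \<omega> in M. \<forall>t. X' t \<omega> = X t \<omega> \<and> B' t \<omega> = B t \<omega>)"
proof -
  interpret usual_filtered_prob_space M F T by (rule space)
  obtain \<beta> where \<beta>: "\<And>t x. t \<in> {0..T} \<Longrightarrow> norm (b t x) \<le> \<beta>"
    using bd unfolding bounded_drift_def bounded_iff by fastforce
  obtain Lb where Lb: "\<And>t. t \<in> {0..T} \<Longrightarrow> Lb-lipschitz_on UNIV (b t)"
    using lip unfolding lipschitz_in_space_def by blast
  have Lb0: "Lb \<ge> 0" using Lb[of 0] T by (auto intro: lipschitz_on_nonneg)
  have b_lip: "norm (b t x - b t y) \<le> Lb * norm (x - y)" if "t \<in> {0..T}" for t x y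
    using lipschitz_onD[OF Lb[OF that], of x y] by (simp add: dist_norm)
  obtain H where H: "\<And>x s t. s \<in> {0..T} \<Longrightarrow> t \<in> {0..T} \<Longrightarrow> norm (b t x - b s x) \<le> H * \<bar>t - s\<bar> powr (1 / 2)"
    using hoelder unfolding half_hoelder_in_time_def by blast
  define Hb where "Hb = max H 0"
  have b_hoelder: "norm (b t x - b s x) \<le> Hb * sqrt \<bar>t - s\<bar>" if "t \<in> {0..T}" "s \<in> {0..T}" for s t x
  proof -
    have "norm (b t x - b s x) \<le> H * sqrt \<bar>t - s\<bar>"
      using H[OF that(2,1), of x] by (simp add: powr_half_sqrt)
    also have "\<dots> \<le> Hb * sqrt \<bar>t - s\<bar>" by (intro mult_right_mono) (auto simp: Hb_def)
    finally show ?thesis .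
  qed
  define good where "good \<omega> \<longleftrightarrow> B 0 \<omega> = 0 \<and> continuous_on {0..T} (\<lambda>t. B t \<omega>) \<and>
    continuous_on {0..T} (\<lambda>t. X t \<omega>) \<and> (\<forall>t\<in>{0..T}. X t \<omega> \<in> weyl_chamber Rp \<and>
      X t \<omega> = x0 + B t \<omega> + (\<Sum>\<alpha>\<in>Rp. integral {0..t} (\<lambda>s. (k \<alpha> / (\<alpha> \<bullet> X s \<omega>)) *\<^sub>R \<alpha>))
        + integral {0..t} (\<lambda>s. b s (X s \<omega>)))" for \<omega>
  have "AE \<omega> in M. good \<omega>"
    using bm X unfolding brownian_motion_def radial_dunkl_process_def good_def by auto
  then obtain N where N: "{\<omega>\<in>space M. \<not> good \<omega>} \<subseteq> N" "emeasure M N = 0" "N \<in> sets M"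
    by (rule AE_E)
  have good': "good \<omega>" if "\<omega> \<in> space M" "\<omega> \<notin> N" for \<omega>
    using N(1) that by blast
  have N_null: "N \<in> null_sets M" using N by auto
  \<comment> \<open>By the usual conditions the exceptional set belongs to every \<open>F t\<close>,
    so redefining the process on it preserves adaptedness.\<close>
  have N_F: "N \<in> sets (F t)" if "t \<in> {0..T}" for t
    using N_null null_sets_F sets_F_mono[of 0 t] that by auto
  have AE_N: "AE \<omega> in M. \<omega> \<notin> N" by (rule AE_not_in[OF N_null])
  define G where "G x r = dunkl_drift Rp k x + b r x" for x r
  define X' where "X' t \<omega> = (if \<omega> \<in> N then x0 else X t \<omega>)" for t \<omega>
  \<comment> \<open>Where the process is constant at \<open>x0\<close>, the equation forces the
    driving path to be minus the integrated drift at \<open>x0\<close>.\<close>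
  define B' where "B' t \<omega> = (if \<omega> \<in> N then - integral {0..t} (G x0) else B t \<omega>)" for t \<omega>
  have fin: "finite Rp" by (rule root_finite(2)[OF root pos])
  have X'_chamber: "X' t \<omega> \<in> weyl_chamber Rp" if "t \<in> {0..T}" "\<omega> \<in> space M" for t \<omega>
  proof (cases "\<omega> \<in> N")
    case False
    then have "X t \<omega> \<in> weyl_chamber Rp"
      using good'[OF that(2)] that(1) unfolding good_def by blast
    then show ?thesis using False by (simp add: X'_def)
  qed (use x0 in \<open>simp add: X'_def\<close>)
  have X'_cont: "continuous_on {0..T} (\<lambda>t. X' t \<omega>)" if "\<omega> \<in> space M" for \<omega>
    using good'[OF that] by (cases "\<omega> \<in> N") (auto simp: X'_def good_def)
  have nz: "\<alpha> \<bullet> X' t \<omega> \<noteq> 0" if "t \<in> {0..T}" "\<omega> \<in> space M" "\<alpha> \<in> Rp" for t \<omega> \<alpha>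
    using X'_chamber[OF that(1,2)] that(3) by (force simp: weyl_chamber_def)
  have term_cont: "continuous_on {0..T} (\<lambda>s. (k \<alpha> / (\<alpha> \<bullet> X' s \<omega>)) *\<^sub>R \<alpha>)"
    if "\<omega> \<in> space M" "\<alpha> \<in> Rp" for \<omega> \<alpha>
    using nz[OF _ that] by (intro continuous_intros X'_cont that(1)) auto
  have b_cont: "continuous_on {0..T} (\<lambda>s. b s (X' s \<omega>))" if "\<omega> \<in> space M" for \<omega>
    by (rule continuous_on_drift_path[OF X'_cont[OF that] b_lip b_hoelder])
  have G_cont: "continuous_on {0..T} (\<lambda>s. G (X' s \<omega>) s)" if "\<omega> \<in> space M" for \<omega>
    unfolding G_def dunkl_drift_def
    by (intro continuous_on_add continuous_on_sum term_cont b_cont that)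
  have G_int: "(\<lambda>s. G (X' s \<omega>) s) integrable_on {0..t}" if "\<omega> \<in> space M" "t \<in> {0..T}" for \<omega> t
    using that by (intro integrable_continuous_real continuous_on_subset[OF G_cont]) auto
  have X'_eq0: "X' t \<omega> = x0 + B' t \<omega> + integral {0..t} (\<lambda>s. G (X' s \<omega>) s)"
    if t: "t \<in> {0..T}" and \<omega>: "\<omega> \<in> space M" for t \<omega>
  proof (cases "\<omega> \<in> N")
    case False
    then have g: "good \<omega>" by (rule good'[OF \<omega>])
    have sub: "{0..t} \<subseteq> {0..T}" using t by auto
    have eqX: "X' s \<omega> = X s \<omega>" for s using False by (simp add: X'_def)
    have "integral {0..t} (\<lambda>s. G (X' s \<omega>) s) =
        (\<Sum>\<alpha>\<in>Rp. integral {0..t} (\<lambda>s. (k \<alpha> / (\<alpha> \<bullet> X' s \<omega>)) *\<^sub>R \<alpha>)) + integral {0..t} (\<lambda>s. b s (X' s \<omega>))"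
      unfolding G_def dunkl_drift_def
      by (subst Henstock_Kurzweil_Integration.integral_add, intro integrable_sum fin)
         (auto intro!: integral_sum fin integrable_continuous_real continuous_on_subset[OF term_cont[OF \<omega>] sub]
           continuous_on_subset[OF b_cont[OF \<omega>] sub])
    then show ?thesis using g t False unfolding good_def eqX by (simp add: B'_def)
  qed (simp add: X'_def B'_def)
  have incr_AE: "AE \<omega> in M. B' t \<omega> - B' s \<omega> = B t \<omega> - B s \<omega>" for s t
    using AE_N by eventually_elim (simp add: B'_def)
  have B_meas: "B t \<in> borel_measurable M" if "t \<in> {0..T}" for t
    using bm that
    by (intro measurable_from_subalg[OF subalgebra_F[OF that]]) (simp add: brownian_motion_def)
  have B'_meas: "B' t \<in> borel_measurable M" if "t \<in> {0..T}" for t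
    unfolding B'_def[abs_def] using N(3) B_meas[OF that] by (intro measurable_If_set) auto
  show ?thesis
  proof (intro exI conjI)
    show "AE \<omega> in M. \<forall>t. X' t \<omega> = X t \<omega> \<and> B' t \<omega> = B t \<omega>"
      using AE_N by eventually_elim (simp add: X'_def B'_def)
    show "dunkl_sde M F T B' X' R Rp k b x0 \<beta> Lb Hb \<kappa>"
    proof (unfold_locales)
      show "X' t \<in> borel_measurable (F t)" if t: "t \<in> {0..T}" for t
      proof -
        have "X t \<in> borel_measurable (F t)" using X t by (auto simp: radial_dunkl_process_def)
        moreover have "N \<inter> space (F t) \<in> sets (F t)" using N_F[OF t] by auto
        ultimately show ?thesis unfolding X'_def[abs_def] by (intro measurable_If_set) auto
      qed
      fix s t :: real assume st: "0 \<le> s" "s < t" "t \<le> T"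
      let ?W = "\<lambda>\<omega>. B t \<omega> - B s \<omega>" and ?W' = "\<lambda>\<omega>. B' t \<omega> - B' s \<omega>"
      have sT: "s \<in> {0..T}" "t \<in> {0..T}" using st by auto
      note [measurable] = sT[THEN B_meas] sT[THEN B'_meas]
      have ind: "indep_set (sets (F s)) {?W -` A \<inter> space M | A. A \<in> sets borel}"
        and dist: "distributed M lborel ?W (\<lambda>x. ennreal (\<Prod>i\<in>UNIV. normal_density 0 (sqrt (t - s)) (x $ i)))"
        using bm st unfolding brownian_motion_def by blast+
      have pre: "?W -` A \<inter> space M \<in> sets M" "?W' -` A \<inter> space M \<in> sets M" if [measurable]: "A \<in> sets borel" for A
        by measurable
      show "indep_set (sets (F s)) {?W' -` A \<inter> space M | A. A \<in> sets borel}"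
        unfolding indep_sets2_eq
      proof (intro conjI ballI)
        show F_sub: "sets (F s) \<subseteq> events" by (rule indep_setD_ev1[OF ind])
        show "{?W' -` A \<inter> space M | A. A \<in> sets borel} \<subseteq> events" using pre by auto
        fix E D assume E: "E \<in> sets (F s)" and "D \<in> {?W' -` A \<inter> space M | A. A \<in> sets borel}"
        then obtain A where A: "A \<in> sets borel" and D: "D = ?W' -` A \<inter> space M" by auto
        let ?D = "?W -` A \<inter> space M"
        have E_M: "E \<in> sets M" using E F_sub by auto
        \<comment> \<open>The increments change only on a null set, so the events keep their
          probabilities and the factorisation carries over.\<close>
        have ae: "AE \<omega> in M. \<omega> \<in> D \<longleftrightarrow> \<omega> \<in> ?D"
          using incr_AE[of t s] by eventually_elim (simp add: D)
        have "prob (E \<inter> D) = prob (E \<inter> ?D)"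
          using ae pre[OF A] E_M by (intro measure_eq_AE) (auto simp: D)
        also have "\<dots> = prob E * prob ?D" using A by (intro indep_setD[OF ind E]) auto
        also have "prob ?D = prob D" using ae pre[OF A] by (intro measure_eq_AE) (auto simp: D)
        finally show "prob (E \<inter> D) = prob E * prob D" .
      qed
      have "distr M lborel ?W' = distr M lborel ?W"
        by (intro distr_cong_AE incr_AE) measurable
      then show "gauss_vec (sqrt (t - s)) ?W'"
        using dist unfolding gauss_vec_def distributed_def by simp
    next
      fix \<omega> assume \<omega>: "\<omega> \<in> space M"
      show "continuous_on {0..T} (\<lambda>t. X' t \<omega>)" by (rule X'_cont[OF \<omega>])
      show "continuous_on {0..T} (\<lambda>t. B' t \<omega>)"
      proof -
        \<comment> \<open>On and off \<open>N\<close> alike, the integral equation expresses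
          \<open>B'\<close> through functions that are already known to be continuous.\<close>
        have "continuous_on {0..T} (\<lambda>t. X' t \<omega> - x0 - integral {0..t} (\<lambda>s. G (X' s \<omega>) s))"
          using T by (intro continuous_intros X'_cont \<omega> indefinite_integral_continuous_1 G_int) auto
        then show ?thesis
          by (rule continuous_on_cong[THEN iffD1, rotated 2]) (use X'_eq0[OF _ \<omega>] in auto)
      qed
      show "X' 0 \<omega> = x0"
        using X'_eq0[of 0 \<omega>] T \<omega> good'[OF \<omega>] by (auto simp: B'_def good_def)
    next
      fix s t :: real and \<omega> assume st: "0 \<le> s" "s \<le> t" "t \<le> T" and \<omega>: "\<omega> \<in> space M"
      have "integral {0..s} (\<lambda>s. G (X' s \<omega>) s) + integral {s..t} (\<lambda>s. G (X' s \<omega>) s) =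
          integral {0..t} (\<lambda>s. G (X' s \<omega>) s)"
        using st by (intro Henstock_Kurzweil_Integration.integral_combine G_int \<omega>) auto
      then show "X' t \<omega> = X' s \<omega> + (B' t \<omega> - B' s \<omega>)
          + integral {s..t} (\<lambda>r. dunkl_drift Rp k (X' r \<omega>) + b r (X' r \<omega>))"
        using X'_eq0[of s \<omega>] X'_eq0[of t \<omega>] st \<omega> by (simp add: G_def)
    qed (use T subalgebra_F sets_F_mono X'_chamber root pos mult \<kappa> \<beta> b_lip b_hoelder Lb0 in \<open>auto simp: Hb_def\<close>)
  qed
qed

text \<open>For \<open>p \<ge> 1\<close> the maximum of the powers is the power of the maximum.
  Integrability is asserted along with the bound because the integral of a non-integrable function
  is 0 by convention, and the bound alone would then say nothing.\<close>

theorem theorem4p8: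
  fixes M :: "'w measure" and F :: "real \<Rightarrow> 'w measure" and T :: real
    and B X :: "real \<Rightarrow> 'w \<Rightarrow> real ^ 'd"
    and R Rp :: "(real ^ 'd) set" and k :: "real ^ 'd \<Rightarrow> real"
    and b :: "real \<Rightarrow> real ^ 'd \<Rightarrow> real ^ 'd" and x0 :: "real ^ 'd"
  assumes "T > 0"
    and "usual_filtered_prob_space M F T"
    and "brownian_motion M F T B"
    and "root_system R" and "R \<noteq> {}"
    and "positive_root_system R Rp"
    and "multiplicity_function R k"
    and "(MIN \<alpha>\<in>Rp. dunkl_nu k \<alpha>) > 6"
    and "bounded_drift T b" and "lipschitz_in_space T b" and "half_hoelder_in_time T b"
    and "x0 \<in> weyl_chamber Rp"
    and "radial_dunkl_process M F T B Rp k b x0 X"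
  shows "\<forall>p\<in>{1..<(MIN \<alpha>\<in>Rp. dunkl_nu k \<alpha>) / 6}. \<exists>C>0. \<forall>n::nat. \<forall>\<epsilon>::real.
    n \<ge> 1 \<and> \<epsilon> \<in> {0<..<(MIN \<alpha>\<in>Rp. \<alpha> \<bullet> x0)} \<and> T / real n < \<epsilon>\<^sup>2 / trunc_const Rp k \<longrightarrow>
      (let err = \<lambda>\<omega>. MAX l\<in>{1..n}.
             norm (X (grid T n l) \<omega> - em_scheme Rp k b T x0 \<epsilon> n (\<lambda>t. B t \<omega>) l) powr p
       in integrable M err \<and>
          (\<integral>\<omega>. err \<omega> \<partial>M) powr (1 / p) \<le> C * (\<epsilon> + 1 / sqrt (real n)))"
proof
  fix p assume p: "p \<in> {1..<(MIN \<alpha>\<in>Rp. dunkl_nu k \<alpha>) / 6}"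
  \<comment> \<open>As \<open>dunkl_nu\<close> is \<open>k\<close> minus one half, this is the
    minimum of \<open>k\<close> over the positive roots.\<close>
  define \<kappa> where "\<kappa> = (MIN \<alpha>\<in>Rp. dunkl_nu k \<alpha>) + 1 / 2"
  have fin: "finite Rp" by (rule root_finite(2)[OF assms(4,6)])
  have \<kappa>: "\<kappa> \<le> k \<alpha>" if "\<alpha> \<in> Rp" for \<alpha>
  proof -
    have "(MIN \<alpha>\<in>Rp. dunkl_nu k \<alpha>) \<le> dunkl_nu k \<alpha>" using fin that by (intro Min_le) auto
    then show ?thesis by (simp add: \<kappa>_def dunkl_nu_def)
  qed
  have \<kappa>_pos: "\<kappa> > 0" using assms(8) by (simp add: \<kappa>_def)
  obtain B' X' \<beta> Lb Hb where sde: "dunkl_sde M F T B' X' R Rp k b x0 \<beta> Lb Hb \<kappa>"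
    and AE: "AE \<omega> in M. \<forall>t. X' t \<omega> = X t \<omega> \<and> B' t \<omega> = B t \<omega>"
    using dunkl_sde_modification[OF assms(1-4,6,7) \<kappa> \<kappa>_pos assms(9-13)] by blast
  interpret dunkl_sde M F T B' X' R Rp k b x0 \<beta> Lb Hb \<kappa> by (rule sde)
  \<comment> \<open>\<open>2 * \<kappa>\<close> is twice the minimum of \<open>dunkl_nu\<close> plus
    one, so the second claim says that \<open>3 * p\<close> is less than twice this minimum. The
    choice of \<open>p\<close> gives \<open>6 * p\<close> below the minimum, which is
    positive.\<close>
  have p1: "p \<ge> 1" and p2: "3 * p + 1 < 2 * \<kappa>" using p by (auto simp: \<kappa>_def)
  obtain C where C: "C \<ge> 0" and bound: "\<And>n \<epsilon>. 1 \<le> n \<Longrightarrow> 0 < \<epsilon> \<Longrightarrow> T / real n * trunc_const Rp k < \<epsilon>\<^sup>2 \<Longrightarrow>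
    \<exists>S. S \<in> borel_measurable M \<and> (\<forall>\<omega>\<in>space M. 0 \<le> S \<omega>) \<and>
      (\<forall>\<omega>\<in>space M. \<forall>l\<le>n. norm (X' (grid T n l) \<omega> - em_scheme Rp k b T x0 \<epsilon> n (\<lambda>t. B' t \<omega>) l)
        \<le> (\<epsilon> + sqrt (T / real n)) * S \<omega>) \<and>
      (\<integral>\<^sup>+\<omega>. S \<omega> powr p \<partial>M) \<le> ennreal C"
    using scheme_error_bound[OF p1 p2] by metis
  \<comment> \<open>\<open>K\<close> absorbs \<open>sqrt T\<close> from
    \<open>sqrt (T / real n)\<close>; the summand \<open>1\<close> in \<open>D\<close> keeps the
    constant positive when \<open>C\<close> is 0.\<close>
  define K where "K = max 1 (sqrt T)"
  define D where "D = C powr (1 / p) * K + 1"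
  show "\<exists>C>0. \<forall>n::nat. \<forall>\<epsilon>::real.
    n \<ge> 1 \<and> \<epsilon> \<in> {0<..<(MIN \<alpha>\<in>Rp. \<alpha> \<bullet> x0)} \<and> T / real n < \<epsilon>\<^sup>2 / trunc_const Rp k \<longrightarrow>
      (let err = \<lambda>\<omega>. MAX l\<in>{1..n}.
             norm (X (grid T n l) \<omega> - em_scheme Rp k b T x0 \<epsilon> n (\<lambda>t. B t \<omega>) l) powr p
       in integrable M err \<and>
          (\<integral>\<omega>. err \<omega> \<partial>M) powr (1 / p) \<le> C * (\<epsilon> + 1 / sqrt (real n)))"
  proof (intro exI[of _ D] conjI allI impI)
    show "D > 0" using C by (auto simp: D_def K_def intro!: add_nonneg_pos mult_nonneg_nonneg)
    fix n :: nat and \<epsilon> :: real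
    assume *: "n \<ge> 1 \<and> \<epsilon> \<in> {0<..<(MIN \<alpha>\<in>Rp. \<alpha> \<bullet> x0)} \<and> T / real n < \<epsilon>\<^sup>2 / trunc_const Rp k"
    then have n: "1 \<le> n" and \<epsilon>: "0 < \<epsilon>" by auto
    \<comment> \<open>If \<open>trunc_const\<close> were 0, the quotient in the assumption would be
      0 by the convention for division and could not exceed \<open>T / real n\<close>. So it is
      positive and the condition can be multiplied out.\<close>
    have cfl: "T / real n * trunc_const Rp k < \<epsilon>\<^sup>2"
    proof -
      have "0 \<le> trunc_const Rp k" by (simp add: trunc_const_def sum_nonneg)
      moreover have "0 < T / real n" using assms(1) n by simp
      then have "trunc_const Rp k \<noteq> 0" using * by auto
      ultimately have "0 < trunc_const Rp k" by simp
      then show ?thesis using * by (simp add: pos_less_divide_eq)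
    qed
    let ?y = "\<lambda>\<omega>. em_scheme Rp k b T x0 \<epsilon> n (\<lambda>t. B t \<omega>)"
    define err where "err \<omega> = (MAX l\<in>{1..n}. norm (X (grid T n l) \<omega> - ?y \<omega> l) powr p)" for \<omega>
    obtain S where S_meas: "S \<in> borel_measurable M" and S_nn: "\<forall>\<omega>\<in>space M. 0 \<le> S \<omega>"
      and S: "\<forall>\<omega>\<in>space M. \<forall>l\<le>n. norm (X' (grid T n l) \<omega> - em_scheme Rp k b T x0 \<epsilon> n (\<lambda>t. B' t \<omega>) l)
        \<le> (\<epsilon> + sqrt (T / real n)) * S \<omega>"
      and Sp: "(\<integral>\<^sup>+\<omega>. S \<omega> powr p \<partial>M) \<le> ennreal C"
      using bound[OF n \<epsilon> cfl] by blast
    define \<eta> where "\<eta> = \<epsilon> + sqrt (T / real n)"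
    have \<eta>: "\<eta> \<ge> 0" using \<epsilon> assms(1) by (simp add: \<eta>_def)
    have X_meas: "X t \<in> borel_measurable M" if "t \<in> {0..T}" for t
      using assms(13) that
      by (intro measurable_from_subalg[OF subalg[OF that]]) (simp add: radial_dunkl_process_def)
    have B_meas: "B t \<in> borel_measurable M" if "t \<in> {0..T}" for t
      using assms(3) that
      by (intro measurable_from_subalg[OF subalg[OF that]]) (simp add: brownian_motion_def)
    have b_meas: "b t \<in> borel_measurable borel" if "t \<in> {0..T}" for t
    proof -
      obtain L where "L-lipschitz_on UNIV (b t)"
        using assms(10) \<open>t \<in> {0..T}\<close> unfolding lipschitz_in_space_def by blast
      then show ?thesis
        by (intro borel_measurable_continuous_onI lipschitz_on_continuous_on)
    qed
    have y_meas: "(\<lambda>\<omega>. ?y \<omega> l) \<in> borel_measurable M" if "l \<le> n" for l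
    proof (rule em_scheme_measurable[OF \<epsilon> _ cfl _ _ _ that])
      show "0 \<le> k \<alpha>" if "\<alpha> \<in> Rp" for \<alpha> using \<kappa>[OF that] \<kappa>_pos by simp
    qed (use assms(1) B_meas b_meas grid_in in auto)
    have err_meas: "err \<in> borel_measurable M"
      unfolding err_def[abs_def]
    proof (rule borel_measurable_MAX)
      fix l assume "l \<in> {1..n}"
      then have "l \<le> n" by simp
      note [measurable] = X_meas[OF grid_in[OF this]] y_meas[OF this]
      show "(\<lambda>\<omega>. norm (X (grid T n l) \<omega> - ?y \<omega> l) powr p) \<in> borel_measurable M" by measurable
    qed (use n in auto)
    have err_nn: "0 \<le> err \<omega>" for \<omega>
      unfolding err_def using n by (subst Max_ge_iff) (auto intro!: bexI[of _ 1])
    \<comment> \<open>The bound is available for the modified processes, which agree with the given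
      ones almost everywhere.\<close>
    have err_le: "AE \<omega> in M. ennreal (err \<omega>) \<le> ennreal (\<eta> powr p) * ennreal (S \<omega> powr p)"
      using AE
    proof (rule AE_mp, intro AE_I2 impI)
      fix \<omega> assume \<omega>: "\<omega> \<in> space M" and eq: "\<forall>t. X' t \<omega> = X t \<omega> \<and> B' t \<omega> = B t \<omega>"
      have "norm (X (grid T n l) \<omega> - ?y \<omega> l) powr p \<le> (\<eta> * S \<omega>) powr p" if "l \<in> {1..n}" for l
        using S \<omega> eq that p1 by (intro powr_mono2) (auto simp: \<eta>_def)
      then have "err \<omega> \<le> (\<eta> * S \<omega>) powr p"
        unfolding err_def using n by (subst Max_le_iff) auto
      then show "ennreal (err \<omega>) \<le> ennreal (\<eta> powr p) * ennreal (S \<omega> powr p)"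
        using \<eta> S_nn \<omega> by (simp add: powr_mult ennreal_mult[symmetric] ennreal_leI)
    qed
    have "(\<integral>\<^sup>+\<omega>. err \<omega> \<partial>M) \<le> (\<integral>\<^sup>+\<omega>. ennreal (\<eta> powr p) * ennreal (S \<omega> powr p) \<partial>M)"
      by (rule nn_integral_mono_AE[OF err_le])
    also have "\<dots> = ennreal (\<eta> powr p) * (\<integral>\<^sup>+\<omega>. S \<omega> powr p \<partial>M)"
      using S_meas by (intro nn_integral_cmult) measurable
    also have "\<dots> \<le> ennreal (\<eta> powr p) * ennreal C"
      by (intro mult_left_mono Sp) simp
    also have "\<dots> = ennreal (\<eta> powr p * C)" using C by (simp add: ennreal_mult)
    finally have nn: "(\<integral>\<^sup>+\<omega>. err \<omega> \<partial>M) \<le> ennreal (\<eta> powr p * C)" .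
    have int: "integrable M err" and le: "(\<integral>\<omega>. err \<omega> \<partial>M) \<le> \<eta> powr p * C"
      using integral_le_of_nn_integral_le[OF err_meas err_nn nn] C by auto
    have "(\<integral>\<omega>. err \<omega> \<partial>M) powr (1 / p) \<le> (\<eta> powr p * C) powr (1 / p)"
      using le err_nn p1 by (intro powr_mono2 integral_nonneg_AE) auto
    also have "\<dots> = \<eta> * C powr (1 / p)"
      using \<eta> C p1 by (simp add: powr_mult powr_powr)
    also have "\<dots> \<le> (K * (\<epsilon> + 1 / sqrt (real n))) * C powr (1 / p)"
    proof (rule mult_right_mono)
      have "1 * \<epsilon> \<le> K * \<epsilon>" "sqrt T * (1 / sqrt (real n)) \<le> K * (1 / sqrt (real n))"
        using \<epsilon> by (auto simp: K_def intro!: mult_right_mono divide_right_mono)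
      then show "\<eta> \<le> K * (\<epsilon> + 1 / sqrt (real n))"
        by (simp add: \<eta>_def real_sqrt_divide algebra_simps)
    qed simp
    also have "\<dots> \<le> D * (\<epsilon> + 1 / sqrt (real n))"
      using \<epsilon> by (simp add: D_def algebra_simps)
    finally have "(\<integral>\<omega>. err \<omega> \<partial>M) powr (1 / p) \<le> D * (\<epsilon> + 1 / sqrt (real n))" .
    then show "let err = \<lambda>\<omega>. MAX l\<in>{1..n}. norm (X (grid T n l) \<omega> - ?y \<omega> l) powr p
       in integrable M err \<and> (\<integral>\<omega>. err \<omega> \<partial>M) powr (1 / p) \<le> D * (\<epsilon> + 1 / sqrt (real n))"
      using int unfolding Let_def err_def[abs_def] by simp
  qed
qed

end
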